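(* For any compact (Hausdorff) group $G$ there exists a finite group $H$ such that $${\rm cp}(G)=\frac{{\rm cp}(H)}{|G:FC(G)|^2}.$$ In particular, if ${\rm cp}(G)>0$, the finite group $H$ can be chosen so that it is isoclinic to $FC(G)$ and ${\rm cp}(FC(G))={\rm cp}(H)$.
   Context: All compact groups are Hausdorff topological groups. For a compact group $G$, ${\mathbf m}_G$ denotes its unique normalized Haar measure (${\mathbf m}_G(G)=1$), and the commuting probability of $G$ is ${\rm cp}(G):={\mathbf m}_{G\times G}(\{(x,y)\in G\times G \mid xy=yx\})$; the set in question is closed in $G\times G$, hence measurable. A finite group is regarded as a compact group with the discrete topology, so its Haar measure is normalized counting measure. The FC-center $FC(G)$ of $G$ is the subgroup consisting of all elements of $G$ whose conjugacy classes in $G$ are finite. $|G:FC(G)|$ is its index in $G$; by convention, if $|G:FC(G)|$ is infinite then $\frac{1}{|G:FC(G)|}=0$ (so that $\frac{1}{|G:FC(G)|^2}=0$). It is a known result that if ${\rm cp}(G)>0$ then the center $Z(FC(G))$ of $FC(G)$ is open in $G$; hence in this case $FC(G)$ is an open (so closed) subgroup of $G$, thus itself a compact group, and ${\rm cp}(FC(G))$ is defined. For a group $T$, $Z(T)$ denotes its center, $T'$ its derived subgroup, and $[x,y]$ the commutator of $x,y$. Two groups $H$ and $K$ are called isoclinic if there exist group isomorphisms $\alpha:H/Z(H)\rightarrow K/Z(K)$ and $\beta:H'\rightarrow K'$ such that for all $x,y\in H$ and all $x'\in (xZ(H))^\alpha$ and $y'\in (yZ(H))^\alpha$ one has $[x',y']=[x,y]^\beta$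 (exponents denote images under the maps; the coset $(xZ(H))^\alpha$ of $Z(K)$ is viewed as a subset of $K$). *)

theory Defs
  imports "HOL-Analysis.Analysis" "HOL-Algebra.Generated_Groups"
begin

text \<open>A compact group is a group together with an abstract topology on its carrier, so that
  subgroups and products of compact groups can again be treated as compact groups.\<close>

locale compact_group = group G for G :: "('a, 'b) monoid_scheme" (structure) +
  fixes T :: "'a topology"
  assumes topspace_eq: "topspace T = carrier G"
    and continuous_mult: "continuous_map (prod_topology T T) T (\<lambda>(x, y). x \<otimes> y)"
    and continuous_inv: "continuous_map T T (m_inv G)"
    and compact: "compact_space T"
    and Hausdorff: "Hausdorff_space T"

definition borel_sets_of :: "'a topology \<Rightarrow> 'a set set" where
  "borel_sets_of T = sigma_sets (topspace T) {U. openin T U}"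

text \<open>A normalized Haar measure is a left-invariant Radon probability measure on the Borel sets.
  Regularity has to be demanded explicitly because the group need not be metrizable.\<close>

definition is_normalized_haar ::
  "('a, 'b) monoid_scheme \<Rightarrow> 'a topology \<Rightarrow> 'a measure \<Rightarrow> bool" where
  "is_normalized_haar G T M \<longleftrightarrow>
     space M = topspace T \<and> sets M = borel_sets_of T \<and>
     emeasure M (space M) = 1 \<and>
     (\<forall>g \<in> carrier G. \<forall>A \<in> sets M. emeasure M (g <#\<^bsub>G\<^esub> A) = emeasure M A) \<and>
     (\<forall>A \<in> sets M. emeasure M A = (INF U \<in> {U. openin T U \<and> A \<subseteq> U}. emeasure M U)) \<and>
     (\<forall>U. openin T U \<longrightarrow>
        emeasure M U = (SUP K \<in> {K. compactin T K \<and> K \<subseteq> U}. emeasure M K))"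

text \<open>For compact groups the choice is unambiguous, since the normalized Haar measure exists
  and is unique.\<close>

definition haar :: "('a, 'b) monoid_scheme \<Rightarrow> 'a topology \<Rightarrow> 'a measure" where
  "haar G T = (SOME M. is_normalized_haar G T M)"

text \<open>The measure is the Haar measure of the topological group \<open>G \<times> G\<close>. It lives on the Borel sets
  of the product topology; the commuting set need not belong to the product of the two
  Borel \<open>\<sigma>\<close>-algebras.\<close>

definition cp :: "('a, 'b) monoid_scheme \<Rightarrow> 'a topology \<Rightarrow> real" where
  "cp G T = measure (haar (G \<times>\<times> G) (prod_topology T T))
     {(x, y). x \<in> carrier G \<and> y \<in> carrier G \<and> x \<otimes>\<^bsub>G\<^esub> y = y \<otimes>\<^bsub>G\<^esub> x}"

definition conj_class :: "('a, 'b) monoid_scheme \<Rightarrow> 'a \<Rightarrow> 'a set" where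
  "conj_class G x = {g \<otimes>\<^bsub>G\<^esub> x \<otimes>\<^bsub>G\<^esub> inv\<^bsub>G\<^esub> g | g. g \<in> carrier G}"

definition FC :: "('a, 'b) monoid_scheme \<Rightarrow> 'a set" where
  "FC G = {x \<in> carrier G. finite (conj_class G x)}"

definition subgroup_of :: "('a, 'b) monoid_scheme \<Rightarrow> 'a set \<Rightarrow> ('a, 'b) monoid_scheme" where
  "subgroup_of G S = G\<lparr>carrier := S\<rparr>"

text \<open>\<open>1 / |G : S|\<close>, with the convention that it is \<open>0\<close> for infinite index.\<close>

definition inverse_index :: "('a, 'b) monoid_scheme \<Rightarrow> 'a set \<Rightarrow> real" where
  "inverse_index G S =
     (if finite (rcosets\<^bsub>G\<^esub> S) then 1 / real (card (rcosets\<^bsub>G\<^esub> S)) else 0)"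

definition center :: "('a, 'b) monoid_scheme \<Rightarrow> 'a set" where
  "center G = {z \<in> carrier G. \<forall>x \<in> carrier G. z \<otimes>\<^bsub>G\<^esub> x = x \<otimes>\<^bsub>G\<^esub> z}"

text \<open>The convention \<open>[x, y] = x y x\<^sup>-\<^sup>1 y\<^sup>-\<^sup>1\<close> is the one underlying \<^const>\<open>derived\<close>. With
  \<open>x\<^sup>-\<^sup>1 y\<^sup>-\<^sup>1 x y\<close> instead, isoclinism would be the same relation (replace \<open>x\<close>, \<open>y\<close> by their
  inverses).\<close>

definition commutator :: "('a, 'b) monoid_scheme \<Rightarrow> 'a \<Rightarrow> 'a \<Rightarrow> 'a" where
  "commutator G x y = x \<otimes>\<^bsub>G\<^esub> y \<otimes>\<^bsub>G\<^esub> inv\<^bsub>G\<^esub> x \<otimes>\<^bsub>G\<^esub> inv\<^bsub>G\<^esub> y"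

definition derived_subgroup :: "('a, 'b) monoid_scheme \<Rightarrow> ('a, 'b) monoid_scheme" where
  "derived_subgroup G = subgroup_of G (derived G (carrier G))"

definition isoclinic :: "('a, 'b) monoid_scheme \<Rightarrow> ('c, 'd) monoid_scheme \<Rightarrow> bool" where
  "isoclinic H K \<longleftrightarrow>
     (\<exists>\<alpha> \<in> iso (H Mod center H) (K Mod center K).
      \<exists>\<beta> \<in> iso (derived_subgroup H) (derived_subgroup K).
        \<forall>x \<in> carrier H. \<forall>y \<in> carrier H.
        \<forall>x' \<in> \<alpha> (center H #>\<^bsub>H\<^esub> x). \<forall>y' \<in> \<alpha> (center H #>\<^bsub>H\<^esub> y).
          commutator K x' y' = \<beta> (commutator H x y))"

end

theory Submission
  imports Defs "HOL-Algebra.Weak_Morphisms"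
begin

text \<open>Let \<open>F\<close> be the FC-center of the compact group \<open>G\<close>, and \<open>C\<close> the set of commuting pairs.

  The commuting probability is the value of a chosen Haar measure of \<open>G \<times> G\<close>, so the existence of Haar
  measure has to be proved (\<open>exists_normalized_haar\<close>): normalized covering numbers have a cluster
  point, a left-invariant content on compact sets, whose outer measure is regular. Uniqueness
  is not needed, because everything below follows from left invariance and regularity.

  If the conjugates of \<open>x\<close> by \<open>g\<^sub>0, \<dots>, g\<^sub>n\<close> are distinct, this remains true on a neighbourhood \<open>U\<close>
  of \<open>x\<close>, and the translates of \<open>C \<inter> (U \<times> G)\<close> by the elements \<open>(1, g\<^sub>i)\<close> are disjoint; hence
  \<open>C \<inter> (U \<times> G)\<close> has at most \<open>1 / (n + 1)\<close> times the measure of \<open>U \<times> G\<close>. This replaces Fubini's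
  theorem, and with regularity it shows that almost all of \<open>C\<close> lies in \<open>F \<times> F\<close>
  (\<open>measure_commuting_pairs\<close>). If \<open>F\<close> has infinite index, \<open>F \<times> G\<close> is a null set and both sides of the
  claim vanish.

  If \<open>F\<close> has finite index, Baire's theorem gives a nonempty open set of elements with boundedly many
  conjugates, and from it follows that \<open>F\<close> is closed and that its center has finite index
  (\<open>center_FC_finite_index\<close>). Then \<open>C \<inter> (F \<times> F)\<close> is a union of cosets of \<open>Z(F) \<times> Z(F)\<close>, and counting
  cosets gives \<open>cp(G) = cp(F) / |G : F|\<^sup>2\<close>. The same count shows that \<open>cp\<close> is invariant under
  isoclinism of compact groups whose centers have finite index (\<open>isoclinic_transversal_card\<close>).

  It remains to find a finite group isoclinic to \<open>F\<close> (\<open>finite_isoclinic\<close>). As \<open>F\<close> is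
  central-by-finite, it is \<open>K Z(F)\<close> for a subgroup \<open>K\<close> with finitely generated central part. The transfer
  into the center shows that central elements of the derived subgroup are torsion, so a torsion-free
  subgroup \<open>A\<close> of finite index in the central part meets the derived subgroup trivially, and \<open>K / A\<close> is
  finite and isoclinic to \<open>F\<close>.\<close>

section \<open>Cosets, centralizers and the FC-center\<close>

lemma l_coset_image: "g <#\<^bsub>G\<^esub> A = (\<lambda>x. g \<otimes>\<^bsub>G\<^esub> x) ` A"
  by (auto simp: l_coset_def)

context group
begin

lemma mem_l_coset_iff:
  assumes "g \<in> carrier G" "A \<subseteq> carrier G"
  shows "x \<in> g <# A \<longleftrightarrow> x \<in> carrier G \<and> inv g \<otimes> x \<in> A"
proof
  assume "x \<in> g <# A"
  then show "x \<in> carrier G \<and> inv g \<otimes> x \<in> A"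
    using assms by (auto simp: l_coset_image m_assoc[symmetric] subset_iff)
next
  assume x: "x \<in> carrier G \<and> inv g \<otimes> x \<in> A"
  then have "x = g \<otimes> (inv g \<otimes> x)" using assms by (simp add: m_assoc[symmetric])
  then show "x \<in> g <# A" using x unfolding l_coset_image by blast
qed

lemma l_coset_subset_carrier: "g \<in> carrier G \<Longrightarrow> A \<subseteq> carrier G \<Longrightarrow> g <# A \<subseteq> carrier G"
  by (auto simp: l_coset_image)

lemma l_coset_assoc:
  assumes "g \<in> carrier G" "h \<in> carrier G" "A \<subseteq> carrier G"
  shows "g <# (h <# A) = (g \<otimes> h) <# A"
  using assms by (force simp: l_coset_image image_image m_assoc intro!: image_cong)

lemma l_coset_one: "A \<subseteq> carrier G \<Longrightarrow> \<one> <# A = A"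
  by (force simp: l_coset_image)

end

lemma (in group) r_coset_eq_iff:
  assumes "subgroup H G" "a \<in> carrier G" "b \<in> carrier G"
  shows "H #> a = H #> b \<longleftrightarrow> a \<otimes> inv b \<in> H"
proof
  assume "H #> a = H #> b"
  then have "a \<in> H #> b" using rcos_self[OF assms(2,1)] by simp
  then show "a \<otimes> inv b \<in> H" using subgroup.rcos_module_imp[OF assms(1)] assms(3) is_group by blast
next
  assume "a \<otimes> inv b \<in> H"
  then have "a \<in> H #> b" using subgroup.rcos_module_rev[OF assms(1) is_group] assms(2,3) by blast
  then show "H #> a = H #> b" using repr_independence[OF _ assms(3,1)] by simp
qed

text \<open>The index is counted by right cosets, but left cosets have a known measure. Inverses of
  representatives of right cosets represent left cosets.\<close>

lemma (in group) rcosets_representatives: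
  assumes H: "subgroup H G" and X: "\<X> \<subseteq> rcosets H" "finite \<X>"
  obtains S where "S \<subseteq> carrier G" "finite S" "card S = card \<X>"
    "\<forall>s\<in>S. \<forall>t\<in>S. inv s \<otimes> t \<in> H \<longrightarrow> s = t"
    "\<forall>x\<in>carrier G. H #> inv x \<in> \<X> \<longrightarrow> (\<exists>s\<in>S. inv s \<otimes> x \<in> H)"
proof -
  have "\<forall>X\<in>\<X>. \<exists>a\<in>carrier G. X = H #> a" using X by (auto simp: RCOSETS_def)
  then obtain r where r: "\<And>X. X \<in> \<X> \<Longrightarrow> r X \<in> carrier G" "\<And>X. X \<in> \<X> \<Longrightarrow> H #> r X = X"
    by metis
  have key: "X = Y" if "X \<in> \<X>" "Y \<in> \<X>" "r X \<otimes> inv (r Y) \<in> H" for X Y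
    using r_coset_eq_iff[OF H, of "r X" "r Y"] r that by auto
  show ?thesis
  proof (rule that[of "(\<lambda>X. inv (r X)) ` \<X>"])
    have "inj_on (\<lambda>X. inv (r X)) \<X>"
    proof (rule inj_onI)
      fix X Y assume XY: "X \<in> \<X>" "Y \<in> \<X>" "inv (r X) = inv (r Y)"
      have "r X = inv (inv (r X))" using r(1)[OF XY(1)] by simp
      also have "\<dots> = r Y" unfolding XY(3) using r(1)[OF XY(2)] by simp
      finally have "r X = r Y" .
      then have "H #> r X = H #> r Y" by simp
      then show "X = Y" using XY r(2) by simp
    qed
    then show "card ((\<lambda>X. inv (r X)) ` \<X>) = card \<X>" by (rule card_image)
    show "\<forall>s\<in>(\<lambda>X. inv (r X)) ` \<X>. \<forall>t\<in>(\<lambda>X. inv (r X)) ` \<X>. inv s \<otimes> t \<in> H \<longrightarrow> s = t"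
      by (auto simp: r(1) dest: key)
    show "\<forall>x\<in>carrier G. H #> inv x \<in> \<X> \<longrightarrow> (\<exists>s\<in>(\<lambda>X. inv (r X)) ` \<X>. inv s \<otimes> x \<in> H)"
    proof (intro ballI impI)
      fix x assume x: "x \<in> carrier G" "H #> inv x \<in> \<X>"
      then have "r (H #> inv x) \<otimes> inv (inv x) \<in> H"
        using r_coset_eq_iff[OF H, of "r (H #> inv x)" "inv x"] r by auto
      then show "\<exists>s\<in>(\<lambda>X. inv (r X)) ` \<X>. inv s \<otimes> x \<in> H"
        using x r by (intro bexI[of _ "inv (r (H #> inv x))"]) auto
    qed
  qed (use X r in auto)
qed

lemma (in group) l_cosets_disjoint:
  assumes H: "subgroup H G" and S: "S \<subseteq> carrier G" "\<forall>s\<in>S. \<forall>t\<in>S. inv s \<otimes> t \<in> H \<longrightarrow> s = t"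
  shows "disjoint_family_on (\<lambda>s. s <# H) S"
  unfolding disjoint_family_on_def
proof (intro ballI impI)
  fix s t assume st: "s \<in> S" "t \<in> S" "s \<noteq> t"
  have HG: "H \<subseteq> carrier G" using subgroup.subset[OF H] .
  show "(s <# H) \<inter> (t <# H) = {}"
  proof (rule ccontr)
    assume "\<not> ?thesis"
    then obtain h k where hk: "h \<in> H" "k \<in> H" "s \<otimes> h = t \<otimes> k" by (auto simp: l_coset_image)
    have c: "s \<in> carrier G" "t \<in> carrier G" "h \<in> carrier G" "k \<in> carrier G" using hk HG S st by auto
    have "inv s \<otimes> t = inv s \<otimes> (t \<otimes> k) \<otimes> inv k" using c by (simp add: m_assoc)
    also have "\<dots> = h \<otimes> inv k" using c by (simp add: hk(3)[symmetric] m_assoc[symmetric])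
    also have "\<dots> \<in> H" using hk H by (simp add: subgroup.m_closed subgroup.m_inv_closed)
    finally show False using S st by auto
  qed
qed

lemma (in group) left_coset_cover:
  assumes "S \<subseteq> carrier G" "x \<in> carrier G" "\<exists>s\<in>S. inv s \<otimes> x \<in> H" "H \<subseteq> carrier G"
  shows "x \<in> (\<Union>s\<in>S. s <# H)"
  using assms mem_l_coset_iff[of _ H x] by blast

lemma (in group) DirProd_l_coset:
  "(g, h) <#\<^bsub>G \<times>\<times> G\<^esub> (A \<times> B) = (g <# A) \<times> (h <# B)"
  by (auto simp: l_coset_def)

lemma conj_class_image: "conj_class G x = (\<lambda>g. g \<otimes>\<^bsub>G\<^esub> x \<otimes>\<^bsub>G\<^esub> inv\<^bsub>G\<^esub> g) ` carrier G"
  by (auto simp: conj_class_def)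

context group
begin

lemma inv_mult_cancel: "g \<in> carrier G \<Longrightarrow> x \<in> carrier G \<Longrightarrow> inv g \<otimes> (g \<otimes> x) = x"
  and mult_inv_cancel: "g \<in> carrier G \<Longrightarrow> x \<in> carrier G \<Longrightarrow> g \<otimes> (inv g \<otimes> x) = x"
  by (simp_all add: m_assoc[symmetric])

text \<open>With the simplification rules for groups this is the complete rewriting system for free
  groups, so it proves every equation that holds in all groups.\<close>

lemmas group_normalize = m_assoc inv_mult_group inv_mult_cancel mult_inv_cancel

lemma conj_mult_commuting:
  assumes "g \<in> carrier G" "x \<in> carrier G" "y \<in> carrier G" "x \<otimes> y = y \<otimes> x"
  shows "(g \<otimes> y) \<otimes> x \<otimes> inv (g \<otimes> y) = g \<otimes> x \<otimes> inv g"
proof -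
  have "(g \<otimes> y) \<otimes> x = g \<otimes> x \<otimes> y" using assms by (simp add: m_assoc)
  then show ?thesis using assms(1-3) by (simp add: group_normalize)
qed

lemma conj_eq_iff:
  assumes "x \<in> carrier G" "g \<in> carrier G" "h \<in> carrier G"
  shows "g \<otimes> x \<otimes> inv g = h \<otimes> x \<otimes> inv h \<longleftrightarrow> (inv h \<otimes> g) \<otimes> x = x \<otimes> (inv h \<otimes> g)"
proof -
  have "g \<otimes> x \<otimes> inv g = h \<otimes> x \<otimes> inv h \<longleftrightarrow> g \<otimes> x = h \<otimes> x \<otimes> inv h \<otimes> g"
    using assms by (metis inv_solve_right m_closed inv_closed)
  also have "\<dots> \<longleftrightarrow> g \<otimes> x = h \<otimes> (x \<otimes> inv h \<otimes> g)"
    using assms by (simp add: m_assoc)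
  also have "\<dots> \<longleftrightarrow> inv h \<otimes> (g \<otimes> x) = x \<otimes> inv h \<otimes> g"
    using assms by (metis inv_solve_left m_closed inv_closed)
  finally show ?thesis using assms by (simp add: m_assoc)
qed

lemma subgroup_FC: "subgroup (FC G) G"
proof (rule subgroupI)
  show "FC G \<subseteq> carrier G" by (auto simp: FC_def)
  have "conj_class G \<one> \<subseteq> {\<one>}" by (auto simp: conj_class_def)
  then have "\<one> \<in> FC G" by (auto simp: FC_def intro: finite_subset)
  then show "FC G \<noteq> {}" by auto
  fix x assume x: "x \<in> FC G"
  then have "conj_class G (inv x) \<subseteq> m_inv G ` conj_class G x"
  proof -
    have "g \<otimes> inv x \<otimes> inv g = inv (g \<otimes> x \<otimes> inv g)" if "g \<in> carrier G" for g
      using x that by (simp add: FC_def inv_mult_group m_assoc)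
    then show ?thesis by (auto simp: conj_class_image)
  qed
  then show "inv x \<in> FC G"
    using x by (auto simp: FC_def intro: finite_subset)
  fix y assume y: "y \<in> FC G"
  have "conj_class G (x \<otimes> y) \<subseteq> (\<lambda>(a, b). a \<otimes> b) ` (conj_class G x \<times> conj_class G y)"
  proof
    fix z assume "z \<in> conj_class G (x \<otimes> y)"
    then obtain g where g: "g \<in> carrier G" "z = g \<otimes> (x \<otimes> y) \<otimes> inv g" by (auto simp: conj_class_image)
    have "z = (g \<otimes> x \<otimes> inv g) \<otimes> (g \<otimes> y \<otimes> inv g)"
      using g x y by (simp add: FC_def group_normalize)
    then show "z \<in> (\<lambda>(a, b). a \<otimes> b) ` (conj_class G x \<times> conj_class G y)"
      using g by (auto simp: conj_class_image intro!: image_eqI)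
  qed
  then show "x \<otimes> y \<in> FC G"
    using x y by (auto simp: FC_def intro: finite_subset)
qed

end

text \<open>The elements of the group that commute with every element of \<open>X\<close>.\<close>

definition centralizer :: "('a, 'b) monoid_scheme \<Rightarrow> 'a set \<Rightarrow> 'a set" where
  "centralizer G X = {g \<in> carrier G. \<forall>x\<in>X. g \<otimes>\<^bsub>G\<^esub> x = x \<otimes>\<^bsub>G\<^esub> g}"

lemma finite_image_cong:
  assumes "finite (f ` A)" "\<And>a b. \<lbrakk>a \<in> A; b \<in> A; f a = f b\<rbrakk> \<Longrightarrow> g a = g b"
  shows "finite (g ` A)"
proof -
  have "g ` A \<subseteq> (\<lambda>y. g (inv_into A f y)) ` f ` A"
  proof
    fix y assume "y \<in> g ` A"
    then obtain a where a: "a \<in> A" "y = g a" by auto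
    have "g (inv_into A f (f a)) = g a"
      using a by (intro assms(2)) (auto intro: inv_into_into f_inv_into_f)
    then show "y \<in> (\<lambda>y. g (inv_into A f y)) ` f ` A" using a by (metis image_eqI)
  qed
  then show ?thesis using assms(1) by (meson finite_imageI finite_subset)
qed

context group
begin

lemma rcosets_image: "rcosets H = (\<lambda>a. H #> a) ` carrier G"
  by (auto simp: RCOSETS_def)

lemma finite_index_cover:
  assumes H: "subgroup H G" and S: "finite S" "S \<subseteq> carrier G" "\<forall>x\<in>carrier G. \<exists>s\<in>S. inv s \<otimes> x \<in> H"
  shows "finite (rcosets H)"
proof (rule finite_subset)
  show "rcosets H \<subseteq> (\<lambda>s. H #> inv s) ` S"
  proof
    fix X assume "X \<in> rcosets H"
    then obtain a where a: "a \<in> carrier G" "X = H #> a" by (auto simp: RCOSETS_def)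
    then obtain s where s: "s \<in> S" "inv s \<otimes> inv a \<in> H" using S(3) by auto
    then have "H #> inv s = H #> a" using r_coset_eq_iff[OF H, of "inv s" a] a S by auto
    then show "X \<in> (\<lambda>s. H #> inv s) ` S" using a s by auto
  qed
qed (use S in auto)

lemma finite_index_representatives:
  assumes H: "subgroup H G" "finite (rcosets H)"
  obtains S where "finite S" "S \<subseteq> carrier G" "\<forall>x\<in>carrier G. \<exists>s\<in>S. inv s \<otimes> x \<in> H"
    "\<forall>s\<in>S. \<forall>t\<in>S. inv s \<otimes> t \<in> H \<longrightarrow> s = t"
proof -
  obtain S where S: "S \<subseteq> carrier G" "finite S" "\<forall>s\<in>S. \<forall>t\<in>S. inv s \<otimes> t \<in> H \<longrightarrow> s = t"
    "\<forall>x\<in>carrier G. H #> inv x \<in> rcosets H \<longrightarrow> (\<exists>s\<in>S. inv s \<otimes> x \<in> H)"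
    using rcosets_representatives[OF H(1) subset_refl H(2)] by metis
  have "\<forall>x\<in>carrier G. \<exists>s\<in>S. inv s \<otimes> x \<in> H" using S(4) by (simp add: rcosets_image)
  then show ?thesis by (rule that[OF S(2,1) _ S(3)])
qed

lemma finite_index_mono:
  assumes "subgroup H G" "subgroup K G" "H \<subseteq> K" "finite (rcosets H)"
  shows "finite (rcosets K)"
  using assms(4) unfolding rcosets_image
  by (rule finite_image_cong) (use assms r_coset_eq_iff in blast)

lemma finite_index_Int:
  assumes "subgroup H G" "subgroup K G" "finite (rcosets H)" "finite (rcosets K)"
  shows "finite (rcosets (H \<inter> K))"
  unfolding rcosets_image
proof (rule finite_image_cong)
  have "(\<lambda>a. (H #> a, K #> a)) ` carrier G \<subseteq> (rcosets H) \<times> (rcosets K)"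
    by (auto simp: rcosets_image)
  then show "finite ((\<lambda>a. (H #> a, K #> a)) ` carrier G)"
    using assms by (meson finite_SigmaI finite_subset)
  have "subgroup (H \<inter> K) G" using assms by (simp add: subgroups_Inter_pair)
  then show "(H \<inter> K) #> a = (H \<inter> K) #> b"
    if "a \<in> carrier G" "b \<in> carrier G" "(H #> a, K #> a) = (H #> b, K #> b)" for a b
    using that assms(1,2) by (simp add: r_coset_eq_iff)
qed

lemma subgroup_centralizer:
  assumes "X \<subseteq> carrier G"
  shows "subgroup (centralizer G X) G"
proof (rule subgroupI)
  show "centralizer G X \<subseteq> carrier G" by (auto simp: centralizer_def)
  have "\<one> \<in> centralizer G X" using assms by (auto simp: centralizer_def)
  then show "centralizer G X \<noteq> {}" by auto
next
  fix a assume a: "a \<in> centralizer G X"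
  have "inv a \<otimes> x = x \<otimes> inv a" if "x \<in> X" for x
  proof -
    have c: "a \<in> carrier G" "x \<in> carrier G" "a \<otimes> x = x \<otimes> a"
      using a that assms by (auto simp: centralizer_def)
    have "inv a \<otimes> x = inv a \<otimes> (x \<otimes> a) \<otimes> inv a" using c(1,2) by (simp add: m_assoc)
    also have "\<dots> = x \<otimes> inv a" using c(1,2) unfolding c(3)[symmetric] by (simp add: group_normalize)
    finally show ?thesis .
  qed
  then show "inv a \<in> centralizer G X" using a by (auto simp: centralizer_def)
next
  fix a b assume ab: "a \<in> centralizer G X" "b \<in> centralizer G X"
  have "a \<otimes> b \<otimes> x = x \<otimes> (a \<otimes> b)" if "x \<in> X" for x
  proof -
    have c: "a \<in> carrier G" "b \<in> carrier G" "x \<in> carrier G" "a \<otimes> x = x \<otimes> a" "b \<otimes> x = x \<otimes> b"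
      using ab that assms by (auto simp: centralizer_def)
    have "a \<otimes> b \<otimes> x = (a \<otimes> x) \<otimes> b" using c(1-3) by (simp add: m_assoc c(5))
    then show ?thesis using c(1-3) unfolding c(4) by (simp add: m_assoc)
  qed
  then show "a \<otimes> b \<in> centralizer G X" using ab by (auto simp: centralizer_def)
qed

text \<open>The conjugacy class of \<open>x\<close> has as many elements as the centralizer of \<open>x\<close> has cosets.\<close>

lemma finite_index_centralizer_iff:
  assumes x: "x \<in> carrier G"
  shows "finite (rcosets (centralizer G {x})) \<longleftrightarrow> x \<in> FC G"
proof -
  let ?C = "centralizer G {x}"
  have C: "subgroup ?C G" using x by (intro subgroup_centralizer) auto
  have eq: "rcosets ?C = (\<lambda>g. ?C #> inv g) ` carrier G"
    unfolding rcosets_image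
  proof (intro antisym subsetI)
    fix X assume "X \<in> (\<lambda>a. ?C #> a) ` carrier G"
    then obtain a where "a \<in> carrier G" "X = ?C #> a" by blast
    then show "X \<in> (\<lambda>g. ?C #> inv g) ` carrier G" by (intro image_eqI[of _ _ "inv a"]) auto
  qed auto
  have iff: "?C #> inv g = ?C #> inv h \<longleftrightarrow> g \<otimes> x \<otimes> inv g = h \<otimes> x \<otimes> inv h"
    if "g \<in> carrier G" "h \<in> carrier G" for g h
  proof -
    have "?C #> inv g = ?C #> inv h \<longleftrightarrow> inv g \<otimes> h \<in> ?C"
      using r_coset_eq_iff[OF C, of "inv g" "inv h"] that by simp
    also have "\<dots> \<longleftrightarrow> h \<otimes> x \<otimes> inv h = g \<otimes> x \<otimes> inv g"
      using conj_eq_iff[OF x that(2,1)] that by (simp add: centralizer_def)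
    finally show ?thesis by auto
  qed
  have "finite ((\<lambda>g. ?C #> inv g) ` carrier G) \<longleftrightarrow> finite ((\<lambda>g. g \<otimes> x \<otimes> inv g) ` carrier G)"
  proof
    assume "finite ((\<lambda>g. ?C #> inv g) ` carrier G)"
    then show "finite ((\<lambda>g. g \<otimes> x \<otimes> inv g) ` carrier G)"
      by (rule finite_image_cong) (use iff in blast)
  next
    assume "finite ((\<lambda>g. g \<otimes> x \<otimes> inv g) ` carrier G)"
    then show "finite ((\<lambda>g. ?C #> inv g) ` carrier G)"
      by (rule finite_image_cong) (use iff in blast)
  qed
  then show ?thesis using x unfolding eq by (simp add: FC_def conj_class_image)
qed

lemma finite_index_centralizer_finite:
  assumes "finite S" "S \<subseteq> FC G"
  shows "finite (rcosets (centralizer G S))"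
  using assms
proof (induction S rule: finite_induct)
  case empty
  have "subgroup (centralizer G {}) G" by (rule subgroup_centralizer) simp
  then show ?case
    by (rule finite_index_cover[where S = "{\<one>}"]) (auto simp: centralizer_def)
next
  case (insert s S)
  have FG: "FC G \<subseteq> carrier G" by (auto simp: FC_def)
  have "centralizer G (insert s S) = centralizer G {s} \<inter> centralizer G S"
    by (auto simp: centralizer_def)
  moreover have "s \<in> carrier G" "S \<subseteq> carrier G" using insert.prems FG by auto
  ultimately show ?case
    using insert finite_index_Int[of "centralizer G {s}" "centralizer G S"]
    by (simp add: subgroup_centralizer finite_index_centralizer_iff)
qed

end

section \<open>Radon measures from contents on compact sets\<close>

text \<open>A content \<open>c\<close> assigns sizes to compact sets. The inner content of a set is the supremum
  of the sizes of its compact subsets; it is used for open sets only.\<close>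

definition inner_content :: "'a topology \<Rightarrow> ('a set \<Rightarrow> ennreal) \<Rightarrow> 'a set \<Rightarrow> ennreal" where
  "inner_content T c U = (SUP K \<in> {K. compactin T K \<and> K \<subseteq> U}. c K)"

text \<open>The outer measure of a content: arbitrary sets are approximated from outside by open sets.\<close>

definition outer_content :: "'a topology \<Rightarrow> ('a set \<Rightarrow> ennreal) \<Rightarrow> 'a set \<Rightarrow> ennreal" where
  "outer_content T c A = (INF U \<in> {U. openin T U \<and> A \<subseteq> U}. inner_content T c U)"

text \<open>A finite content on a compact Hausdorff space. The values of \<open>c\<close> on sets that are not compact
  are irrelevant.\<close>

locale compact_content =
  fixes T :: "'a topology" and c :: "'a set \<Rightarrow> ennreal"
  assumes compact_T: "compact_space T" and Hausdorff_T: "Hausdorff_space T"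
    and content_mono: "\<And>K L. \<lbrakk>compactin T K; compactin T L; K \<subseteq> L\<rbrakk> \<Longrightarrow> c K \<le> c L"
    and content_subadd: "\<And>K L. \<lbrakk>compactin T K; compactin T L\<rbrakk> \<Longrightarrow> c (K \<union> L) \<le> c K + c L"
    and content_add: "\<And>K L. \<lbrakk>compactin T K; compactin T L; K \<inter> L = {}\<rbrakk> \<Longrightarrow> c (K \<union> L) = c K + c L"
    and content_finite: "c (topspace T) < \<infinity>"
begin

lemma compactin_iff_closedin: "compactin T K \<longleftrightarrow> closedin T K"
  using compact_T Hausdorff_T closedin_compact_space compactin_imp_closedin by blast

lemma inner_upper: "compactin T K \<Longrightarrow> K \<subseteq> U \<Longrightarrow> c K \<le> inner_content T c U"
  unfolding inner_content_def by (rule SUP_upper) auto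

lemma inner_mono: "U \<subseteq> V \<Longrightarrow> inner_content T c U \<le> inner_content T c V"
  unfolding inner_content_def by (rule SUP_subset_mono) auto

lemma content_empty: "c {} = 0"
proof -
  have "c {} + c {} = c {} + 0"
    using content_add[of "{}" "{}"] by simp
  moreover have "c {} < \<infinity>"
    using content_mono[of "{}" "topspace T"] content_finite compact_T
    by (auto simp: compact_space_def)
  ultimately show ?thesis
    by (simp only: ennreal_add_left_cancel) auto
qed

lemma inner_empty: "inner_content T c {} = 0"
proof -
  have "{K. compactin T K \<and> K \<subseteq> {}} = {{}}" by auto
  then show ?thesis by (simp add: inner_content_def content_empty)
qed

lemma inner_finite: "inner_content T c U < \<infinity>"
proof -
  have "inner_content T c U \<le> c (topspace T)"
    unfolding inner_content_def
    using compact_T by (intro SUP_least content_mono) (auto simp: compact_space_def compactin_subset_topspace)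
  then show ?thesis using content_finite by (rule le_less_trans)
qed

lemma outer_lower: "openin T U \<Longrightarrow> A \<subseteq> U \<Longrightarrow> outer_content T c A \<le> inner_content T c U"
  unfolding outer_content_def by (rule INF_lower) auto

lemma outer_open: "openin T U \<Longrightarrow> outer_content T c U = inner_content T c U"
  by (intro antisym outer_lower) (auto simp: outer_content_def intro!: INF_greatest inner_mono)

lemma outer_mono: "A \<subseteq> B \<Longrightarrow> outer_content T c A \<le> outer_content T c B"
  unfolding outer_content_def by (rule INF_superset_mono) auto

lemma content_le_outer: "compactin T K \<Longrightarrow> c K \<le> outer_content T c K"
  unfolding outer_content_def by (rule INF_greatest) (auto intro: inner_upper)

text \<open>A compact set covered by two open sets is the union of two compact sets, one inside each.\<close>

lemma inner_Un:
  assumes "openin T U" "openin T V"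
  shows "inner_content T c (U \<union> V) \<le> inner_content T c U + inner_content T c V"
  unfolding inner_content_def[of T c "U \<union> V"]
proof (rule SUP_least)
  fix K assume "K \<in> {K. compactin T K \<and> K \<subseteq> U \<union> V}"
  then have K: "closedin T K" "K \<subseteq> U \<union> V" by (auto simp: compactin_iff_closedin)
  have "closedin T (K - U)" "closedin T (K - V)" "disjnt (K - U) (K - V)"
    using K assms by (auto simp: disjnt_def intro: closedin_diff)
  moreover have "normal_space T"
    using compact_T Hausdorff_T by (simp add: compact_Hausdorff_or_regular_imp_normal_space)
  ultimately obtain P Q where PQ: "openin T P" "openin T Q" "K - U \<subseteq> P" "K - V \<subseteq> Q" "disjnt P Q"
    unfolding normal_space_def by metis
  have comp: "compactin T (K - P)" "compactin T (K - Q)"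
    using K PQ by (auto simp: compactin_iff_closedin intro: closedin_diff)
  have "K = (K - P) \<union> (K - Q)" using PQ by (auto simp: disjnt_def)
  then have "c K \<le> c (K - P) + c (K - Q)" using content_subadd[OF comp] by metis
  also have "\<dots> \<le> inner_content T c U + inner_content T c V"
    using comp PQ K by (intro add_mono inner_upper) auto
  finally show "c K \<le> inner_content T c U + inner_content T c V" .
qed

lemma inner_UN_finite:
  assumes "finite I" "\<And>i. i \<in> I \<Longrightarrow> openin T (U i)"
  shows "inner_content T c (\<Union>i\<in>I. U i) \<le> (\<Sum>i\<in>I. inner_content T c (U i))"
  using assms
proof (induction I rule: finite_induct)
  case empty
  then show ?case by (simp add: inner_empty)
next
  case (insert i I)
  have "inner_content T c (\<Union>i\<in>insert i I. U i)
      \<le> inner_content T c (U i) + inner_content T c (\<Union>i\<in>I. U i)"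
    using inner_Un[of "U i" "\<Union>i\<in>I. U i"] insert by auto
  also have "\<dots> \<le> inner_content T c (U i) + (\<Sum>i\<in>I. inner_content T c (U i))"
    using insert by (intro add_left_mono) auto
  finally show ?case using insert by simp
qed

lemma inner_UN:
  fixes U :: "nat \<Rightarrow> 'a set"
  assumes "\<And>i. openin T (U i)"
  shows "inner_content T c (\<Union>i. U i) \<le> (\<Sum>i. inner_content T c (U i))"
  unfolding inner_content_def[of T c "\<Union>i. U i"]
proof (rule SUP_least)
  fix K assume "K \<in> {K. compactin T K \<and> K \<subseteq> (\<Union>i. U i)}"
  then have K: "compactin T K" "K \<subseteq> \<Union>(range U)" by auto
  then obtain \<F> where "finite \<F>" "\<F> \<subseteq> range U" "K \<subseteq> \<Union>\<F>"
    using compactinD[OF K(1), of "range U"] assms by auto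
  then obtain I where I: "finite I" "K \<subseteq> (\<Union>i\<in>I. U i)"
    using finite_subset_image[of \<F> U UNIV] by auto
  have "c K \<le> inner_content T c (\<Union>i\<in>I. U i)" using K I by (intro inner_upper) auto
  also have "\<dots> \<le> (\<Sum>i\<in>I. inner_content T c (U i))" by (rule inner_UN_finite) (use I assms in auto)
  also have "\<dots> \<le> (\<Sum>i. inner_content T c (U i))" by (rule sum_le_suminf) (use I in auto)
  finally show "c K \<le> (\<Sum>i. inner_content T c (U i))" .
qed

lemma outer_measure_space_outer_content:
  "outer_measure_space (Pow (topspace T)) (outer_content T c)"
  unfolding outer_measure_space_def
proof (intro conjI)
  show "positive (Pow (topspace T)) (outer_content T c)"
    by (simp add: positive_def outer_open inner_empty)
  show "increasing (Pow (topspace T)) (outer_content T c)"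
    by (simp add: increasing_def outer_mono)
  show "countably_subadditive (Pow (topspace T)) (outer_content T c)"
    unfolding countably_subadditive_def
  proof (intro allI impI)
    fix A :: "nat \<Rightarrow> 'a set" assume A: "range A \<subseteq> Pow (topspace T)"
    show "outer_content T c (\<Union>i. A i) \<le> (\<Sum>i. outer_content T c (A i))"
    proof (rule ennreal_le_epsilon)
      fix e :: real assume e: "0 < e"
      \<comment> \<open>The errors of the approximations from outside add up to \<open>e\<close>.\<close>
      have "\<exists>U. openin T U \<and> A n \<subseteq> U \<and> inner_content T c U \<le> outer_content T c (A n) + e * (1/2)^Suc n" for n
      proof -
        have "outer_content T c (A n) \<noteq> \<infinity>"
          using A outer_lower[of "topspace T" "A n"] inner_finite[of "topspace T"] subsetD[OF A rangeI, of n]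
          by (auto simp: top_unique)
        then have "\<exists>U\<in>{U. openin T U \<and> A n \<subseteq> U}. inner_content T c U < outer_content T c (A n) + ennreal (e * (1/2)^Suc n)"
          unfolding outer_content_def 
          by (intro INF_approx_ennreal[OF _ refl]) (use e in auto)
        then show ?thesis by (auto intro: less_imp_le)
      qed
      then obtain U where U: "\<And>n. openin T (U n)" "\<And>n. A n \<subseteq> U n"
        "\<And>n. inner_content T c (U n) \<le> outer_content T c (A n) + e * (1/2)^Suc n"
        by metis
      have "outer_content T c (\<Union>i. A i) \<le> inner_content T c (\<Union>i. U i)"
        using U by (intro outer_lower) auto
      also have "\<dots> \<le> (\<Sum>i. inner_content T c (U i))" by (rule inner_UN) (use U in auto)
      also have "\<dots> \<le> (\<Sum>i. outer_content T c (A i) + e * (1/2)^Suc i)"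
        using U by (intro suminf_le) auto
      also have "\<dots> = (\<Sum>i. outer_content T c (A i)) + (\<Sum>i. ennreal (e * (1/2)^Suc i))"
        by (intro suminf_add[symmetric]) auto
      also have "(\<Sum>i. ennreal (e * (1/2)^Suc i)) = ennreal e"
      proof (subst suminf_ennreal2)
        have "(\<lambda>i. e * (1/2)^Suc i) sums (e * 1)"
          by (intro sums_mult power_half_series)
        then show "summable (\<lambda>i. e * (1 / 2) ^ Suc i)" "ennreal (\<Sum>i. e * (1 / 2) ^ Suc i) = ennreal e"
          by (auto simp: sums_iff)
      qed (use e in auto)
      finally show "outer_content T c (\<Union>i. A i) \<le> (\<Sum>i. outer_content T c (A i)) + ennreal e" .
    qed
  qed
qed

lemma inner_add_le:
  assumes K: "compactin T K" "K \<subseteq> W"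
  shows "c K + inner_content T c (W - K) \<le> inner_content T c W"
proof -
  have "c K + inner_content T c (W - K) = (SUP L \<in> {L. compactin T L \<and> L \<subseteq> W - K}. c K + c L)"
    unfolding inner_content_def by (rule ennreal_SUP_add_right) (auto intro!: exI[of _ "{}"])
  also have "\<dots> \<le> inner_content T c W"
  proof (rule SUP_least)
    fix L assume L: "L \<in> {L. compactin T L \<and> L \<subseteq> W - K}"
    then have "c K + c L = c (K \<union> L)" by (intro content_add[symmetric] K) auto
    also have "\<dots> \<le> inner_content T c W" using K L by (intro inner_upper) (auto intro: compactin_Un)
    finally show "c K + c L \<le> inner_content T c W" .
  qed
  finally show ?thesis .
qed

lemma inner_split_le:
  assumes "openin T U" "openin T W"
  shows "outer_content T c (U \<inter> W) + outer_content T c (W - U) \<le> inner_content T c W"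
proof -
  have "outer_content T c (U \<inter> W) + outer_content T c (W - U)
     = inner_content T c (U \<inter> W) + outer_content T c (W - U)"
    using assms by (simp add: outer_open openin_Int)
  also have "\<dots> = (SUP K \<in> {K. compactin T K \<and> K \<subseteq> U \<inter> W}. c K + outer_content T c (W - U))"
    unfolding inner_content_def by (rule ennreal_SUP_add_left[symmetric]) (auto intro!: exI[of _ "{}"])
  also have "\<dots> \<le> inner_content T c W"
  proof (rule SUP_least)
    fix K assume K: "K \<in> {K. compactin T K \<and> K \<subseteq> U \<inter> W}"
    then have "openin T (W - K)" using assms by (auto simp: compactin_iff_closedin intro: openin_diff)
    then have "outer_content T c (W - U) \<le> inner_content T c (W - K)"
      using K by (intro outer_lower) auto
    then have "c K + outer_content T c (W - U) \<le> c K + inner_content T c (W - K)" by (rule add_left_mono)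
    also have "\<dots> \<le> inner_content T c W" using K by (intro inner_add_le) auto
    finally show "c K + outer_content T c (W - U) \<le> inner_content T c W" .
  qed
  finally show ?thesis .
qed

text \<open>Open sets are measurable in the sense of Caratheodory.\<close>

lemma openin_lambda_system:
  assumes U: "openin T U"
  shows "U \<in> lambda_system (topspace T) (Pow (topspace T)) (outer_content T c)"
  unfolding lambda_system_def
proof (intro CollectI conjI ballI)
  show "U \<in> Pow (topspace T)" using U openin_subset by auto
  fix X assume X: "X \<in> Pow (topspace T)"
  show "outer_content T c (U \<inter> X) + outer_content T c ((topspace T - U) \<inter> X) = outer_content T c X"
  proof (rule antisym)
    show "outer_content T c (U \<inter> X) + outer_content T c ((topspace T - U) \<inter> X) \<le> outer_content T c X"
      unfolding outer_content_def[of T c X]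
    proof (rule INF_greatest)
      fix W assume W: "W \<in> {W. openin T W \<and> X \<subseteq> W}"
      then have "outer_content T c (U \<inter> X) + outer_content T c ((topspace T - U) \<inter> X)
         \<le> outer_content T c (U \<inter> W) + outer_content T c (W - U)"
        by (intro add_mono outer_mono) auto
      also have "\<dots> \<le> inner_content T c W" using U W by (intro inner_split_le) auto
      finally show "outer_content T c (U \<inter> X) + outer_content T c ((topspace T - U) \<inter> X) \<le> inner_content T c W" .
    qed
    have sub: "subadditive (Pow (topspace T)) (outer_content T c)"
      using ring_of_sets.countably_subadditive_subadditive[OF ring_of_sets_Pow]
        outer_measure_space_outer_content by (auto simp: outer_measure_space_def)
    have "X = (U \<inter> X) \<union> ((topspace T - U) \<inter> X)" using X by auto
    then show "outer_content T c X \<le> outer_content T c (U \<inter> X) + outer_content T c ((topspace T - U) \<inter> X)"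
      using subadditiveD[OF sub, of "U \<inter> X" "(topspace T - U) \<inter> X"] X openin_subset[OF U] by auto
  qed
qed

lemma exists_measure_of_content:
  "\<exists>M. space M = topspace T \<and> sets M = borel_sets_of T \<and>
    (\<forall>A \<in> sets M. emeasure M A = outer_content T c A)"
proof -
  let ?\<Omega> = "topspace T" and ?L = "lambda_system (topspace T) (Pow (topspace T)) (outer_content T c)"
  have ms: "measure_space ?\<Omega> ?L (outer_content T c)"
    by (rule sigma_algebra.caratheodory_lemma[OF sigma_algebra_Pow outer_measure_space_outer_content])
  then have sa: "sigma_algebra ?\<Omega> ?L" by (simp add: measure_space_def)
  have sub: "borel_sets_of T \<subseteq> ?L"
    unfolding borel_sets_of_def
    by (rule sigma_algebra.sigma_sets_subset[OF sa]) (auto intro: openin_lambda_system)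
  have opens: "{U. openin T U} \<subseteq> Pow ?\<Omega>" by (auto dest: openin_subset)
  have ms': "measure_space ?\<Omega> (borel_sets_of T) (outer_content T c)"
    using measure_down[OF ms _ sub] opens by (simp add: borel_sets_of_def sigma_algebra_sigma_sets)
  define M where "M = measure_of ?\<Omega> {U. openin T U} (outer_content T c)"
  have s: "space M = ?\<Omega>" "sets M = borel_sets_of T"
    using opens by (auto simp: M_def borel_sets_of_def space_measure_of sets_measure_of)
  have "emeasure M A = outer_content T c A" if "A \<in> sets M" for A
    using ms' opens that s by (intro emeasure_measure_of[OF M_def]) (auto simp: measure_space_def)
  with s show ?thesis by blast
qed

end

section \<open>Existence of Haar measure on compact groups\<close>

lemma borel_sets_of_preimage:
  assumes f: "continuous_map X Y f" and B: "B \<in> borel_sets_of Y"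
  shows "{x \<in> topspace X. f x \<in> B} \<in> borel_sets_of X"
proof -
  have fX: "f \<in> topspace X \<rightarrow> topspace Y" using f by (simp add: continuous_map_def)
  have "{x \<in> topspace X. f x \<in> B} \<in> sigma_sets (topspace X) {U. openin X U}"
    using B unfolding borel_sets_of_def
  proof (induction rule: sigma_sets.induct)
    case (Basic U)
    then show ?case using f by (intro sigma_sets.Basic) (auto simp: continuous_map_def)
  next
    case Empty
    then show ?case by (simp add: sigma_sets.Empty)
  next
    case (Compl U)
    have "{x \<in> topspace X. f x \<in> topspace Y - U} = topspace X - {x \<in> topspace X. f x \<in> U}"
      using fX by auto
    then show ?case using sigma_sets.Compl[OF Compl.IH] by simp
  next
    case (Union U)
    have "{x \<in> topspace X. f x \<in> (\<Union>i. U i)} = (\<Union>i. {x \<in> topspace X. f x \<in> U i})" by auto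
    then show ?case using sigma_sets.Union[OF Union.IH] by simp
  qed
  then show ?thesis by (simp add: borel_sets_of_def)
qed

lemma openin_imp_borel: "openin T U \<Longrightarrow> U \<in> borel_sets_of T"
  by (simp add: borel_sets_of_def)

text \<open>The least number of left translates of \<open>U\<close> that cover \<open>A\<close>. It is meaningful when finitely
  many translates suffice, as they do for subsets of a compact group and open \<open>U\<close> containing
  the identity.\<close>

definition covering_number :: "('a, 'b) monoid_scheme \<Rightarrow> 'a set \<Rightarrow> 'a set \<Rightarrow> nat" where
  "covering_number G U A =
     (LEAST n. \<exists>S. S \<subseteq> carrier G \<and> finite S \<and> card S = n \<and> A \<subseteq> (\<Union>s\<in>S. s <#\<^bsub>G\<^esub> U))"

lemma covering_number_le:
  assumes "S \<subseteq> carrier G" "finite S" "A \<subseteq> (\<Union>s\<in>S. s <#\<^bsub>G\<^esub> U)"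
  shows "covering_number G U A \<le> card S"
  unfolding covering_number_def by (rule Least_le) (use assms in auto)

context compact_group
begin

lemma continuous_map_mult:
  assumes "continuous_map X T f" "continuous_map X T g"
  shows "continuous_map X T (\<lambda>x. f x \<otimes> g x)"
  using continuous_map_compose[OF continuous_map_pairedI[OF assms] continuous_mult]
  by (simp add: o_def)

lemma continuous_map_inverse:
  assumes "continuous_map X T f"
  shows "continuous_map X T (\<lambda>x. inv (f x))"
  using continuous_map_compose[OF assms continuous_inv] by (simp add: o_def)

lemma continuous_map_const_carrier: "g \<in> carrier G \<Longrightarrow> continuous_map X T (\<lambda>x. g)"
  by (simp add: topspace_eq)

lemma continuous_map_left_mult: "g \<in> carrier G \<Longrightarrow> continuous_map T T (\<lambda>x. g \<otimes> x)"
  by (intro continuous_map_mult continuous_map_const_carrier continuous_map_id[unfolded id_def])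

lemma l_coset_preimage:
  assumes "g \<in> carrier G" "A \<subseteq> carrier G"
  shows "g <# A = {x \<in> topspace T. inv g \<otimes> x \<in> A}"
  using mem_l_coset_iff[OF assms] by (auto simp: topspace_eq)

lemma openin_l_coset:
  assumes "g \<in> carrier G" "openin T U"
  shows "openin T (g <# U)"
proof -
  have "U \<subseteq> carrier G" using assms openin_subset topspace_eq by blast
  then show ?thesis
    using assms continuous_map_left_mult[of "inv g"]
    by (simp add: l_coset_preimage openin_continuous_map_preimage)
qed

lemma closedin_l_coset:
  assumes "g \<in> carrier G" "closedin T U"
  shows "closedin T (g <# U)"
proof -
  have "U \<subseteq> carrier G" using assms closedin_subset topspace_eq by blast
  then show ?thesis
    using assms continuous_map_left_mult[of "inv g"]
    by (simp add: l_coset_preimage closedin_continuous_map_preimage)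
qed

lemma compactin_l_coset: "g \<in> carrier G \<Longrightarrow> compactin T K \<Longrightarrow> compactin T (g <# K)"
  unfolding l_coset_image by (rule image_compactin[OF _ continuous_map_left_mult])

lemma borel_subset_carrier:
  assumes "A \<in> borel_sets_of T"
  shows "A \<subseteq> carrier G"
proof -
  have "{U. openin T U} \<subseteq> Pow (topspace T)" by (auto dest: openin_subset)
  from sigma_sets_into_sp[OF this, of A] show ?thesis
    using assms by (simp add: borel_sets_of_def topspace_eq)
qed

lemma borel_l_coset:
  assumes "g \<in> carrier G" "A \<in> borel_sets_of T"
  shows "g <# A \<in> borel_sets_of T"
  using assms borel_subset_carrier continuous_map_left_mult[of "inv g"]
  by (simp add: l_coset_preimage borel_sets_of_preimage)

lemma finite_cover:
  assumes U: "openin T U" "\<one> \<in> U"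
  obtains S where "S \<subseteq> carrier G" "finite S" "carrier G \<subseteq> (\<Union>s\<in>S. s <# U)"
proof -
  have cc: "compactin T (carrier G)" using compact by (simp add: compact_space_def topspace_eq)
  have "x \<in> x <# U" if "x \<in> carrier G" for x
    using U that by (force simp: l_coset_image)
  then have "carrier G \<subseteq> \<Union>((\<lambda>s. s <# U) ` carrier G)" by auto
  then obtain \<F> where "finite \<F>" "\<F> \<subseteq> (\<lambda>s. s <# U) ` carrier G" "carrier G \<subseteq> \<Union>\<F>"
    using compactinD[OF cc, of "(\<lambda>s. s <# U) ` carrier G"] U openin_l_coset by auto
  then show ?thesis using finite_subset_image[of \<F> "\<lambda>s. s <# U" "carrier G"] that by metis
qed

lemma covering_number_witness:
  assumes U: "openin T U" "\<one> \<in> U" and A: "A \<subseteq> carrier G"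
  obtains S where "S \<subseteq> carrier G" "finite S" "A \<subseteq> (\<Union>s\<in>S. s <# U)" "card S = covering_number G U A"
proof -
  obtain S where "S \<subseteq> carrier G" "finite S" "carrier G \<subseteq> (\<Union>s\<in>S. s <# U)"
    using finite_cover[OF U] .
  then have "\<exists>n S. S \<subseteq> carrier G \<and> finite S \<and> card S = n \<and> A \<subseteq> (\<Union>s\<in>S. s <# U)"
    using A by blast
  then have "\<exists>S. S \<subseteq> carrier G \<and> finite S \<and> card S = covering_number G U A \<and> A \<subseteq> (\<Union>s\<in>S. s <# U)"
    unfolding covering_number_def by (rule LeastI_ex)
  then show ?thesis using that by blast
qed

lemma covering_number_mono:
  assumes U: "openin T U" "\<one> \<in> U" and A: "A \<subseteq> B" "B \<subseteq> carrier G"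
  shows "covering_number G U A \<le> covering_number G U B"
proof -
  obtain S where "S \<subseteq> carrier G" "finite S" "B \<subseteq> (\<Union>s\<in>S. s <# U)" "card S = covering_number G U B"
    using covering_number_witness[OF U A(2)] .
  then show ?thesis using covering_number_le[of S G A U] A by auto
qed

lemma covering_number_Un_le:
  assumes U: "openin T U" "\<one> \<in> U" and A: "A \<subseteq> carrier G" "B \<subseteq> carrier G"
  shows "covering_number G U (A \<union> B) \<le> covering_number G U A + covering_number G U B"
proof -
  obtain S where S: "S \<subseteq> carrier G" "finite S" "A \<subseteq> (\<Union>s\<in>S. s <# U)" "card S = covering_number G U A"
    using covering_number_witness[OF U A(1)] .
  obtain R where R: "R \<subseteq> carrier G" "finite R" "B \<subseteq> (\<Union>s\<in>R. s <# U)" "card R = covering_number G U B"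
    using covering_number_witness[OF U A(2)] .
  have "covering_number G U (A \<union> B) \<le> card (S \<union> R)"
    using S R by (intro covering_number_le) auto
  also have "\<dots> \<le> card S + card R" by (rule card_Un_le)
  finally show ?thesis using S R by simp
qed

lemma covering_number_translate_le:
  assumes U: "openin T U" "\<one> \<in> U" and A: "A \<subseteq> carrier G" and g: "g \<in> carrier G"
  shows "covering_number G U (g <# A) \<le> covering_number G U A"
proof -
  obtain S where S: "S \<subseteq> carrier G" "finite S" "A \<subseteq> (\<Union>s\<in>S. s <# U)" "card S = covering_number G U A"
    using covering_number_witness[OF U A(1)] .
  have UG: "U \<subseteq> carrier G" using U openin_subset topspace_eq by blast
  have "covering_number G U (g <# A) \<le> card ((\<lambda>s. g \<otimes> s) ` S)"
  proof (rule covering_number_le)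
    have "g <# A \<subseteq> (\<Union>s\<in>S. g <# (s <# U))" using S(3) unfolding l_coset_image by blast
    also have "\<dots> = (\<Union>s\<in>S. (g \<otimes> s) <# U)"
      using S(1) g UG by (intro SUP_cong refl l_coset_assoc) auto
    finally show "g <# A \<subseteq> (\<Union>s\<in>(\<lambda>s. g \<otimes> s) ` S. s <# U)" by simp
  qed (use S g in auto)
  also have "\<dots> \<le> card S" using S by (intro card_image_le)
  finally show ?thesis using S by simp
qed

lemma covering_number_translate:
  assumes U: "openin T U" "\<one> \<in> U" and A: "A \<subseteq> carrier G" and g: "g \<in> carrier G"
  shows "covering_number G U (g <# A) = covering_number G U A"
proof (rule antisym[OF covering_number_translate_le[OF assms]])
  have "inv g <# (g <# A) = A" using A g by (simp add: l_coset_assoc l_coset_one)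
  then show "covering_number G U A \<le> covering_number G U (g <# A)"
    using covering_number_translate_le[OF U, of "g <# A" "inv g"] A g
    by (simp add: l_coset_subset_carrier)
qed

lemma covering_number_pos:
  assumes U: "openin T U" "\<one> \<in> U"
  shows "covering_number G U (carrier G) > 0"
proof (rule ccontr)
  assume "\<not> ?thesis"
  then obtain S where "S \<subseteq> carrier G" "finite S" "carrier G \<subseteq> (\<Union>s\<in>S. s <# U)" "card S = 0"
    using covering_number_witness[OF U, of "carrier G"] by auto
  then show False using one_closed by auto
qed

text \<open>If no translate of \<open>U\<close> meets both \<open>A\<close> and \<open>B\<close>, then a covering of \<open>A \<union> B\<close>
  splits into disjoint coverings of \<open>A\<close> and of \<open>B\<close>.\<close>

lemma covering_number_Un:
  assumes U: "openin T U" "\<one> \<in> U" and A: "A \<subseteq> carrier G" "B \<subseteq> carrier G"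
    and sep: "\<And>s. s \<in> carrier G \<Longrightarrow> (s <# U) \<inter> A = {} \<or> (s <# U) \<inter> B = {}"
  shows "covering_number G U (A \<union> B) = covering_number G U A + covering_number G U B"
proof (rule antisym[OF covering_number_Un_le[OF U A]])
  obtain S where S: "S \<subseteq> carrier G" "finite S" "A \<union> B \<subseteq> (\<Union>s\<in>S. s <# U)"
      "card S = covering_number G U (A \<union> B)"
    using covering_number_witness[OF U, of "A \<union> B"] A by auto
  let ?S = "\<lambda>A. {s \<in> S. (s <# U) \<inter> A \<noteq> {}}"
  have "X \<subseteq> (\<Union>s\<in>?S X. s <# U)" if X: "X \<subseteq> A \<union> B" for X
  proof
    fix x assume x: "x \<in> X"
    then obtain s where "s \<in> S" "x \<in> s <# U" using X S(3) by blast
    then show "x \<in> (\<Union>s\<in>?S X. s <# U)" using x by blast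
  qed
  then have "covering_number G U A + covering_number G U B \<le> card (?S A) + card (?S B)"
    using S(1,2) by (intro add_mono covering_number_le) auto
  also have "\<dots> = card (?S A \<union> ?S B)"
    using S sep by (intro card_Un_disjoint[symmetric]) auto
  also have "\<dots> \<le> card S" using S by (intro card_mono) auto
  finally show "covering_number G U A + covering_number G U B \<le> covering_number G U (A \<union> B)"
    using S by simp
qed

text \<open>Disjoint compact sets are separated by the translates of all small neighbourhoods of
  the identity.\<close>

lemma disjoint_compact_separated:
  assumes K: "compactin T K" and L: "compactin T L" and disj: "K \<inter> L = {}"
  shows "\<exists>U. openin T U \<and> \<one> \<in> U \<and>
    (\<forall>V s. V \<subseteq> U \<longrightarrow> s \<in> carrier G \<longrightarrow> (s <# V) \<inter> K = {} \<or> (s <# V) \<inter> L = {})"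
proof -
  let ?q = "\<lambda>p. inv (fst p) \<otimes> snd p"
  have q: "continuous_map (prod_topology T T) T ?q"
    by (intro continuous_map_mult continuous_map_inverse continuous_map_fst continuous_map_snd)
  have KL: "K \<subseteq> carrier G" "L \<subseteq> carrier G"
    using K L compactin_subset_topspace topspace_eq by auto
  have "compactin T (?q ` (K \<times> L))"
    by (rule image_compactin[OF _ q]) (simp add: compactin_Times K L)
  then have cl: "closedin T (?q ` (K \<times> L))"
    using Hausdorff compactin_imp_closedin by blast
  define W where "W = topspace T - ?q ` (K \<times> L)"
  have "openin T W" unfolding W_def using cl by auto
  then have o: "openin (prod_topology T T) {p \<in> topspace (prod_topology T T). ?q p \<in> W}"
    by (rule openin_continuous_map_preimage[OF q])
  have "inv a \<otimes> b \<noteq> \<one>" if ab: "a \<in> K" "b \<in> L" for a b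
  proof
    assume e: "inv a \<otimes> b = \<one>"
    have c: "a \<in> carrier G" "b \<in> carrier G" using ab KL by auto
    then have "b = a \<otimes> (inv a \<otimes> b)" by (simp add: m_assoc[symmetric])
    then have "b = a" using e c by simp
    then show False using ab disj by auto
  qed
  then have "\<one> \<in> W" unfolding W_def by (force simp: topspace_eq)
  then have "(\<one>, \<one>) \<in> {p \<in> topspace (prod_topology T T). ?q p \<in> W}"
    by (simp add: topspace_eq)
  then obtain P Q where PQ: "openin T P" "openin T Q" "\<one> \<in> P" "\<one> \<in> Q"
      "P \<times> Q \<subseteq> {p \<in> topspace (prod_topology T T). ?q p \<in> W}"
    using o unfolding openin_prod_topology_alt by meson
  show ?thesis
  proof (intro exI[of _ "P \<inter> Q"] conjI allI impI)
    fix V s assume V: "V \<subseteq> P \<inter> Q" and s: "s \<in> carrier G"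
    have VG: "V \<subseteq> carrier G" using V PQ openin_subset topspace_eq by blast
    show "(s <# V) \<inter> K = {} \<or> (s <# V) \<inter> L = {}"
    proof (rule ccontr)
      assume "\<not> ?thesis"
      then obtain u v where uv: "u \<in> V" "v \<in> V" "s \<otimes> u \<in> K" "s \<otimes> v \<in> L"
        by (auto simp: l_coset_image)
      then have c: "u \<in> carrier G" "v \<in> carrier G" using VG by auto
      have "inv (s \<otimes> u) \<otimes> (s \<otimes> v) = inv u \<otimes> (inv s \<otimes> (s \<otimes> v))"
        using c s by (simp add: inv_mult_group m_assoc)
      also have "inv s \<otimes> (s \<otimes> v) = v" using c s by (simp add: m_assoc[symmetric])
      finally have "?q (u, v) = ?q (s \<otimes> u, s \<otimes> v)" by simp
      moreover have "(u, v) \<in> P \<times> Q" using V uv by auto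
      then have "?q (u, v) \<in> W" using PQ(5) by blast
      moreover have "?q (s \<otimes> u, s \<otimes> v) \<in> ?q ` (K \<times> L)" using uv by (intro imageI) simp
      ultimately show False unfolding W_def by simp
    qed
  qed (use PQ in auto)
qed

text \<open>The normalized covering numbers \<open>r U\<close> lie in the compact space of all functions from sets to
  \<open>[0, 1]\<close>. A cluster point \<open>l\<close> along the neighbourhoods \<open>U\<close> of the identity inherits every closed
  condition that holds for all small \<open>U\<close>; for disjoint compact sets additivity is such a condition.\<close>

lemma exists_invariant_content:
  obtains l :: "'a set \<Rightarrow> real" where "\<And>A. 0 \<le> l A" "l (carrier G) = 1"
    "\<And>A B. \<lbrakk>A \<subseteq> B; B \<subseteq> carrier G\<rbrakk> \<Longrightarrow> l A \<le> l B"
    "\<And>A B. \<lbrakk>A \<subseteq> carrier G; B \<subseteq> carrier G\<rbrakk> \<Longrightarrow> l (A \<union> B) \<le> l A + l B"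
    "\<And>g A. \<lbrakk>g \<in> carrier G; A \<subseteq> carrier G\<rbrakk> \<Longrightarrow> l (g <# A) = l A"
    "\<And>K L. \<lbrakk>compactin T K; compactin T L; K \<inter> L = {}\<rbrakk> \<Longrightarrow> l (K \<union> L) = l K + l L"
proof -
  define \<N> where "\<N> = {U. openin T U \<and> \<one> \<in> U}"
  define r where "r U A = real (covering_number G U (A \<inter> carrier G)) / real (covering_number G U (carrier G))"
    for U A
  define I where "I = (UNIV :: 'a set set) \<rightarrow>\<^sub>E {0..1::real}"
  define \<C> where "\<C> = (\<lambda>U. closure (r ` {V \<in> \<N>. V \<subseteq> U})) ` \<N>"
  have N_Int: "U \<inter> V \<in> \<N>" if "U \<in> \<N>" "V \<in> \<N>" for U V using that by (auto simp: \<N>_def)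
  have NT: "topspace T \<in> \<N>"
    using openin_topspace[of T] one_closed by (simp add: \<N>_def topspace_eq)
  have r: "0 \<le> r U A" "r U A \<le> 1" if "U \<in> \<N>" for U A
    using that covering_number_mono[of U "A \<inter> carrier G" "carrier G"] covering_number_pos[of U]
    by (auto simp: r_def \<N>_def divide_le_eq_1)
  have "compact I"
    using compactin_PiE[of "\<lambda>_. euclidean :: real topology" UNIV "\<lambda>_::'a set. {0..1::real}"]
    by (simp add: I_def euclidean_product_topology)
  moreover have "closed C" if "C \<in> \<C>" for C using that by (auto simp: \<C>_def)
  moreover have "I \<inter> \<Inter>\<F> \<noteq> {}" if \<F>: "finite \<F>" "\<F> \<subseteq> \<C>" for \<F>
  proof -
    obtain \<U> where \<U>: "finite \<U>" "\<U> \<subseteq> \<N>" "\<F> = (\<lambda>U. closure (r ` {V \<in> \<N>. V \<subseteq> U})) ` \<U>"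
      using finite_subset_image[of \<F> "\<lambda>U. closure (r ` {V \<in> \<N>. V \<subseteq> U})" \<N>] \<F> by (auto simp: \<C>_def)
    have "\<exists>V\<in>\<N>. \<forall>U\<in>\<U>. V \<subseteq> U" using \<U>(1,2)
    proof (induction \<U> rule: finite_induct)
      case empty
      then show ?case using NT by auto
    next
      case (insert U \<U>)
      then obtain V where "V \<in> \<N>" "\<forall>U\<in>\<U>. V \<subseteq> U" by auto
      then show ?case using insert.prems N_Int[of V U] by (intro bexI[of _ "V \<inter> U"]) auto
    qed
    then obtain V where V: "V \<in> \<N>" "\<forall>U\<in>\<U>. V \<subseteq> U" by auto
    then have "r V \<in> I \<inter> \<Inter>\<F>"
      using r \<U> closure_subset by (fastforce simp: I_def)
    then show ?thesis by auto
  qed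
  ultimately have "I \<inter> \<Inter>\<C> \<noteq> {}" by (rule compact_imp_fip)
  then obtain l where l: "l \<in> I" "\<And>U. U \<in> \<N> \<Longrightarrow> l \<in> closure (r ` {V \<in> \<N>. V \<subseteq> U})"
    by (auto simp: \<C>_def)
  have limit: "P l" if "U \<in> \<N>" "closed {f. P f}" "\<And>V. V \<in> \<N> \<Longrightarrow> V \<subseteq> U \<Longrightarrow> P (r V)" for P U
  proof -
    have "closure (r ` {V \<in> \<N>. V \<subseteq> U}) \<subseteq> {f. P f}"
      using that by (intro closure_minimal) auto
    then show ?thesis using l(2)[OF that(1)] by auto
  qed
  have cont: "continuous_on UNIV (\<lambda>f :: 'a set \<Rightarrow> real. f A)" for A
    by (rule continuous_on_product_coordinates)
  have pos: "real (covering_number G V (carrier G)) > 0" if "V \<in> \<N>" for V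
    using covering_number_pos[of V] that by (auto simp: \<N>_def)
  show ?thesis
  proof (rule that[of l])
    show "0 \<le> l A" for A using l(1) by (auto simp: I_def)
    show "l (carrier G) = 1"
      by (rule limit[OF NT], intro closed_Collect_eq cont continuous_intros)
        (use pos in \<open>fastforce simp: r_def\<close>)
    show "l A \<le> l B" if "A \<subseteq> B" "B \<subseteq> carrier G" for A B
    proof (rule limit[OF NT])
      show "closed {f :: 'a set \<Rightarrow> real. f A \<le> f B}" for A B :: "'a set" by (intro closed_Collect_le cont)
      fix V assume "V \<in> \<N>"
      then have "covering_number G V (A \<inter> carrier G) \<le> covering_number G V (B \<inter> carrier G)"
        using that by (intro covering_number_mono) (auto simp: \<N>_def)
      then show "r V A \<le> r V B" by (auto simp: r_def intro: divide_right_mono)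
    qed
    show "l (A \<union> B) \<le> l A + l B" if "A \<subseteq> carrier G" "B \<subseteq> carrier G" for A B
    proof (rule limit[OF NT])
      show "closed {f :: 'a set \<Rightarrow> real. f (A \<union> B) \<le> f A + f B}" for A B :: "'a set"
        by (intro closed_Collect_le cont continuous_intros)
      fix V assume "V \<in> \<N>"
      then have "covering_number G V (A \<union> B) \<le> covering_number G V A + covering_number G V B"
        using that by (intro covering_number_Un_le) (auto simp: \<N>_def)
      then have "real (covering_number G V (A \<union> B)) \<le> real (covering_number G V A) + real (covering_number G V B)"
        by linarith
      then show "r V (A \<union> B) \<le> r V A + r V B"
        using that by (simp add: r_def Int_absorb2 divide_right_mono flip: add_divide_distrib)
    qed
    show "l (g <# A) = l A" if "g \<in> carrier G" "A \<subseteq> carrier G" for g A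
    proof (rule limit[OF NT])
      show "closed {f :: 'a set \<Rightarrow> real. f (g <# A) = f A}" by (intro closed_Collect_eq cont)
      fix V assume "V \<in> \<N>"
      then have "covering_number G V (g <# A) = covering_number G V A"
        using that by (intro covering_number_translate) (auto simp: \<N>_def)
      then show "r V (g <# A) = r V A"
        using that l_coset_subset_carrier[OF that] by (simp add: r_def Int_absorb2)
    qed
    show "l (K \<union> L) = l K + l L" if KL: "compactin T K" "compactin T L" "K \<inter> L = {}" for K L
    proof -
      obtain U where U: "openin T U" "\<one> \<in> U"
        "\<And>V s. V \<subseteq> U \<Longrightarrow> s \<in> carrier G \<Longrightarrow> (s <# V) \<inter> K = {} \<or> (s <# V) \<inter> L = {}"
        using disjoint_compact_separated[OF KL] by blast
      have sub: "K \<subseteq> carrier G" "L \<subseteq> carrier G"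
        using KL compactin_subset_topspace[of T K] compactin_subset_topspace[of T L]
        by (auto simp: topspace_eq)
      show ?thesis
      proof (rule limit[of U])
        show "U \<in> \<N>" using U by (simp add: \<N>_def)
        show "closed {f :: 'a set \<Rightarrow> real. f (A \<union> B) = f A + f B}" for A B :: "'a set"
          by (intro closed_Collect_eq cont continuous_intros)
        fix V assume V: "V \<in> \<N>" "V \<subseteq> U"
        then have "covering_number G V (K \<union> L) = covering_number G V K + covering_number G V L"
          using sub U(3)[OF V(2)] by (intro covering_number_Un) (auto simp: \<N>_def)
        then show "r V (K \<union> L) = r V K + r V L"
          using sub by (simp add: r_def Int_absorb2 flip: add_divide_distrib)
      qed
    qed
  qed
qed

theorem exists_normalized_haar: "\<exists>M. is_normalized_haar G T M"
proof -
  obtain l :: "'a set \<Rightarrow> real" where l: "\<And>A. 0 \<le> l A" "l (carrier G) = 1"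
    "\<And>A B. \<lbrakk>A \<subseteq> B; B \<subseteq> carrier G\<rbrakk> \<Longrightarrow> l A \<le> l B"
    "\<And>A B. \<lbrakk>A \<subseteq> carrier G; B \<subseteq> carrier G\<rbrakk> \<Longrightarrow> l (A \<union> B) \<le> l A + l B"
    "\<And>g A. \<lbrakk>g \<in> carrier G; A \<subseteq> carrier G\<rbrakk> \<Longrightarrow> l (g <# A) = l A"
    "\<And>K L. \<lbrakk>compactin T K; compactin T L; K \<inter> L = {}\<rbrakk> \<Longrightarrow> l (K \<union> L) = l K + l L"
    using exists_invariant_content by blast
  define c where "c A = ennreal (l A)" for A
  have compG: "K \<subseteq> carrier G" if "compactin T K" for K
    using that compactin_subset_topspace topspace_eq by auto
  interpret compact_content T c
  proof
    show "compact_space T" "Hausdorff_space T" by (fact compact Hausdorff)+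
    show "c (topspace T) < \<infinity>" by (simp add: c_def)
    show "c K \<le> c L" if "compactin T K" "compactin T L" "K \<subseteq> L" for K L
      using that l(3)[of K L] compG by (simp add: c_def ennreal_leI)
    show "c (K \<union> L) \<le> c K + c L" if "compactin T K" "compactin T L" for K L
      using that l(4)[of K L] compG l(1) by (simp add: c_def ennreal_leI flip: ennreal_plus)
    show "c (K \<union> L) = c K + c L" if "compactin T K" "compactin T L" "K \<inter> L = {}" for K L
      using that l(6)[of K L] l(1) by (simp add: c_def flip: ennreal_plus)
  qed
  obtain M where M: "space M = topspace T" "sets M = borel_sets_of T"
    "\<And>A. A \<in> sets M \<Longrightarrow> emeasure M A = outer_content T c A"
    using exists_measure_of_content by blast
  have M_open: "emeasure M U = inner_content T c U" if "openin T U" for U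
    using that M by (simp add: openin_imp_borel outer_open)
  have inner_translate: "inner_content T c (g <# U) \<le> inner_content T c U"
    if g: "g \<in> carrier G" and U: "U \<subseteq> carrier G" for g U
    unfolding inner_content_def[of T c "g <# U"]
  proof (rule SUP_least)
    fix K assume "K \<in> {K. compactin T K \<and> K \<subseteq> g <# U}"
    then have K: "compactin T K" "K \<subseteq> g <# U" by auto
    have "c K = c (inv g <# K)" using K compG g l(5) by (simp add: c_def)
    also have "inv g <# K \<subseteq> inv g <# (g <# U)" using K by (auto simp: l_coset_image)
    then have "inv g <# K \<subseteq> U" using g U by (simp add: l_coset_assoc l_coset_one)
    then have "c (inv g <# K) \<le> inner_content T c U"
      using K g by (intro inner_upper compactin_l_coset) auto
    finally show "c K \<le> inner_content T c U" .
  qed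
  have outer_translate: "outer_content T c (g <# A) \<le> outer_content T c A"
    if g: "g \<in> carrier G" for g A
    unfolding outer_content_def[of T c A]
  proof (rule INF_greatest)
    fix U assume "U \<in> {U. openin T U \<and> A \<subseteq> U}"
    then have U: "openin T U" "A \<subseteq> U" by auto
    then have "outer_content T c (g <# A) \<le> inner_content T c (g <# U)"
      using g by (intro outer_lower openin_l_coset) (auto simp: l_coset_image)
    also have "\<dots> \<le> inner_content T c U"
      using U openin_subset[of T U] g by (intro inner_translate) (auto simp: topspace_eq)
    finally show "outer_content T c (g <# A) \<le> inner_content T c U" .
  qed
  have "is_normalized_haar G T M"
    unfolding is_normalized_haar_def
  proof (intro conjI ballI allI impI)
    show "space M = topspace T" "sets M = borel_sets_of T" by fact+
    have "c (topspace T) = inner_content T c (topspace T)"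
      by (intro antisym inner_upper)
        (use compact in \<open>auto simp: inner_content_def compact_space_def intro!: SUP_least content_mono compactin_subset_topspace\<close>)
    then show "emeasure M (space M) = 1"
      using M M_open[OF openin_topspace] l(2) by (simp add: c_def topspace_eq)
    fix g A assume g: "g \<in> carrier G" and A: "A \<in> sets M"
    then have AG: "A \<subseteq> carrier G" and A': "g <# A \<in> sets M"
      using M borel_subset_carrier borel_l_coset by auto
    have "outer_content T c A = outer_content T c (inv g <# (g <# A))"
      using g AG by (simp add: l_coset_assoc l_coset_one)
    also have "\<dots> \<le> outer_content T c (g <# A)" using g by (intro outer_translate) simp
    finally have "outer_content T c (g <# A) = outer_content T c A"
      using outer_translate[OF g, of A] by simp
    then show "emeasure M (g <# A) = emeasure M A" using M A A' by simp
  next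
    fix A assume "A \<in> sets M"
    then have "emeasure M A = outer_content T c A" by (rule M)
    also have "\<dots> = (INF U\<in>{U. openin T U \<and> A \<subseteq> U}. emeasure M U)"
      unfolding outer_content_def by (intro INF_cong refl) (simp add: M_open)
    finally show "emeasure M A = (INF U\<in>{U. openin T U \<and> A \<subseteq> U}. emeasure M U)" .
  next
    fix U assume U: "openin T U"
    show "emeasure M U = (SUP K\<in>{K. compactin T K \<and> K \<subseteq> U}. emeasure M K)"
    proof (rule antisym)
      have K: "c K \<le> emeasure M K" "K \<in> sets M" if "compactin T K" for K
      proof -
        show "K \<in> sets M"
          using that M closedin_def[of T K] sigma_sets.Compl[of "topspace T - K" "topspace T"]
          by (auto simp: compactin_iff_closedin borel_sets_of_def double_diff)
        then show "c K \<le> emeasure M K" using that by (simp add: M content_le_outer)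
      qed
      show "emeasure M U \<le> (SUP K\<in>{K. compactin T K \<and> K \<subseteq> U}. emeasure M K)"
        unfolding M_open[OF U] inner_content_def by (rule SUP_subset_mono[OF subset_refl]) (use K in auto)
      show "(SUP K\<in>{K. compactin T K \<and> K \<subseteq> U}. emeasure M K) \<le> emeasure M U"
        using U M by (intro SUP_least emeasure_mono) (auto simp: openin_imp_borel)
    qed
  qed
  then show ?thesis by blast
qed

lemma is_normalized_haar_haar: "is_normalized_haar G T (haar G T)"
  unfolding haar_def by (rule someI_ex[OF exists_normalized_haar])

end

section \<open>Haar measure of the set of commuting pairs\<close>

lemma compact_group_DirProd:
  fixes G (structure)
  assumes "compact_group G T"
  shows "compact_group (G \<times>\<times> G) (prod_topology T T)"
proof -
  interpret compact_group G T by fact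
  have g: "group (G \<times>\<times> G)" by (intro DirProd_group is_group)
  show ?thesis
  proof (intro compact_group.intro g compact_group_axioms.intro)
    show "topspace (prod_topology T T) = carrier (G \<times>\<times> G)" by (simp add: topspace_eq)
    let ?Q = "prod_topology (prod_topology T T) (prod_topology T T)"
    have "continuous_map ?Q T (\<lambda>p. fst (fst p))" "continuous_map ?Q T (\<lambda>p. snd (fst p))"
      "continuous_map ?Q T (\<lambda>p. fst (snd p))" "continuous_map ?Q T (\<lambda>p. snd (snd p))"
      using continuous_map_compose[OF continuous_map_fst continuous_map_fst]
        continuous_map_compose[OF continuous_map_fst continuous_map_snd]
        continuous_map_compose[OF continuous_map_snd continuous_map_fst]
        continuous_map_compose[OF continuous_map_snd continuous_map_snd]
      unfolding o_def by blast+
    then have "continuous_map ?Q (prod_topology T T)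
       (\<lambda>p. (fst (fst p) \<otimes> fst (snd p), snd (fst p) \<otimes> snd (snd p)))"
      by (intro continuous_map_pairedI continuous_map_mult)
    then show "continuous_map (prod_topology (prod_topology T T) (prod_topology T T)) (prod_topology T T)
       (\<lambda>(x, y). x \<otimes>\<^bsub>G \<times>\<times> G\<^esub> y)"
      by (simp add: case_prod_unfold mult_DirProd')
    have "continuous_map (prod_topology T T) (prod_topology T T) (\<lambda>p. (inv (fst p), inv (snd p)))"
      by (intro continuous_map_pairedI continuous_map_inverse continuous_map_fst continuous_map_snd)
    then show "continuous_map (prod_topology T T) (prod_topology T T) (m_inv (G \<times>\<times> G))"
      by (rule continuous_map_eq) (auto simp: topspace_eq inv_DirProd[OF is_group is_group])
    show "compact_space (prod_topology T T)" by (simp add: compact_space_prod_topology compact)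
    show "Hausdorff_space (prod_topology T T)" by (simp add: Hausdorff_space_prod_topology Hausdorff)
  qed
qed

text \<open>A compact group with a normalized Haar measure; no uniqueness of \<open>M\<close> is assumed.\<close>

locale haar_measure = compact_group G T
  for G :: "('a, 'b) monoid_scheme" (structure) and T :: "'a topology" +
  fixes M :: "'a measure"
  assumes haar_M: "is_normalized_haar G T M"
begin

lemma space_M: "space M = carrier G" and sets_M: "sets M = borel_sets_of T"
  using haar_M by (auto simp: is_normalized_haar_def topspace_eq)

lemma emeasure_carrier: "emeasure M (carrier G) = 1"
proof -
  have "emeasure M (space M) = 1" using haar_M unfolding is_normalized_haar_def by blast
  then show ?thesis by (simp add: space_M)
qed

sublocale finite_M: finite_measure M
  by (intro finite_measureI) (simp add: space_M emeasure_carrier)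

lemma measure_carrier: "measure M (carrier G) = 1"
  by (simp add: measure_def emeasure_carrier)

lemma measure_translate:
  assumes "g \<in> carrier G" "A \<in> sets M"
  shows "measure M (g <# A) = measure M A"
  using haar_M assms by (simp add: is_normalized_haar_def measure_def)

lemma sets_translate: "g \<in> carrier G \<Longrightarrow> A \<in> sets M \<Longrightarrow> g <# A \<in> sets M"
  by (simp add: sets_M borel_l_coset)

lemma openin_sets: "openin T U \<Longrightarrow> U \<in> sets M"
  by (simp add: sets_M openin_imp_borel)

lemma closedin_sets: "closedin T K \<Longrightarrow> K \<in> sets M"
  using sets.compl_sets[OF openin_sets[of "carrier G - K"]]
  by (simp add: space_M closedin_def topspace_eq double_diff)

lemma measure_UN_translates:
  assumes "finite S" "S \<subseteq> carrier G" "A \<in> sets M" "disjoint_family_on (\<lambda>s. s <# A) S"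
  shows "measure M (\<Union>s\<in>S. s <# A) = card S * measure M A"
proof -
  have "measure M (\<Union>s\<in>S. s <# A) = (\<Sum>s\<in>S. measure M (s <# A))"
    using assms sets_translate by (intro finite_M.finite_measure_finite_Union) auto
  also have "\<dots> = (\<Sum>s\<in>S. measure M A)"
    using assms by (intro sum.cong refl measure_translate) auto
  finally show ?thesis by simp
qed

lemma inner_regular:
  assumes U: "openin T U" and e: "0 < e"
  obtains K where "compactin T K" "K \<subseteq> U" "measure M U < measure M K + e"
proof -
  have "emeasure M U = (SUP K\<in>{K. compactin T K \<and> K \<subseteq> U}. emeasure M K)"
    using haar_M U by (simp add: is_normalized_haar_def)
  then have "\<exists>K\<in>{K. compactin T K \<and> K \<subseteq> U}. emeasure M U < emeasure M K + ennreal e"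
  proof (intro SUP_approx_ennreal)
    show "{K. compactin T K \<and> K \<subseteq> U} \<noteq> {}" by (auto intro!: exI[of _ "{}"])
    show "emeasure M U \<noteq> \<infinity>" by (simp add: finite_M.emeasure_eq_measure)
  qed (use e in auto)
  then obtain K where K: "compactin T K" "K \<subseteq> U" "emeasure M U < emeasure M K + ennreal e"
    by auto
  then have "measure M U < measure M K + e"
    using e by (simp add: finite_M.emeasure_eq_measure ennreal_less_iff flip: ennreal_plus)
  with K that show ?thesis by blast
qed

end

text \<open>The set whose measure is the commuting probability.\<close>

definition commuting_pairs :: "('a, 'b) monoid_scheme \<Rightarrow> ('a \<times> 'a) set" where
  "commuting_pairs G =
     {(x, y). x \<in> carrier G \<and> y \<in> carrier G \<and> x \<otimes>\<^bsub>G\<^esub> y = y \<otimes>\<^bsub>G\<^esub> x}"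

text \<open>The elements with at most \<open>n\<close> conjugates. These sets are closed and exhaust the FC-center.\<close>

definition FC_bounded :: "('a, 'b) monoid_scheme \<Rightarrow> nat \<Rightarrow> 'a set" where
  "FC_bounded G n = {x \<in> carrier G. finite (conj_class G x) \<and> card (conj_class G x) \<le> n}"

text \<open>The elements whose conjugates by the members of \<open>E\<close> are pairwise distinct. For a finite set \<open>E\<close> of group
  elements this is an open set, and the elements with more than \<open>n\<close> conjugates are covered by these sets with
  \<open>card E = Suc n\<close>.\<close>

definition distinct_conjugates :: "('a, 'b) monoid_scheme \<Rightarrow> 'a set \<Rightarrow> 'a set" where
  "distinct_conjugates G E = {x \<in> carrier G. inj_on (\<lambda>g. g \<otimes>\<^bsub>G\<^esub> x \<otimes>\<^bsub>G\<^esub> inv\<^bsub>G\<^esub> g) E}"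

lemma FC_eq_UN_FC_bounded: "FC G = (\<Union>n. FC_bounded G n)"
  by (auto simp: FC_def FC_bounded_def)

lemma not_FC_bounded_iff:
  assumes "x \<in> carrier G"
  shows "x \<notin> FC_bounded G n \<longleftrightarrow>
    (\<exists>E. E \<subseteq> carrier G \<and> finite E \<and> card E = Suc n \<and> x \<in> distinct_conjugates G E)"
proof
  assume x: "x \<notin> FC_bounded G n"
  have "\<exists>B. B \<subseteq> conj_class G x \<and> finite B \<and> card B = Suc n"
  proof (cases "finite (conj_class G x)")
    case True
    then have "Suc n \<le> card (conj_class G x)" using x assms by (auto simp: FC_bounded_def)
    then show ?thesis by (meson obtain_subset_with_card_n)
  next
    case False
    then show ?thesis using infinite_arbitrarily_large by blast
  qed
  then obtain B where B: "B \<subseteq> conj_class G x" "finite B" "card B = Suc n" by auto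
  then obtain E where E: "E \<subseteq> carrier G" "inj_on (\<lambda>g. g \<otimes>\<^bsub>G\<^esub> x \<otimes>\<^bsub>G\<^esub> inv\<^bsub>G\<^esub> g) E"
      "B = (\<lambda>g. g \<otimes>\<^bsub>G\<^esub> x \<otimes>\<^bsub>G\<^esub> inv\<^bsub>G\<^esub> g) ` E"
    unfolding conj_class_image subset_image_inj by auto
  then have "finite E" "card E = Suc n"
    using B by (auto simp: finite_image_iff card_image)
  with E assms show "\<exists>E. E \<subseteq> carrier G \<and> finite E \<and> card E = Suc n \<and> x \<in> distinct_conjugates G E"
    by (auto simp: distinct_conjugates_def)
next
  assume "\<exists>E. E \<subseteq> carrier G \<and> finite E \<and> card E = Suc n \<and> x \<in> distinct_conjugates G E"
  then obtain E where E: "E \<subseteq> carrier G" "card E = Suc n"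
    "inj_on (\<lambda>g. g \<otimes>\<^bsub>G\<^esub> x \<otimes>\<^bsub>G\<^esub> inv\<^bsub>G\<^esub> g) E" by (auto simp: distinct_conjugates_def)
  have "Suc n \<le> card (conj_class G x)" if "finite (conj_class G x)"
    using card_mono[OF that, of "(\<lambda>g. g \<otimes>\<^bsub>G\<^esub> x \<otimes>\<^bsub>G\<^esub> inv\<^bsub>G\<^esub> g) ` E"] E
    by (auto simp: conj_class_image card_image)
  then show "x \<notin> FC_bounded G n" by (auto simp: FC_bounded_def)
qed

context compact_group
begin

lemma closedin_equalizer:
  "continuous_map X T f \<Longrightarrow> continuous_map X T g \<Longrightarrow> closedin X {x \<in> topspace X. f x = g x}"
  by (rule closedin_continuous_maps_eq[OF Hausdorff])

lemma continuous_map_conj: "g \<in> carrier G \<Longrightarrow> continuous_map T T (\<lambda>x. g \<otimes> x \<otimes> inv g)"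
  by (intro continuous_map_mult continuous_map_const_carrier continuous_map_id[unfolded id_def] inv_closed)

lemma openin_distinct_conjugates:
  assumes E: "finite E" "E \<subseteq> carrier G"
  shows "openin T (distinct_conjugates G E)"
proof -
  let ?C = "\<lambda>g h. {x \<in> topspace T. g \<otimes> x \<otimes> inv g = h \<otimes> x \<otimes> inv h}"
  have "closedin T (?C g h)" if "g \<in> E" "h \<in> E" for g h
    using E that by (intro closedin_equalizer continuous_map_conj) auto
  then have "closedin T (\<Union>h\<in>E - {g}. ?C g h)" if "g \<in> E" for g
    using E that by (intro closedin_Union) auto
  then have "closedin T (\<Union>g\<in>E. \<Union>h\<in>E - {g}. ?C g h)"
    using E by (intro closedin_Union) auto
  then have "openin T (topspace T - (\<Union>g\<in>E. \<Union>h\<in>E - {g}. ?C g h))"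
    by (rule openin_diff[OF openin_topspace])
  also have "topspace T - (\<Union>g\<in>E. \<Union>h\<in>E - {g}. ?C g h) = distinct_conjugates G E"
    unfolding distinct_conjugates_def inj_on_def topspace_eq by blast
  finally show ?thesis .
qed

lemma closedin_FC_bounded: "closedin T (FC_bounded G n)"
proof -
  let ?\<E> = "{E. E \<subseteq> carrier G \<and> finite E \<and> card E = Suc n}"
  have "openin T (\<Union>E\<in>?\<E>. distinct_conjugates G E)"
    by (auto intro!: openin_Union openin_distinct_conjugates)
  moreover have "carrier G - FC_bounded G n = (\<Union>E\<in>?\<E>. distinct_conjugates G E)"
    using not_FC_bounded_iff[of _ G n] by (auto simp: distinct_conjugates_def)
  ultimately show ?thesis
    by (auto simp: closedin_def topspace_eq FC_bounded_def)
qed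

lemma closedin_commuting_pairs: "closedin (prod_topology T T) (commuting_pairs G)"
proof -
  have "closedin (prod_topology T T)
     {p \<in> topspace (prod_topology T T). fst p \<otimes> snd p = snd p \<otimes> fst p}"
    by (intro closedin_equalizer continuous_map_mult continuous_map_fst continuous_map_snd)
  also have "{p \<in> topspace (prod_topology T T). fst p \<otimes> snd p = snd p \<otimes> fst p} = commuting_pairs G"
    by (auto simp: commuting_pairs_def topspace_eq)
  finally show ?thesis .
qed

lemma borel_Int: "A \<in> borel_sets_of T \<Longrightarrow> B \<in> borel_sets_of T \<Longrightarrow> A \<inter> B \<in> borel_sets_of T"
  and borel_Diff: "A \<in> borel_sets_of T \<Longrightarrow> B \<in> borel_sets_of T \<Longrightarrow> A - B \<in> borel_sets_of T"
  and borel_UN_nat: "(\<And>n :: nat. C n \<in> borel_sets_of T) \<Longrightarrow> (\<Union>n. C n) \<in> borel_sets_of T"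
proof -
  have "{U. openin T U} \<subseteq> Pow (topspace T)" by (auto dest: openin_subset)
  then interpret sigma_algebra "topspace T" "borel_sets_of T"
    by (simp add: borel_sets_of_def sigma_algebra_sigma_sets)
  show "A \<in> borel_sets_of T \<Longrightarrow> B \<in> borel_sets_of T \<Longrightarrow> A \<inter> B \<in> borel_sets_of T"
   "A \<in> borel_sets_of T \<Longrightarrow> B \<in> borel_sets_of T \<Longrightarrow> A - B \<in> borel_sets_of T"
   "(\<And>n :: nat. C n \<in> borel_sets_of T) \<Longrightarrow> (\<Union>n. C n) \<in> borel_sets_of T"
    by auto
qed

lemma closedin_borel: "closedin T K \<Longrightarrow> K \<in> borel_sets_of T"
  using borel_Diff[of "topspace T" "topspace T - K"] openin_imp_borel[of T]
  by (auto simp: closedin_def double_diff)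

lemma FC_borel: "FC G \<in> borel_sets_of T"
  unfolding FC_eq_UN_FC_bounded by (intro borel_UN_nat closedin_borel closedin_FC_bounded)

end

text \<open>A compact group \<open>G\<close> with a normalized Haar measure of \<open>G \<times> G\<close>.\<close>

locale haar_square = compact_group G T
  for G :: "('a, 'b) monoid_scheme" (structure) and T :: "'a topology" +
  fixes M :: "('a \<times> 'a) measure"
  assumes haar_square: "is_normalized_haar (G \<times>\<times> G) (prod_topology T T) M"
begin

sublocale sq: haar_measure "G \<times>\<times> G" "prod_topology T T" M
  using compact_group_DirProd[OF compact_group_axioms] haar_square
  by (simp add: haar_measure_def haar_measure_axioms_def)

lemma borel_Times_sets:
  assumes "A \<in> borel_sets_of T"
  shows "A \<times> carrier G \<in> sets M" "carrier G \<times> A \<in> sets M"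
proof -
  have A: "A \<subseteq> carrier G" using assms by (rule borel_subset_carrier)
  have "A \<times> carrier G = {p \<in> topspace (prod_topology T T). fst p \<in> A}"
    "carrier G \<times> A = {p \<in> topspace (prod_topology T T). snd p \<in> A}"
    using A by (auto simp: topspace_eq)
  then show "A \<times> carrier G \<in> sets M" "carrier G \<times> A \<in> sets M"
    using assms borel_sets_of_preimage[OF continuous_map_fst[of T T]]
      borel_sets_of_preimage[OF continuous_map_snd[of T T]]
    by (simp_all add: sq.sets_M)
qed

lemma commuting_pairs_sets: "commuting_pairs G \<in> sets M"
  using closedin_commuting_pairs by (rule sq.closedin_sets)

text \<open>Over a set on which the conjugates by the elements of \<open>E\<close> are distinct, the translates of
  the commuting pairs by the elements of \<open>1 \<times> E\<close> are disjoint.\<close>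

lemma card_mult_measure_commuting_le:
  assumes E: "finite E" "E \<subseteq> carrier G" and B: "B \<in> borel_sets_of T" "B \<subseteq> distinct_conjugates G E"
  shows "card E * measure M (commuting_pairs G \<inter> (B \<times> carrier G)) \<le> measure M (B \<times> carrier G)"
proof -
  let ?A = "commuting_pairs G \<inter> (B \<times> carrier G)" and ?S = "Pair \<one> ` E"
  have A: "?A \<in> sets M" using commuting_pairs_sets borel_Times_sets B by auto
  have BG: "B \<subseteq> carrier G" using B borel_subset_carrier by blast
  have "disjoint_family_on (\<lambda>s. s <#\<^bsub>G \<times>\<times> G\<^esub> ?A) ?S"
    unfolding disjoint_family_on_def
  proof (intro ballI impI)
    fix s t assume st: "s \<in> ?S" "t \<in> ?S" "s \<noteq> t"
    then obtain g h where gh: "g \<in> E" "h \<in> E" "s = (\<one>, g)" "t = (\<one>, h)" "g \<noteq> h" by auto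
    show "(s <#\<^bsub>G \<times>\<times> G\<^esub> ?A) \<inter> (t <#\<^bsub>G \<times>\<times> G\<^esub> ?A) = {}"
    proof (rule ccontr)
      assume "\<not> ?thesis"
      then obtain w where w: "w \<in> s <#\<^bsub>G \<times>\<times> G\<^esub> ?A" "w \<in> t <#\<^bsub>G \<times>\<times> G\<^esub> ?A" by blast
      obtain p where "p \<in> ?A" "w = s \<otimes>\<^bsub>G \<times>\<times> G\<^esub> p" using w(1) unfolding l_coset_image by blast
      moreover obtain q where "q \<in> ?A" "w = t \<otimes>\<^bsub>G \<times>\<times> G\<^esub> q" using w(2) unfolding l_coset_image by blast
      ultimately have pq: "p \<in> ?A" "q \<in> ?A" "s \<otimes>\<^bsub>G \<times>\<times> G\<^esub> p = t \<otimes>\<^bsub>G \<times>\<times> G\<^esub> q" by auto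
      obtain x y where p: "p = (x, y)" by (cases p)
      obtain x' z where q: "q = (x', z)" by (cases q)
      have c: "x \<in> carrier G" "y \<in> carrier G" "x' \<in> carrier G" "z \<in> carrier G" "g \<in> carrier G" "h \<in> carrier G"
        using pq p q gh E by (auto simp: commuting_pairs_def)
      then have xx: "x' = x" and e: "g \<otimes> y = h \<otimes> z" using pq(3) gh p q by auto
      have com: "x \<otimes> y = y \<otimes> x" "x \<otimes> z = z \<otimes> x" using pq p q xx by (auto simp: commuting_pairs_def)
      have "g \<otimes> x \<otimes> inv g = (g \<otimes> y) \<otimes> x \<otimes> inv (g \<otimes> y)"
        using c com by (simp add: conj_mult_commuting)
      moreover have "h \<otimes> x \<otimes> inv h = (h \<otimes> z) \<otimes> x \<otimes> inv (h \<otimes> z)"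
        using c com by (simp add: conj_mult_commuting)
      ultimately have "g \<otimes> x \<otimes> inv g = h \<otimes> x \<otimes> inv h" using e by simp
      moreover have "x \<in> distinct_conjugates G E" using pq p B by auto
      ultimately show False using gh by (auto simp: distinct_conjugates_def inj_on_def)
    qed
  qed
  then have "measure M (\<Union>s\<in>?S. s <#\<^bsub>G \<times>\<times> G\<^esub> ?A) = card ?S * measure M ?A"
    using E A by (intro sq.measure_UN_translates) auto
  moreover have "card ?S = card E" by (simp add: card_image inj_on_def)
  moreover have "measure M (\<Union>s\<in>?S. s <#\<^bsub>G \<times>\<times> G\<^esub> ?A) \<le> measure M (B \<times> carrier G)"
    using E BG borel_Times_sets[OF B(1)]
    by (intro sq.finite_M.finite_measure_mono) (auto simp: l_coset_image)
  ultimately show ?thesis by simp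
qed

text \<open>A set covered by finitely many of the open sets above is cut into Borel pieces, each of which
  lies in one of them.\<close>

lemma card_mult_measure_commuting_le_cover:
  assumes "finite \<E>" "\<And>E. E \<in> \<E> \<Longrightarrow> E \<subseteq> carrier G \<and> finite E \<and> card E = m"
    and "B \<in> borel_sets_of T" "B \<subseteq> (\<Union>E\<in>\<E>. distinct_conjugates G E)"
  shows "m * measure M (commuting_pairs G \<inter> (B \<times> carrier G)) \<le> measure M (B \<times> carrier G)"
  using assms
proof (induction \<E> arbitrary: B rule: finite_induct)
  case empty
  then show ?case by simp
next
  case (insert E \<E>)
  let ?C = "commuting_pairs G" and ?B1 = "B \<inter> distinct_conjugates G E" and ?B2 = "B - distinct_conjugates G E"
  have U: "distinct_conjugates G E \<in> borel_sets_of T"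
    using insert.prems(1)[of E] by (intro openin_imp_borel openin_distinct_conjugates) auto
  have bor: "?B1 \<in> borel_sets_of T" "?B2 \<in> borel_sets_of T"
    using insert.prems(2) U by (auto intro: borel_Int borel_Diff)
  have split: "measure M (X \<inter> (B \<times> carrier G)) = measure M (X \<inter> (?B1 \<times> carrier G)) + measure M (X \<inter> (?B2 \<times> carrier G))"
    if "X \<in> sets M" for X
  proof -
    have "X \<inter> (B \<times> carrier G) = (X \<inter> (?B1 \<times> carrier G)) \<union> (X \<inter> (?B2 \<times> carrier G))" by auto
    then show ?thesis
      using that borel_Times_sets bor
      by (simp only:) (intro sq.finite_M.finite_measure_Union, auto)
  qed
  have "m * measure M (?C \<inter> (?B1 \<times> carrier G)) \<le> measure M (?B1 \<times> carrier G)"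
    using card_mult_measure_commuting_le[OF _ _ bor(1), of E] insert.prems(1)[of E] by auto
  moreover have "m * measure M (?C \<inter> (?B2 \<times> carrier G)) \<le> measure M (?B2 \<times> carrier G)"
    using insert.prems bor by (intro insert.IH) auto
  moreover have "(carrier G \<times> carrier G) \<inter> (X \<times> carrier G) = X \<times> carrier G" if "X \<subseteq> B" for X
    using that borel_subset_carrier[OF insert.prems(2)] by auto
  then have "measure M (B \<times> carrier G) = measure M (?B1 \<times> carrier G) + measure M (?B2 \<times> carrier G)"
    using split[of "carrier G \<times> carrier G"] sets.top[of M] by (simp add: sq.space_M)
  ultimately show ?case using split[OF commuting_pairs_sets] by (simp add: distrib_left)
qed

end

lemma continuous_map_swap: "continuous_map (prod_topology X Y) (prod_topology Y X) prod.swap"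
proof -
  have "prod.swap = (\<lambda>p :: 'a \<times> 'b. (snd p, fst p))" by (auto simp: fun_eq_iff)
  then show ?thesis
    using continuous_map_pairedI[OF continuous_map_snd[of X Y] continuous_map_fst[of X Y]] by simp
qed

lemma (in haar_square) measurable_swap: "prod.swap \<in> measurable M M"
proof (rule measurableI)
  fix A assume "A \<in> sets M"
  then have "{x \<in> topspace (prod_topology T T). prod.swap x \<in> A} \<in> sets M"
    using borel_sets_of_preimage[OF continuous_map_swap] by (simp add: sq.sets_M)
  moreover have "{x \<in> topspace (prod_topology T T). prod.swap x \<in> A} = prod.swap -` A \<inter> space M"
    by (auto simp: sq.space_M topspace_eq)
  ultimately show "prod.swap -` A \<inter> space M \<in> sets M" by simp
qed (auto simp: sq.space_M)

text \<open>The map exchanging the two factors turns Haar measures of \<open>G \<times> G\<close> into Haar measures.\<close>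

lemma (in haar_square) haar_square_swap:
  "haar_square G T (distr M M prod.swap)"
proof -
  let ?TT = "prod_topology T T" and ?N = "distr M M prod.swap"
  have cont: "continuous_map ?TT ?TT prod.swap" by (rule continuous_map_swap)
  have sp: "space M = topspace ?TT" by (simp add: sq.space_M topspace_eq)
  have pre: "prod.swap -` A \<inter> space M = prod.swap ` A" if "A \<subseteq> space M" for A
    using that by (force simp: sq.space_M prod.swap_def)
  have sub: "A \<subseteq> space M" if "A \<in> sets M" for A using that by (rule sets.sets_into_space)
  have meas: "prod.swap \<in> measurable M M" by (rule measurable_swap)
  have swap_sets: "prod.swap ` A \<in> sets M" if "A \<in> sets M" for A
    using measurable_sets[OF meas that] pre[OF sub[OF that]] by simp
  have em: "emeasure ?N A = emeasure M (prod.swap ` A)" if "A \<in> sets M" for A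
    using that meas sub by (simp add: emeasure_distr pre)
  have swap2: "prod.swap ` prod.swap ` A = A" for A :: "('a \<times> 'a) set"
    by (simp add: image_image)
  have op: "openin ?TT (prod.swap ` U)" if U: "openin ?TT U" for U
  proof -
    have "prod.swap ` U = {x \<in> topspace ?TT. prod.swap x \<in> U}"
      using openin_subset[OF U] by (force simp: prod.swap_def)
    then show ?thesis using openin_continuous_map_preimage[OF cont U] by simp
  qed
  have co: "compactin ?TT (prod.swap ` K)" if "compactin ?TT K" for K
    using that cont by (rule image_compactin)
  have "is_normalized_haar (G \<times>\<times> G) ?TT ?N"
    unfolding is_normalized_haar_def
  proof (intro conjI ballI allI impI)
    show "space ?N = topspace ?TT" by (simp add: sp)
    show "sets ?N = borel_sets_of ?TT" by (simp add: sq.sets_M)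
    have "prod.swap ` space M = space M" by (force simp: sq.space_M)
    then show "emeasure ?N (space ?N) = 1"
      using em[OF sets.top] sq.emeasure_carrier by (simp add: sq.space_M)
  next
    fix g A assume g: "g \<in> carrier (G \<times>\<times> G)" and "A \<in> sets ?N"
    then have A: "A \<in> sets M" by simp
    have "prod.swap ` (g <#\<^bsub>G \<times>\<times> G\<^esub> A) = prod.swap g <#\<^bsub>G \<times>\<times> G\<^esub> (prod.swap ` A)"
      by (simp add: l_coset_image image_image mult_DirProd')
    moreover have "prod.swap g \<in> carrier (G \<times>\<times> G)" using g by auto
    then have "emeasure M (prod.swap g <#\<^bsub>G \<times>\<times> G\<^esub> (prod.swap ` A)) = emeasure M (prod.swap ` A)"
      using haar_square swap_sets[OF A] unfolding is_normalized_haar_def by blast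
    ultimately show "emeasure ?N (g <#\<^bsub>G \<times>\<times> G\<^esub> A) = emeasure ?N A"
      using A sq.sets_translate[OF g A] by (simp add: em)
  next
    fix A assume "A \<in> sets ?N"
    then have A: "A \<in> sets M" by simp
    have "emeasure ?N A = emeasure M (prod.swap ` A)" by (rule em[OF A])
    also have "\<dots> = (INF U\<in>{U. openin ?TT U \<and> prod.swap ` A \<subseteq> U}. emeasure M U)"
      using haar_square swap_sets[OF A] unfolding is_normalized_haar_def by blast
    also have "{U. openin ?TT U \<and> prod.swap ` A \<subseteq> U} = (`) prod.swap ` {U. openin ?TT U \<and> A \<subseteq> U}"
    proof (intro antisym subsetI)
      fix U assume "U \<in> {U. openin ?TT U \<and> prod.swap ` A \<subseteq> U}"
      then have "openin ?TT (prod.swap ` U)" "prod.swap ` prod.swap ` A \<subseteq> prod.swap ` U"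
        using op by auto
      then show "U \<in> (`) prod.swap ` {U. openin ?TT U \<and> A \<subseteq> U}"
        by (intro image_eqI[of _ _ "prod.swap ` U"]) (auto simp: swap2)
    qed (use op in auto)
    also have "(INF U\<in>(`) prod.swap ` {U. openin ?TT U \<and> A \<subseteq> U}. emeasure M U)
       = (INF U\<in>{U. openin ?TT U \<and> A \<subseteq> U}. emeasure ?N U)"
      unfolding image_image by (intro INF_cong refl) (simp add: em sq.openin_sets)
    finally show "emeasure ?N A = (INF U\<in>{U. openin ?TT U \<and> A \<subseteq> U}. emeasure ?N U)" .
  next
    fix U assume U: "openin ?TT U"
    have "emeasure ?N U = emeasure M (prod.swap ` U)" using U by (intro em sq.openin_sets)
    also have "\<dots> = (SUP K\<in>{K. compactin ?TT K \<and> K \<subseteq> prod.swap ` U}. emeasure M K)"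
      using haar_square op[OF U] unfolding is_normalized_haar_def by blast
    also have "{K. compactin ?TT K \<and> K \<subseteq> prod.swap ` U} = (`) prod.swap ` {K. compactin ?TT K \<and> K \<subseteq> U}"
    proof (intro antisym subsetI)
      fix K assume "K \<in> {K. compactin ?TT K \<and> K \<subseteq> prod.swap ` U}"
      then have "compactin ?TT (prod.swap ` K)" "prod.swap ` K \<subseteq> prod.swap ` prod.swap ` U"
        using co by blast+
      then show "K \<in> (`) prod.swap ` {K. compactin ?TT K \<and> K \<subseteq> U}"
        by (intro image_eqI[of _ _ "prod.swap ` K"]) (simp_all add: swap2)
    qed (use co in auto)
    also have "(SUP K\<in>(`) prod.swap ` {K. compactin ?TT K \<and> K \<subseteq> U}. emeasure M K)
       = (SUP K\<in>{K. compactin ?TT K \<and> K \<subseteq> U}. emeasure ?N K)"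
      unfolding image_image
    proof (intro SUP_cong refl)
      fix K assume "K \<in> {K. compactin ?TT K \<and> K \<subseteq> U}"
      then have "closedin ?TT K"
        using compactin_imp_closedin[OF sq.Hausdorff] by auto
      then show "emeasure M (prod.swap ` K) = emeasure ?N K" by (simp add: em sq.closedin_sets)
    qed
    finally show "emeasure ?N U = (SUP K\<in>{K. compactin ?TT K \<and> K \<subseteq> U}. emeasure ?N K)" .
  qed
  then show ?thesis
    by (simp add: haar_square_def haar_square_axioms_def compact_group_axioms)
qed

context haar_square
begin

lemma measure_commuting_compact_le:
  assumes K: "compactin T K" "K \<subseteq> carrier G - FC_bounded G n"
  shows "Suc n * measure M (commuting_pairs G \<inter> (K \<times> carrier G)) \<le> 1"
proof -
  let ?\<E> = "{E. E \<subseteq> carrier G \<and> finite E \<and> card E = Suc n}"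
  have "K \<subseteq> \<Union>(distinct_conjugates G ` ?\<E>)"
    using K(2) not_FC_bounded_iff[of _ G n] by blast
  then have "\<exists>\<F>. finite \<F> \<and> \<F> \<subseteq> distinct_conjugates G ` ?\<E> \<and> K \<subseteq> \<Union>\<F>"
    by (rule compactinD[OF K(1), rotated]) (auto intro: openin_distinct_conjugates)
  then obtain \<F> where \<F>: "finite \<F>" "\<F> \<subseteq> distinct_conjugates G ` ?\<E>" "K \<subseteq> \<Union>\<F>"
    by blast
  then obtain \<G> where \<G>: "\<G> \<subseteq> ?\<E>" "finite \<G>" "\<F> = distinct_conjugates G ` \<G>"
    using finite_subset_image[of \<F> "distinct_conjugates G" ?\<E>] by blast
  have Kb: "K \<in> borel_sets_of T"
    using K(1) compactin_imp_closedin[OF Hausdorff] closedin_borel by blast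
  have "Suc n * measure M (commuting_pairs G \<inter> (K \<times> carrier G)) \<le> measure M (K \<times> carrier G)"
    using \<G> \<F> by (intro card_mult_measure_commuting_le_cover[OF \<G>(2) _ Kb]) auto
  also have "\<dots> \<le> measure M (carrier (G \<times>\<times> G))"
    using borel_subset_carrier[OF Kb] sets.top[of M]
    by (intro sq.finite_M.finite_measure_mono) (auto simp: sq.space_M)
  finally show ?thesis by (simp only: sq.measure_carrier)
qed

text \<open>The covering argument needs compact sets, so the open set of elements with more than \<open>n\<close>
  conjugates is approximated from inside. The compact subset of \<open>G \<times> G\<close> given by regularity is
  enlarged to \<open>K \<times> G\<close>, where \<open>K\<close> is its first projection.\<close>

lemma measure_commuting_not_FC_bounded_le:
  "measure M (commuting_pairs G \<inter> ((carrier G - FC_bounded G n) \<times> carrier G)) \<le> 1 / Suc n"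
proof (rule field_le_epsilon)
  fix e :: real assume e: "0 < e"
  let ?O = "carrier G - FC_bounded G n" and ?C = "commuting_pairs G"
  have O: "openin T ?O" using closedin_FC_bounded by (simp add: closedin_def topspace_eq)
  have "openin (prod_topology T T) (?O \<times> carrier G)"
    using O by (simp add: openin_prod_Times_iff flip: topspace_eq)
  then obtain L where L: "compactin (prod_topology T T) L" "L \<subseteq> ?O \<times> carrier G"
    "measure M (?O \<times> carrier G) < measure M L + e"
    using sq.inner_regular e by blast
  define K where "K = fst ` L"
  have K: "compactin T K" unfolding K_def using L(1) continuous_map_fst by (rule image_compactin)
  have KO: "K \<subseteq> ?O" using L(2) by (auto simp: K_def)
  have sets: "K \<times> carrier G \<in> sets M" "?O \<times> carrier G \<in> sets M" "L \<in> sets M"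
    using closedin_borel[OF compactin_imp_closedin[OF Hausdorff K]] openin_imp_borel[OF O]
      compactin_imp_closedin[OF sq.Hausdorff L(1)]
    by (auto intro: borel_Times_sets sq.closedin_sets)
  have "measure M L \<le> measure M (K \<times> carrier G)"
    using sets L(2) by (intro sq.finite_M.finite_measure_mono) (force simp: K_def)+
  moreover have "K \<times> carrier G \<subseteq> ?O \<times> carrier G" using KO by blast
  ultimately have "measure M ((?O \<times> carrier G) - (K \<times> carrier G)) \<le> e"
    using sq.finite_M.finite_measure_Diff[OF sets(2,1)] L(3) by linarith
  moreover have "measure M (?C \<inter> (?O \<times> carrier G)) \<le>
      measure M ((?C \<inter> (K \<times> carrier G)) \<union> ((?O \<times> carrier G) - (K \<times> carrier G)))"
    using sets commuting_pairs_sets by (intro sq.finite_M.finite_measure_mono) auto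
  moreover have "\<dots> \<le> measure M (?C \<inter> (K \<times> carrier G)) + measure M ((?O \<times> carrier G) - (K \<times> carrier G))"
    using sets commuting_pairs_sets by (intro measure_Un_le) auto
  moreover have "measure M (?C \<inter> (K \<times> carrier G)) \<le> 1 / Suc n"
    using measure_commuting_compact_le[OF K KO] by (simp add: field_simps)
  ultimately show "measure M (?C \<inter> (?O \<times> carrier G)) \<le> 1 / Suc n + e" by linarith
qed

text \<open>Almost every commuting pair has its first component in the FC-center; by exchanging the
  factors, so it is with the second component.\<close>

lemma measure_commuting_not_FC_fst:
  "measure M (commuting_pairs G \<inter> ((carrier G - FC G) \<times> carrier G)) = 0"
proof -
  let ?m = "measure M (commuting_pairs G \<inter> ((carrier G - FC G) \<times> carrier G))"
  have "?m \<le> inverse (real (Suc n))" for n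
  proof -
    have "?m \<le> measure M (commuting_pairs G \<inter> ((carrier G - FC_bounded G n) \<times> carrier G))"
    proof (intro sq.finite_M.finite_measure_mono)
      show "commuting_pairs G \<inter> ((carrier G - FC_bounded G n) \<times> carrier G) \<in> sets M"
        using closedin_FC_bounded
        by (intro sets.Int commuting_pairs_sets borel_Times_sets openin_imp_borel)
          (simp add: closedin_def topspace_eq)
    qed (auto simp: FC_eq_UN_FC_bounded)
    then show ?thesis using measure_commuting_not_FC_bounded_le[of n] by (simp add: inverse_eq_divide)
  qed
  then have "?m \<le> 0"
    using LIMSEQ_le_const[OF LIMSEQ_inverse_real_of_nat, of ?m] by auto
  then show ?thesis by (simp add: measure_le_0_iff)
qed

lemma measure_commuting_not_FC_snd:
  "measure M (commuting_pairs G \<inter> (carrier G \<times> (carrier G - FC G))) = 0"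
proof -
  let ?A = "commuting_pairs G \<inter> ((carrier G - FC G) \<times> carrier G)"
    and ?B = "commuting_pairs G \<inter> (carrier G \<times> (carrier G - FC G))"
  interpret swap: haar_square G T "distr M M prod.swap" by (rule haar_square_swap)
  have A: "?A \<in> sets M"
    using borel_Diff[OF openin_imp_borel[OF openin_topspace] FC_borel]
    by (intro sets.Int commuting_pairs_sets borel_Times_sets) (simp add: topspace_eq)
  have "measure (distr M M prod.swap) ?A = measure M (prod.swap -` ?A \<inter> space M)"
    using A by (intro measure_distr measurable_swap)
  also have "prod.swap -` ?A \<inter> space M = ?B"
    by (auto simp: sq.space_M commuting_pairs_def)
  finally show ?thesis using swap.measure_commuting_not_FC_fst by simp
qed

lemma measure_commuting_pairs:
  "measure M (commuting_pairs G) = measure M (commuting_pairs G \<inter> (FC G \<times> FC G))"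
proof (rule antisym)
  let ?C = "commuting_pairs G" and ?N1 = "(carrier G - FC G) \<times> carrier G" and ?N2 = "carrier G \<times> (carrier G - FC G)"
  have carr: "carrier G \<in> borel_sets_of T"
    using openin_imp_borel[OF openin_topspace, of T] by (simp add: topspace_eq)
  have N: "?N1 \<in> sets M" "?N2 \<in> sets M"
    using borel_Diff[OF carr FC_borel] by (auto intro: borel_Times_sets)
  have "FC G \<times> FC G = (FC G \<times> carrier G) \<inter> (carrier G \<times> FC G)"
    by (auto simp: FC_def)
  then have FF: "FC G \<times> FC G \<in> sets M" using borel_Times_sets[OF FC_borel] by auto
  show "measure M (?C \<inter> (FC G \<times> FC G)) \<le> measure M ?C"
    by (intro sq.finite_M.finite_measure_mono commuting_pairs_sets) auto
  have "?C = (?C \<inter> (FC G \<times> FC G)) \<union> ((?C \<inter> ?N1) \<union> (?C \<inter> ?N2))"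
    by (auto simp: commuting_pairs_def)
  then have "measure M ?C \<le> measure M (?C \<inter> (FC G \<times> FC G)) + measure M ((?C \<inter> ?N1) \<union> (?C \<inter> ?N2))"
    using measure_Un_le[of "?C \<inter> (FC G \<times> FC G)" M "(?C \<inter> ?N1) \<union> (?C \<inter> ?N2)"] N FF commuting_pairs_sets
    by auto
  also have "measure M ((?C \<inter> ?N1) \<union> (?C \<inter> ?N2)) \<le> measure M (?C \<inter> ?N1) + measure M (?C \<inter> ?N2)"
    using N commuting_pairs_sets by (intro measure_Un_le) auto
  finally show "measure M ?C \<le> measure M (?C \<inter> (FC G \<times> FC G))"
    using measure_commuting_not_FC_fst measure_commuting_not_FC_snd by simp
qed

text \<open>A Borel subgroup of infinite index is a null set, since arbitrarily many of its cosets are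
  disjoint and have the same measure.\<close>

lemma measure_commuting_pairs_eq_0:
  assumes "infinite (rcosets FC G)"
  shows "measure M (commuting_pairs G) = 0"
proof -
  let ?m = "measure M (FC G \<times> carrier G)"
  have F: "FC G \<times> carrier G \<in> sets M" by (intro borel_Times_sets FC_borel)
  have "real n * ?m \<le> 1" for n
  proof -
    obtain \<X> where "finite \<X>" "card \<X> = n" "\<X> \<subseteq> rcosets FC G"
      using infinite_arbitrarily_large[OF assms] by blast
    then obtain S where S: "S \<subseteq> carrier G" "finite S" "card S = n"
      "\<forall>s\<in>S. \<forall>t\<in>S. inv s \<otimes> t \<in> FC G \<longrightarrow> s = t"
      using rcosets_representatives[OF subgroup_FC] by metis
    have disj: "disjoint_family_on (\<lambda>s. s <# FC G) S"
      by (rule l_cosets_disjoint[OF subgroup_FC S(1,4)])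
    let ?S = "(\<lambda>s. (s, \<one>)) ` S"
    have "disjoint_family_on (\<lambda>s. s <#\<^bsub>G \<times>\<times> G\<^esub> (FC G \<times> carrier G)) ?S"
      using disj unfolding disjoint_family_on_def by (auto simp: DirProd_l_coset)
    then have "measure M (\<Union>s\<in>?S. s <#\<^bsub>G \<times>\<times> G\<^esub> (FC G \<times> carrier G)) = card ?S * ?m"
      using S F by (intro sq.measure_UN_translates) auto
    also have "card ?S = n" using S by (simp add: card_image inj_on_def)
    finally have "real n * ?m \<le> measure M (space M)"
      using sq.finite_M.bounded_measure by metis
    then show ?thesis using sq.measure_carrier sq.space_M by simp
  qed
  then have "?m \<le> 0"
    by (metis reals_Archimedean3 not_le order_less_le_trans mult.commute order_less_irrefl)
  then have "?m = 0" by (simp add: measure_le_0_iff)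
  moreover have "measure M (commuting_pairs G \<inter> (FC G \<times> FC G)) \<le> ?m"
    using F by (intro sq.finite_M.finite_measure_mono) (auto simp: FC_def)
  ultimately show ?thesis using measure_commuting_pairs by (simp add: measure_le_0_iff)
qed

text \<open>If \<open>Z\<close> is central in \<open>F\<close>, then the set of commuting pairs in \<open>F \<times> F\<close> is a union of cosets of
  \<open>Z \<times> Z\<close>, and finitely many cosets have equal measures that add up to 1. Here \<open>S\<close> represents the left
  cosets of \<open>Z\<close> in \<open>F\<close>.\<close>

lemma measure_commuting_finite_index:
  assumes F: "subgroup F G" "closedin T F" "finite (rcosets F)"
    and Z: "subgroup Z G" "closedin T Z" "Z \<subseteq> F" "\<And>z x. z \<in> Z \<Longrightarrow> x \<in> F \<Longrightarrow> z \<otimes> x = x \<otimes> z"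
    and S: "S \<subseteq> F" "finite S" "\<forall>s\<in>S. \<forall>t\<in>S. inv s \<otimes> t \<in> Z \<longrightarrow> s = t"
      "\<forall>x\<in>F. \<exists>s\<in>S. inv s \<otimes> x \<in> Z"
  shows "measure M (commuting_pairs G \<inter> (F \<times> F)) =
    card (commuting_pairs G \<inter> (S \<times> S)) / (card S)\<^sup>2 * (1 / card (rcosets F))\<^sup>2"
proof -
  have FG: "F \<subseteq> carrier G" and ZG: "Z \<subseteq> carrier G" and SG: "S \<subseteq> carrier G"
    using F(1) Z(1) S(1) subgroup.subset by blast+
  have ZZ: "Z \<times> Z \<in> sets M" and FF: "F \<times> F \<in> sets M"
    using F Z by (auto intro!: sq.closedin_sets simp: closedin_prod_Times_iff)
  have union: "measure M (\<Union>p\<in>P. p <#\<^bsub>G \<times>\<times> G\<^esub> (H \<times> H)) = card P * measure M (H \<times> H)"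
    if H: "subgroup H G" "H \<times> H \<in> sets M" and R: "R \<subseteq> carrier G" "finite R"
      "\<forall>s\<in>R. \<forall>t\<in>R. inv s \<otimes> t \<in> H \<longrightarrow> s = t" and P: "P \<subseteq> R \<times> R" for H R P
  proof (rule sq.measure_UN_translates)
    show "finite P" using P R by (auto intro: finite_subset)
    show "P \<subseteq> carrier (G \<times>\<times> G)" using P R by auto
    have "disjoint_family_on (\<lambda>s. s <# H) R" by (rule l_cosets_disjoint[OF H(1) R(1,3)])
    then have "\<forall>s\<in>R. \<forall>t\<in>R. s \<noteq> t \<longrightarrow> (s <# H) \<inter> (t <# H) = {}" unfolding disjoint_family_on_def .
    then have disj: "(s <# H) \<inter> (t <# H) = {}" if "s \<in> R" "t \<in> R" "s \<noteq> t" for s t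
      using that by blast
    show "disjoint_family_on (\<lambda>s. s <#\<^bsub>G \<times>\<times> G\<^esub> (H \<times> H)) P"
      unfolding disjoint_family_on_def
    proof (intro ballI impI)
      fix p q assume pq: "p \<in> P" "q \<in> P" "p \<noteq> q"
      obtain a b where p: "p = (a, b)" by (cases p)
      obtain c d where q: "q = (c, d)" by (cases q)
      have R: "a \<in> R" "b \<in> R" "c \<in> R" "d \<in> R" using pq p q P by auto
      have "(a <# H) \<inter> (c <# H) = {} \<or> (b <# H) \<inter> (d <# H) = {}"
        using pq(3) p q disj[OF R(1,3)] disj[OF R(2,4)] by auto
      then show "(p <#\<^bsub>G \<times>\<times> G\<^esub> (H \<times> H)) \<inter> (q <#\<^bsub>G \<times>\<times> G\<^esub> (H \<times> H)) = {}"
        unfolding p q DirProd_l_coset Times_Int_Times by auto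
    qed
  qed (use H in auto)
  obtain R where R: "R \<subseteq> carrier G" "finite R" "card R = card (rcosets F)"
    "\<forall>s\<in>R. \<forall>t\<in>R. inv s \<otimes> t \<in> F \<longrightarrow> s = t"
    "\<forall>x\<in>carrier G. F #> inv x \<in> rcosets F \<longrightarrow> (\<exists>s\<in>R. inv s \<otimes> x \<in> F)"
    using rcosets_representatives[OF F(1) subset_refl F(3)] .
  have "\<forall>x\<in>carrier G. \<exists>s\<in>R. inv s \<otimes> x \<in> F"
    using R(5) FG by (simp add: rcosetsI)
  then have "carrier G \<subseteq> (\<Union>s\<in>R. s <# F)"
    by (intro subsetI left_coset_cover[OF R(1) _ _ FG]) auto
  moreover have "(\<Union>s\<in>R. s <# F) \<subseteq> carrier G" using R(1) FG l_coset_subset_carrier by blast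
  ultimately have covG: "(\<Union>s\<in>R. s <# F) = carrier G" by blast
  have "(\<Union>p\<in>R \<times> R. p <#\<^bsub>G \<times>\<times> G\<^esub> (F \<times> F)) = (\<Union>s\<in>R. s <# F) \<times> (\<Union>s\<in>R. s <# F)"
    by (auto simp: DirProd_l_coset)
  then have "(\<Union>p\<in>R \<times> R. p <#\<^bsub>G \<times>\<times> G\<^esub> (F \<times> F)) = carrier (G \<times>\<times> G)"
    by (simp add: covG)
  then have eqF: "1 = (real (card (rcosets F)))\<^sup>2 * measure M (F \<times> F)"
    using union[OF F(1) FF R(1,2,4) subset_refl] R(3) sq.measure_carrier
    by (simp add: card_cartesian_product power2_eq_square)
  have cosets_F: "s <# Z \<subseteq> F" if "s \<in> S" for s
    using that S(1) Z(3) F(1) by (auto simp: l_coset_image intro!: subgroup.m_closed)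
  have covF: "(\<Union>s\<in>S. s <# Z) = F"
  proof
    show "(\<Union>s\<in>S. s <# Z) \<subseteq> F" using cosets_F by blast
    show "F \<subseteq> (\<Union>s\<in>S. s <# Z)"
      using S(4) FG by (intro subsetI left_coset_cover[OF SG _ _ ZG]) auto
  qed
  have "(\<Union>p\<in>S \<times> S. p <#\<^bsub>G \<times>\<times> G\<^esub> (Z \<times> Z)) = (\<Union>s\<in>S. s <# Z) \<times> (\<Union>s\<in>S. s <# Z)"
    by (auto simp: DirProd_l_coset)
  then have eqZ: "measure M (F \<times> F) = (real (card S))\<^sup>2 * measure M (Z \<times> Z)"
    using union[OF Z(1) ZZ SG S(2,3) subset_refl] covF
    by (simp add: card_cartesian_product power2_eq_square)
  have comm_iff: "(s \<otimes> z) \<otimes> (t \<otimes> w) = (t \<otimes> w) \<otimes> (s \<otimes> z) \<longleftrightarrow> s \<otimes> t = t \<otimes> s"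
    if st: "s \<in> S" "t \<in> S" and zw: "z \<in> Z" "w \<in> Z" for s t z w
  proof -
    have c: "s \<in> carrier G" "t \<in> carrier G" "z \<in> carrier G" "w \<in> carrier G"
      using st zw SG ZG by auto
    have com: "z \<otimes> t = t \<otimes> z" "w \<otimes> s = s \<otimes> w" "w \<otimes> z = z \<otimes> w" using Z(3,4) S(1) st zw by auto
    have "(s \<otimes> z) \<otimes> (t \<otimes> w) = s \<otimes> (z \<otimes> t) \<otimes> w" using c by (simp add: m_assoc)
    also have "\<dots> = (s \<otimes> t) \<otimes> (z \<otimes> w)" using c by (simp add: com m_assoc)
    finally have 1: "(s \<otimes> z) \<otimes> (t \<otimes> w) = (s \<otimes> t) \<otimes> (z \<otimes> w)" .
    have "(t \<otimes> w) \<otimes> (s \<otimes> z) = t \<otimes> (w \<otimes> s) \<otimes> z" using c by (simp add: m_assoc)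
    also have "\<dots> = t \<otimes> s \<otimes> (w \<otimes> z)" using c unfolding com(2) by (simp add: m_assoc)
    finally have 2: "(t \<otimes> w) \<otimes> (s \<otimes> z) = (t \<otimes> s) \<otimes> (z \<otimes> w)" by (simp only: com)
    show ?thesis unfolding 1 2 using c by (intro right_cancel) auto
  qed
  have "commuting_pairs G \<inter> (F \<times> F) = (\<Union>p\<in>commuting_pairs G \<inter> (S \<times> S). p <#\<^bsub>G \<times>\<times> G\<^esub> (Z \<times> Z))"
  proof (intro antisym subsetI)
    fix p assume p: "p \<in> commuting_pairs G \<inter> (F \<times> F)"
    obtain x y where xy: "p = (x, y)" by (cases p)
    then have "x \<in> (\<Union>s\<in>S. s <# Z)" "y \<in> (\<Union>s\<in>S. s <# Z)" using p covF by auto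
    then obtain s t z w where st: "s \<in> S" "t \<in> S" "z \<in> Z" "w \<in> Z" "x = s \<otimes> z" "y = t \<otimes> w"
      by (auto simp: l_coset_image)
    then have "(s, t) \<in> commuting_pairs G \<inter> (S \<times> S)"
      using p xy comm_iff[OF st(1-4)] SG by (auto simp: commuting_pairs_def)
    moreover have "p \<in> (s, t) <#\<^bsub>G \<times>\<times> G\<^esub> (Z \<times> Z)"
      using st xy unfolding DirProd_l_coset by (auto simp: l_coset_image)
    ultimately show "p \<in> (\<Union>p\<in>commuting_pairs G \<inter> (S \<times> S). p <#\<^bsub>G \<times>\<times> G\<^esub> (Z \<times> Z))" by blast
  next
    fix p assume "p \<in> (\<Union>p\<in>commuting_pairs G \<inter> (S \<times> S). p <#\<^bsub>G \<times>\<times> G\<^esub> (Z \<times> Z))"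
    then obtain s t where st: "s \<in> S" "t \<in> S" "(s, t) \<in> commuting_pairs G" "p \<in> (s <# Z) \<times> (t <# Z)"
      by (auto simp: DirProd_l_coset)
    then obtain z w where zw: "z \<in> Z" "w \<in> Z" "p = (s \<otimes> z, t \<otimes> w)"
      by (auto simp: l_coset_image)
    have "p \<in> F \<times> F" using st cosets_F by auto
    then show "p \<in> commuting_pairs G \<inter> (F \<times> F)"
      using comm_iff[OF st(1,2) zw(1,2)] st(3) zw(3) FG by (auto simp: commuting_pairs_def)
  qed
  then have "measure M (commuting_pairs G \<inter> (F \<times> F)) = card (commuting_pairs G \<inter> (S \<times> S)) * measure M (Z \<times> Z)"
    using union[OF Z(1) ZZ SG S(2,3), of "commuting_pairs G \<inter> (S \<times> S)"] by simp
  moreover have "real (card S) \<noteq> 0" "real (card (rcosets F)) \<noteq> 0"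
    using eqF unfolding eqZ by (metis mult_zero_left mult_zero_right power_zero_numeral zero_neq_one)+
  then have "measure M (Z \<times> Z) = 1 / (card S)\<^sup>2 * (1 / card (rcosets F))\<^sup>2"
    using eqF eqZ by (simp add: field_simps)
  ultimately show ?thesis by simp
qed

end

section \<open>FC-centers of finite index\<close>

context compact_group
begin

lemma closedin_centralizer:
  assumes "X \<subseteq> carrier G"
  shows "closedin T (centralizer G X)"
proof -
  have "closedin T {g \<in> topspace T. g \<otimes> x = x \<otimes> g}" if "x \<in> X" for x
    using that assms
    by (intro closedin_equalizer continuous_map_mult continuous_map_const_carrier
        continuous_map_id[unfolded id_def]) auto
  then have "closedin T (topspace T \<inter> (\<Inter>x\<in>X. {g \<in> topspace T. g \<otimes> x = x \<otimes> g}))"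
    by (cases "X = {}") (auto intro!: closedin_Int closedin_INT)
  also have "topspace T \<inter> (\<Inter>x\<in>X. {g \<in> topspace T. g \<otimes> x = x \<otimes> g}) = centralizer G X"
    by (auto simp: centralizer_def topspace_eq)
  finally show ?thesis .
qed

text \<open>The group is a countable union of translates of the closed sets \<open>FC_bounded G n\<close>, so Baire's
  theorem applies.\<close>

lemma FC_bounded_interior:
  assumes "finite (rcosets FC G)"
  obtains n W where "openin T W" "W \<noteq> {}" "W \<subseteq> FC_bounded G n"
proof -
  obtain S where S: "finite S" "S \<subseteq> carrier G" "\<forall>x\<in>carrier G. \<exists>s\<in>S. inv s \<otimes> x \<in> FC G"
      "\<forall>s\<in>S. \<forall>t\<in>S. inv s \<otimes> t \<in> FC G \<longrightarrow> s = t"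
    using finite_index_representatives[OF subgroup_FC assms] .
  let ?\<G> = "(\<lambda>(s, n). s <# FC_bounded G n) ` (S \<times> (UNIV :: nat set))"
  have BG: "FC_bounded G n \<subseteq> carrier G" for n by (auto simp: FC_bounded_def)
  have "T interior_of \<Union>?\<G> \<noteq> {}"
  proof -
    have "carrier G \<subseteq> \<Union>?\<G>"
    proof
      fix x assume x: "x \<in> carrier G"
      then obtain s where s: "s \<in> S" "inv s \<otimes> x \<in> FC G" using S(3) by auto
      then obtain n where "inv s \<otimes> x \<in> FC_bounded G n" by (auto simp: FC_eq_UN_FC_bounded)
      then have "x \<in> s <# FC_bounded G n" using mem_l_coset_iff[of s "FC_bounded G n" x] s S x BG by auto
      then show "x \<in> \<Union>?\<G>" using s by blast
    qed
    then have "carrier G \<subseteq> T interior_of \<Union>?\<G>"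
      using interior_of_maximal[OF _ openin_topspace[of T]] by (simp add: topspace_eq)
    then show ?thesis using one_closed by blast
  qed
  moreover have "locally_compact_space T \<and> regular_space T"
    using compact Hausdorff
    by (simp add: compact_imp_locally_compact_space compact_Hausdorff_imp_regular_space)
  moreover have "countable ?\<G>" using S(1) by (intro countable_image countable_SIGMA) (auto intro: countable_finite)
  moreover have "closedin T C" if "C \<in> ?\<G>" for C
    using that S by (auto intro: closedin_l_coset closedin_FC_bounded)
  ultimately obtain C where C: "C \<in> ?\<G>" "T interior_of C \<noteq> {}"
    using Baire_category_alt[of T ?\<G>] by blast
  then obtain s n where sn: "s \<in> S" "C = s <# FC_bounded G n" by auto
  have s: "s \<in> carrier G" using sn S by auto
  show ?thesis
  proof (rule that[of "inv s <# (T interior_of C)" n])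
    show "openin T (inv s <# (T interior_of C))" using s by (intro openin_l_coset) auto
    show "inv s <# (T interior_of C) \<noteq> {}" using C(2) by (auto simp: l_coset_image)
    have "inv s <# (T interior_of C) \<subseteq> inv s <# C"
      using interior_of_subset[of T C] by (auto simp: l_coset_image)
    also have "\<dots> = FC_bounded G n" unfolding sn using s BG by (simp add: l_coset_assoc l_coset_one)
    finally show "inv s <# (T interior_of C) \<subseteq> FC_bounded G n" .
  qed
qed

text \<open>Let \<open>x\<close> have a conjugacy class of maximal size in the open set \<open>W\<close>, and let \<open>E\<close> be a finite set of
  conjugators, one for each conjugate of \<open>x\<close>, which consists of the identity and a set \<open>E'\<close>. For
  \<open>u\<close> near the identity the conjugates of \<open>x u\<close> by \<open>E\<close> are still distinct, hence are all its
  conjugates, and only the one by the identity is close to \<open>x\<close>. If \<open>h\<close> centralizes \<open>x\<close>, then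
  \<open>h (x u) h\<^sup>-\<^sup>1 = x (h u h\<^sup>-\<^sup>1)\<close> is a conjugate close to \<open>x\<close>, so it equals \<open>x u\<close> and
  \<open>h\<close> commutes with \<open>u\<close>. The neighbourhood of the identity can be chosen independently of \<open>h\<close>
  because the group is compact.\<close>

lemma centralizer_of_centralizer_open:
  assumes W: "openin T W" "W \<noteq> {}" "W \<subseteq> FC_bounded G n"
  obtains x V where "x \<in> FC G" "openin T V" "\<one> \<in> V"
    "V \<subseteq> centralizer G (centralizer G {x})"
proof -
  have WG: "W \<subseteq> carrier G" using W openin_subset topspace_eq by blast
  obtain w where w: "w \<in> W" using W by auto
  have "\<forall>y. y \<in> W \<longrightarrow> card (conj_class G y) < Suc n" using W(3) by (force simp: FC_bounded_def less_Suc_eq_le)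
  then obtain x where x: "x \<in> W" "\<And>y. y \<in> W \<Longrightarrow> card (conj_class G y) \<le> card (conj_class G x)"
    using ex_has_greatest_nat[of "\<lambda>y. y \<in> W" w "\<lambda>y. card (conj_class G y)" "Suc n"] w by blast
  have xG: "x \<in> carrier G" using x WG by auto
  have fin: "finite (conj_class G y)" if "y \<in> W" for y using that W by (auto simp: FC_bounded_def)
  let ?cj = "\<lambda>g y. g \<otimes> y \<otimes> inv g"
  have "conj_class G x - {x} \<subseteq> (\<lambda>g. ?cj g x) ` carrier G" by (auto simp: conj_class_image)
  then obtain E' where E': "E' \<subseteq> carrier G" "inj_on (\<lambda>g. ?cj g x) E'" "conj_class G x - {x} = (\<lambda>g. ?cj g x) ` E'"
    unfolding subset_image_inj by auto
  let ?E = "insert \<one> E'"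
  have E'x: "?cj g x \<noteq> x" if "g \<in> E'" for g using that E'(3) by blast
  have finE: "finite E'" using E' fin[OF x(1)] by (metis finite_Diff finite_imageD)
  have one_x: "?cj \<one> x = x" using xG by simp
  have "?cj \<one> x \<notin> (\<lambda>g. ?cj g x) ` (E' - {\<one>})"
  proof
    assume "?cj \<one> x \<in> (\<lambda>g. ?cj g x) ` (E' - {\<one>})"
    then obtain g where "g \<in> E'" "?cj g x = x" unfolding one_x by fastforce
    then show False using E'x by blast
  qed
  then have dc: "x \<in> distinct_conjugates G ?E"
    using E'(2) xG unfolding distinct_conjugates_def inj_on_insert by blast
  have "x \<in> conj_class G x"
    unfolding conj_class_image
    by (rule image_eqI[of _ "\<lambda>g. ?cj g x", OF one_x[symmetric] one_closed])
  then have "conj_class G x = insert x (conj_class G x - {x})" by blast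
  also have "\<dots> = (\<lambda>g. ?cj g x) ` ?E" by (simp only: E'(3) image_insert one_x)
  finally have imE: "conj_class G x = (\<lambda>g. ?cj g x) ` ?E" .
  have "inj_on (\<lambda>g. ?cj g x) ?E" using dc unfolding distinct_conjugates_def by blast
  then have cardE: "card ?E = card (conj_class G x)" unfolding imE by (rule card_image[symmetric])
  \<comment> \<open>The pairs \<open>(h, u)\<close> for which \<open>x (h u h\<^sup>-\<^sup>1)\<close> differs from the conjugates of \<open>x u\<close> by all \<open>g \<in> E'\<close>.\<close>
  define N where "N = {p \<in> topspace (prod_topology T T).
      \<forall>g\<in>E'. x \<otimes> (fst p \<otimes> snd p \<otimes> inv (fst p)) \<noteq> g \<otimes> (x \<otimes> snd p) \<otimes> inv g}"
  have "openin (prod_topology T T) N"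
  proof -
    let ?B = "\<lambda>g. {p \<in> topspace (prod_topology T T).
       x \<otimes> (fst p \<otimes> snd p \<otimes> inv (fst p)) = g \<otimes> (x \<otimes> snd p) \<otimes> inv g}"
    have "closedin (prod_topology T T) (?B g)" if "g \<in> E'" for g
      using that E'(1) xG
      by (intro closedin_equalizer continuous_map_mult continuous_map_inverse
          continuous_map_const_carrier continuous_map_fst continuous_map_snd) auto
    then have "closedin (prod_topology T T) (\<Union>g\<in>E'. ?B g)" using finE by (intro closedin_Union) auto
    then have "openin (prod_topology T T) (topspace (prod_topology T T) - (\<Union>g\<in>E'. ?B g))"
      by (rule openin_diff[OF openin_topspace])
    also have "topspace (prod_topology T T) - (\<Union>g\<in>E'. ?B g) = N" unfolding N_def by blast
    finally show ?thesis .
  qed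
  moreover have "topspace T \<times> {\<one>} \<subseteq> N"
  proof
    fix p assume "p \<in> topspace T \<times> {\<one>}"
    then obtain h where h: "h \<in> carrier G" "p = (h, \<one>)" by (auto simp: topspace_eq)
    have "x \<otimes> (h \<otimes> \<one> \<otimes> inv h) \<noteq> g \<otimes> (x \<otimes> \<one>) \<otimes> inv g" if "g \<in> E'" for g
      using E'x[OF that] xG h by auto
    then show "p \<in> N" using h by (simp add: N_def topspace_eq)
  qed
  ultimately obtain U V where UV: "openin T U" "openin T V" "topspace T \<subseteq> U" "\<one> \<in> V" "U \<times> V \<subseteq> N"
    using tube_lemma_left[of T T N "topspace T" \<one>] compact by (auto simp: compact_space_def topspace_eq)
  have VG: "V \<subseteq> carrier G" using UV openin_subset topspace_eq by blast
  define V' where "V' = V \<inter> {u \<in> topspace T. x \<otimes> u \<in> W \<inter> distinct_conjugates G ?E}"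
  have op: "openin T (W \<inter> distinct_conjugates G ?E)"
    using W(1) finE E'(1) by (intro openin_Int openin_distinct_conjugates) auto
  have "openin T V'"
    unfolding V'_def
    by (rule openin_Int[OF UV(2) openin_continuous_map_preimage[OF continuous_map_left_mult[OF xG] op]])
  moreover have "\<one> \<in> V'" using UV x(1) xG dc by (simp add: V'_def topspace_eq)
  moreover have "V' \<subseteq> centralizer G (centralizer G {x})"
  proof
    fix u assume u: "u \<in> V'"
    then have uG: "u \<in> carrier G" and xu: "x \<otimes> u \<in> W" "x \<otimes> u \<in> distinct_conjugates G ?E" and uV: "u \<in> V"
      using VG by (auto simp: V'_def)
    have "(\<lambda>g. ?cj g (x \<otimes> u)) ` ?E = conj_class G (x \<otimes> u)"
    proof (rule card_seteq[OF fin[OF xu(1)]])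
      show "(\<lambda>g. ?cj g (x \<otimes> u)) ` ?E \<subseteq> conj_class G (x \<otimes> u)"
        unfolding conj_class_image using E'(1) by (intro image_mono) auto
      have "card ((\<lambda>g. ?cj g (x \<otimes> u)) ` ?E) = card ?E"
        using xu(2) unfolding distinct_conjugates_def by (intro card_image) blast
      then show "card (conj_class G (x \<otimes> u)) \<le> card ((\<lambda>g. ?cj g (x \<otimes> u)) ` ?E)"
        using x(2)[OF xu(1)] cardE by simp
    qed
    then have cl: "\<exists>g\<in>?E. ?cj h (x \<otimes> u) = ?cj g (x \<otimes> u)" if "h \<in> carrier G" for h
      using that unfolding conj_class_image by blast
    have "u \<otimes> h = h \<otimes> u" if h: "h \<in> centralizer G {x}" for h
    proof -
      have hG: "h \<in> carrier G" and hx: "h \<otimes> x = x \<otimes> h" using h by (auto simp: centralizer_def)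
      have "?cj h (x \<otimes> u) = (h \<otimes> x) \<otimes> u \<otimes> inv h" using hG xG uG by (simp add: m_assoc)
      then have 1: "?cj h (x \<otimes> u) = x \<otimes> (h \<otimes> u \<otimes> inv h)"
        unfolding hx using hG xG uG by (simp add: m_assoc)
      have "(h, u) \<in> N" using UV(3,5) hG uV by (auto simp: topspace_eq)
      then have "\<forall>g\<in>E'. ?cj h (x \<otimes> u) \<noteq> ?cj g (x \<otimes> u)" by (simp add: N_def 1)
      then have "?cj h (x \<otimes> u) = ?cj \<one> (x \<otimes> u)" using cl[OF hG] by auto
      then have "x \<otimes> (h \<otimes> u \<otimes> inv h) = x \<otimes> u" using 1 xG uG by simp
      then have "h \<otimes> u \<otimes> inv h = u" using xG hG uG by simp
      then have "h \<otimes> u \<otimes> inv h \<otimes> h = u \<otimes> h" by simp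
      then show ?thesis using hG uG by (simp add: m_assoc)
    qed
    then show "u \<in> centralizer G (centralizer G {x})" using uG by (auto simp: centralizer_def)
  qed
  moreover have "x \<in> FC G" using x W by (auto simp: FC_eq_UN_FC_bounded)
  ultimately show ?thesis using that by blast
qed

text \<open>With \<open>x\<close> as above, the centralizer \<open>D\<close> of \<open>x\<close> has finite index, and so has its own centralizer,
  which is open. Their intersection \<open>A\<close> is abelian of finite index, therefore contained in the
  FC-center; the elements of \<open>A\<close> that commute with representatives of the finitely many cosets
  of \<open>A\<close> in the FC-center are central in it.\<close>

lemma center_FC_finite_index:
  assumes "finite (rcosets FC G)"
  shows "closedin T (FC G)" "finite (rcosets (FC G \<inter> centralizer G (FC G)))"
proof -
  let ?F = "FC G"
  have FG: "?F \<subseteq> carrier G" by (auto simp: FC_def)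
  obtain n W where "openin T W" "W \<noteq> {}" "W \<subseteq> FC_bounded G n"
    using FC_bounded_interior[OF assms] .
  then obtain x V where xV: "x \<in> ?F" "openin T V" "\<one> \<in> V" "V \<subseteq> centralizer G (centralizer G {x})"
    using centralizer_of_centralizer_open by blast
  define D where "D = centralizer G {x}"
  define A where "A = D \<inter> centralizer G D"
  have D: "subgroup D G" unfolding D_def using xV FG by (intro subgroup_centralizer) auto
  then have DG: "D \<subseteq> carrier G" by (rule subgroup.subset)
  then have CD: "subgroup (centralizer G D) G" by (rule subgroup_centralizer)
  have A: "subgroup A G" unfolding A_def using D CD by (rule subgroups_Inter_pair)
  have AG: "A \<subseteq> carrier G" using A by (rule subgroup.subset)
  have finD: "finite (rcosets D)" unfolding D_def using xV FG by (simp add: finite_index_centralizer_iff subset_iff)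
  have VG: "V \<subseteq> carrier G" using xV openin_subset topspace_eq by blast
  obtain R where R: "R \<subseteq> carrier G" "finite R" "carrier G \<subseteq> (\<Union>s\<in>R. s <# V)"
    using finite_cover[OF xV(2,3)] .
  have "\<forall>y\<in>carrier G. \<exists>s\<in>R. inv s \<otimes> y \<in> centralizer G D"
  proof
    fix y assume "y \<in> carrier G"
    then obtain s where "s \<in> R" "y \<in> s <# V" using R(3) by blast
    then show "\<exists>s\<in>R. inv s \<otimes> y \<in> centralizer G D"
      using mem_l_coset_iff[of s V y] R(1) VG xV(4) D_def by blast
  qed
  then have "finite (rcosets (centralizer G D))" by (rule finite_index_cover[OF CD R(2,1)])
  then have finA: "finite (rcosets A)" unfolding A_def by (rule finite_index_Int[OF D CD finD])
  have abelian: "a \<otimes> b = b \<otimes> a" if "a \<in> A" "b \<in> A" for a b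
  proof -
    have "a \<in> centralizer G D" "b \<in> D" using that by (auto simp: A_def)
    then show ?thesis unfolding centralizer_def by blast
  qed
  have AF: "A \<subseteq> ?F"
  proof
    fix a assume a: "a \<in> A"
    then have aG: "a \<in> carrier G" using AG by auto
    have "A \<subseteq> centralizer G {a}" using abelian a AG unfolding centralizer_def by blast
    then have "finite (rcosets (centralizer G {a}))"
      using finite_index_mono[OF A _ _ finA] subgroup_centralizer[of "{a}"] aG by blast
    then show "a \<in> ?F" using aG by (simp add: finite_index_centralizer_iff)
  qed
  obtain S where S: "finite S" "S \<subseteq> carrier G" "\<forall>x\<in>carrier G. \<exists>s\<in>S. inv s \<otimes> x \<in> A"
      "\<forall>s\<in>S. \<forall>t\<in>S. inv s \<otimes> t \<in> A \<longrightarrow> s = t"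
    using finite_index_representatives[OF A finA] .
  define S' where "S' = S \<inter> ?F"
  have cover: "\<exists>s\<in>S'. \<exists>a\<in>A. y = s \<otimes> a" if y: "y \<in> ?F" for y
  proof -
    have yG: "y \<in> carrier G" using y FG by auto
    then obtain s where s: "s \<in> S" "inv s \<otimes> y \<in> A" using S(3) by auto
    have sG: "s \<in> carrier G" using s S by auto
    have "s = y \<otimes> inv (inv s \<otimes> y)" using sG yG by (simp add: group_normalize)
    moreover have "inv (inv s \<otimes> y) \<in> ?F" using s AF by (intro subgroup.m_inv_closed[OF subgroup_FC]) auto
    ultimately have "s \<in> ?F" using subgroup.m_closed[OF subgroup_FC y] by metis
    moreover have "y = s \<otimes> (inv s \<otimes> y)" using sG yG by (simp add: group_normalize)
    ultimately show ?thesis using s by (auto simp: S'_def)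
  qed
  show "closedin T ?F"
  proof -
    have "closedin T A" unfolding A_def D_def using xV(1) FG DG[unfolded D_def]
      by (intro closedin_Int closedin_centralizer) auto
    then have "closedin T (\<Union>s\<in>S'. s <# A)"
      using S by (intro closedin_Union) (auto simp: S'_def intro: closedin_l_coset)
    also have "(\<Union>s\<in>S'. s <# A) = ?F"
    proof
      show "(\<Union>s\<in>S'. s <# A) \<subseteq> ?F"
        using AF by (auto simp: l_coset_image S'_def intro: subgroup.m_closed[OF subgroup_FC])
      show "?F \<subseteq> (\<Union>s\<in>S'. s <# A)" using cover unfolding l_coset_image by blast
    qed
    finally show ?thesis .
  qed
  have S'F: "S' \<subseteq> ?F" "finite S'" using S by (auto simp: S'_def)
  then have C: "subgroup (centralizer G S') G" using FG by (intro subgroup_centralizer) auto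
  have "finite (rcosets (A \<inter> centralizer G S'))"
    using finite_index_centralizer_finite[OF S'F(2,1)] by (rule finite_index_Int[OF A C finA])
  moreover have "A \<inter> centralizer G S' \<subseteq> ?F \<inter> centralizer G ?F"
  proof
    fix z assume z: "z \<in> A \<inter> centralizer G S'"
    then have zG: "z \<in> carrier G" using AG by auto
    have "z \<otimes> y = y \<otimes> z" if yF: "y \<in> ?F" for y
    proof -
      obtain s a where sa: "s \<in> S'" "a \<in> A" "y = s \<otimes> a" using cover[OF yF] by blast
      have c: "s \<in> carrier G" "a \<in> carrier G" using sa S'F FG AG by auto
      have 1: "z \<otimes> s = s \<otimes> z" using z sa by (auto simp: centralizer_def)
      have 2: "z \<otimes> a = a \<otimes> z" using abelian z sa by auto
      have "z \<otimes> y = (z \<otimes> s) \<otimes> a" using c zG sa by (simp add: m_assoc)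
      also have "\<dots> = s \<otimes> (z \<otimes> a)" using c zG unfolding 1 by (simp add: m_assoc)
      also have "\<dots> = y \<otimes> z" using c zG sa unfolding 2 by (simp add: m_assoc)
      finally show ?thesis .
    qed
    then show "z \<in> ?F \<inter> centralizer G ?F" using z zG AF by (auto simp: centralizer_def)
  qed
  ultimately show "finite (rcosets (?F \<inter> centralizer G ?F))"
    using finite_index_mono[of "A \<inter> centralizer G S'" "?F \<inter> centralizer G ?F"] A C
      subgroup_FC subgroup_centralizer[OF FG] by (simp add: subgroups_Inter_pair)
qed

end

section \<open>Transfer and finitely generated central subgroups\<close>

context group
begin

lemma center_eq_centralizer: "center G = centralizer G (carrier G)"
  by (simp add: center_def centralizer_def)

lemma subgroup_center: "subgroup (center G) G"
  unfolding center_eq_centralizer by (rule subgroup_centralizer) simp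

lemma center_subset: "center G \<subseteq> carrier G"
  by (auto simp: center_def)

lemma center_comm: "z \<in> center G \<Longrightarrow> x \<in> carrier G \<Longrightarrow> z \<otimes> x = x \<otimes> z"
  by (simp add: center_def)

lemma normal_center: "center G \<lhd> G"
proof (rule normalI[OF subgroup_center], rule ballI)
  fix x assume "x \<in> carrier G"
  then show "center G #> x = x <# center G"
    unfolding r_coset_def l_coset_def by (intro SUP_cong refl) (metis center_comm)
qed

lemma comm_group_center: "comm_group (G\<lparr>carrier := center G\<rparr>)"
proof -
  interpret Z: group "G\<lparr>carrier := center G\<rparr>" by (rule subgroup_imp_group[OF subgroup_center])
  show ?thesis
    by (rule Z.group_comm_groupI) (use center_comm center_subset in auto)
qed

lemma generate_commutator:
  "derived G (carrier G) = generate G {commutator G x y | x y. x \<in> carrier G \<and> y \<in> carrier G}"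
proof -
  have "derived_set G (carrier G) = {commutator G x y | x y. x \<in> carrier G \<and> y \<in> carrier G}"
    by (auto simp: commutator_def)
  then show ?thesis by (simp add: derived_def)
qed

lemma commutator_closed: "x \<in> carrier G \<Longrightarrow> y \<in> carrier G \<Longrightarrow> commutator G x y \<in> carrier G"
  by (simp add: commutator_def)

lemma commutator_in_derived:
  "x \<in> carrier G \<Longrightarrow> y \<in> carrier G \<Longrightarrow> commutator G x y \<in> derived G (carrier G)"
  unfolding generate_commutator by (rule generate.incl) auto

lemma subgroup_derived: "subgroup (derived G (carrier G)) G"
  unfolding generate_commutator by (rule generate_is_subgroup) (auto simp: commutator_closed)

lemma commutator_eq_one_iff:
  assumes "x \<in> carrier G" "y \<in> carrier G"
  shows "commutator G x y = \<one> \<longleftrightarrow> x \<otimes> y = y \<otimes> x"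
proof -
  have "commutator G x y = (x \<otimes> y) \<otimes> inv (y \<otimes> x)"
    using assms by (simp add: commutator_def group_normalize)
  moreover have "(x \<otimes> y) \<otimes> inv (y \<otimes> x) = \<one> \<longleftrightarrow> x \<otimes> y = y \<otimes> x"
  proof
    assume "(x \<otimes> y) \<otimes> inv (y \<otimes> x) = \<one>"
    then have "inv (inv (y \<otimes> x)) = x \<otimes> y" using assms by (intro inv_equality) auto
    then show "x \<otimes> y = y \<otimes> x" using assms by simp
  qed (use assms in simp)
  ultimately show ?thesis by simp
qed

text \<open>Commutators depend only on the cosets of the center; this is what makes isoclinism meaningful.\<close>

lemma commutator_mult_center:
  assumes z: "z \<in> center G" "w \<in> center G" and x: "x \<in> carrier G" "y \<in> carrier G"
  shows "commutator G (z \<otimes> x) (w \<otimes> y) = commutator G x y"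
proof -
  have c: "z \<in> carrier G" "w \<in> carrier G" using z center_subset by auto
  define d where "d = x \<otimes> (y \<otimes> inv x)"
  have d: "d \<in> carrier G" using x by (simp add: d_def)
  have "(z \<otimes> x) \<otimes> (w \<otimes> y) = z \<otimes> ((x \<otimes> w) \<otimes> y)" using c x by (simp add: m_assoc)
  also have "x \<otimes> w = w \<otimes> x" using center_comm[OF z(2) x(1)] by simp
  finally have "(z \<otimes> x) \<otimes> (w \<otimes> y) \<otimes> inv (z \<otimes> x) = z \<otimes> (w \<otimes> d) \<otimes> inv z"
    using c x by (simp add: d_def group_normalize)
  also have "\<dots> = w \<otimes> d"
    using center_comm[OF z(1), of "w \<otimes> d"] c d by (simp add: m_assoc)
  finally have "commutator G (z \<otimes> x) (w \<otimes> y) = (w \<otimes> d) \<otimes> inv (w \<otimes> y)"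
    by (simp add: commutator_def)
  also have "\<dots> = w \<otimes> (d \<otimes> inv y) \<otimes> inv w" using c d x by (simp add: group_normalize)
  also have "\<dots> = d \<otimes> inv y"
    using center_comm[OF z(2), of "d \<otimes> inv y"] c d x by (simp add: m_assoc)
  also have "\<dots> = commutator G x y" using x by (simp add: commutator_def d_def m_assoc)
  finally show ?thesis .
qed

text \<open>The transfer into the center is a homomorphism, so it vanishes on the derived subgroup; on
  the center itself it is the power map whose exponent is the index.\<close>

lemma derived_Int_center_pow:
  assumes fin: "finite (rcosets center G)" and a: "a \<in> derived G (carrier G)" "a \<in> center G"
  shows "a [^] card (rcosets center G) = \<one>"
proof -
  let ?Z = "center G" and ?Q = "rcosets center G"
  let ?C = "G\<lparr>carrier := center G\<rparr>"
  interpret C: comm_group ?C by (rule comm_group_center)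
  have Z: "subgroup ?Z G" by (rule subgroup_center)
  have "\<forall>X\<in>?Q. \<exists>b\<in>carrier G. X = ?Z #> b" by (auto simp: rcosets_image)
  then obtain r where r: "\<And>X. X \<in> ?Q \<Longrightarrow> r X \<in> carrier G" "\<And>X. X \<in> ?Q \<Longrightarrow> ?Z #> r X = X"
    by metis
  have shift: "X #> x \<in> ?Q" "X #> x = ?Z #> (r X \<otimes> x)" if "X \<in> ?Q" "x \<in> carrier G" for X x
  proof -
    show "X #> x = ?Z #> (r X \<otimes> x)"
      using coset_mult_assoc[OF center_subset r(1)[OF that(1)] that(2)] unfolding r(2)[OF that(1)] .
    then show "X #> x \<in> ?Q" using r that by (simp add: rcosets_image)
  qed
  \<comment> \<open>The coset representatives \<open>r X\<close> satisfy \<open>r X x = d X x \<otimes> r (X x)\<close>; the transfer \<open>\<tau> x\<close> is the product of all \<open>d X x\<close>.\<close>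
  define d where "d X x = r X \<otimes> x \<otimes> inv (r (X #> x))" for X x
  have d: "d X x \<in> ?Z" if "X \<in> ?Q" "x \<in> carrier G" for X x
    unfolding d_def using r_coset_eq_iff[OF Z, of "r X \<otimes> x" "r (X #> x)"] that r shift by simp
  define \<tau> where "\<tau> x = finprod ?C (\<lambda>X. d X x) ?Q" for x
  have \<tau>_closed: "\<tau> x \<in> ?Z" if "x \<in> carrier G" for x
    using C.finprod_closed[of "\<lambda>X. d X x" ?Q] d that by (auto simp: \<tau>_def)
  have \<tau>_mult: "\<tau> (x \<otimes> y) = \<tau> x \<otimes> \<tau> y" if xy: "x \<in> carrier G" "y \<in> carrier G" for x y
  proof -
    have inj: "inj_on (\<lambda>X. X #> x) ?Q"
    proof (rule inj_onI)
      fix X Y assume XY: "X \<in> ?Q" "Y \<in> ?Q" "X #> x = Y #> x"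
      have sub: "X \<subseteq> carrier G" "Y \<subseteq> carrier G"
        using XY rcosets_part_G[OF Z] by blast+
      have "X = X #> x #> inv x" "Y = Y #> x #> inv x"
        using sub xy by (simp_all add: coset_mult_assoc)
      then show "X = Y" using XY(3) by simp
    qed
    then have img: "(\<lambda>X. X #> x) ` ?Q = ?Q"
      using fin shift xy by (intro endo_inj_surj) auto
    have "d X (x \<otimes> y) = d X x \<otimes> d (X #> x) y" if X: "X \<in> ?Q" for X
    proof -
      have sub: "X \<subseteq> carrier G" using X rcosets_part_G[OF Z] by blast
      then have "X #> (x \<otimes> y) = X #> x #> y" using xy by (simp add: coset_mult_assoc)
      then show ?thesis
        using r X xy shift by (simp add: d_def group_normalize)
    qed
    then have "\<tau> (x \<otimes> y) = finprod ?C (\<lambda>X. d X x \<otimes>\<^bsub>?C\<^esub> d (X #> x) y) ?Q"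
      unfolding \<tau>_def using d xy shift C.m_closed
      by (intro C.finprod_cong') (auto simp: Pi_def subgroup.m_closed[OF Z])
    also have "\<dots> = \<tau> x \<otimes> finprod ?C (\<lambda>X. d (X #> x) y) ?Q"
      unfolding \<tau>_def using d xy shift by (subst C.finprod_multf) (auto simp: Pi_def)
    also have "finprod ?C (\<lambda>X. d (X #> x) y) ?Q = finprod ?C (\<lambda>X. d X y) ((\<lambda>X. X #> x) ` ?Q)"
      using d xy shift inj by (intro C.finprod_reindex[symmetric]) (auto simp: Pi_def)
    also have "\<dots> = \<tau> y" unfolding img \<tau>_def ..
    finally show ?thesis .
  qed
  have hom: "group_hom G ?C \<tau>"
    using \<tau>_closed \<tau>_mult by unfold_locales (auto simp: hom_def)
  then interpret \<tau>: group_hom G ?C \<tau> .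
  have "commutator G x y \<in> kernel G ?C \<tau>" if "x \<in> carrier G" "y \<in> carrier G" for x y
  proof -
    have "\<tau> (commutator G x y) = \<tau> x \<otimes>\<^bsub>?C\<^esub> \<tau> y \<otimes>\<^bsub>?C\<^esub> inv\<^bsub>?C\<^esub> \<tau> x \<otimes>\<^bsub>?C\<^esub> inv\<^bsub>?C\<^esub> \<tau> y"
      unfolding commutator_def using that by (simp only: \<tau>.hom_mult \<tau>.hom_inv m_closed inv_closed)
    also have "\<dots> = \<tau> y \<otimes>\<^bsub>?C\<^esub> \<tau> x \<otimes>\<^bsub>?C\<^esub> inv\<^bsub>?C\<^esub> \<tau> x \<otimes>\<^bsub>?C\<^esub> inv\<^bsub>?C\<^esub> \<tau> y"
      using C.m_comm[OF \<tau>.hom_closed \<tau>.hom_closed] that by simp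
    also have "\<dots> = \<one>\<^bsub>?C\<^esub>"
      using that \<tau>.hom_closed
      by (simp only: C.m_assoc C.r_inv C.inv_closed C.m_closed C.r_one C.mult_inv_cancel)
    finally show ?thesis using that by (simp add: kernel_def commutator_closed)
  qed
  then have "derived G (carrier G) \<subseteq> kernel G ?C \<tau>"
    unfolding generate_commutator
    by (intro generate_subgroup_incl \<tau>.subgroup_kernel) auto
  then have "\<tau> a = \<one>" using a by (auto simp: kernel_def)
  moreover have "\<tau> a = finprod ?C (\<lambda>X. a) ?Q"
    unfolding \<tau>_def
  proof (rule C.finprod_cong')
    fix X assume X: "X \<in> ?Q"
    have ac: "a \<in> carrier G" using a center_subset by auto
    have "r X \<otimes> a \<otimes> inv (r X) \<in> ?Z"
      using center_comm[OF a(2) r(1)[OF X]] r(1)[OF X] a(2) ac by (simp add: group_normalize flip: center_comm[OF a(2) r(1)[OF X]])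
    then have "?Z #> (r X \<otimes> a) = ?Z #> r X"
      using r_coset_eq_iff[OF Z, of "r X \<otimes> a" "r X"] r(1)[OF X] ac by simp
    then have "X #> a = X" using shift(2)[OF X ac] r(2)[OF X] by simp
    then show "d X a = a"
      using r(1)[OF X] ac unfolding d_def by (simp add: m_assoc flip: center_comm[OF a(2) r(1)[OF X]])
  qed (use a in auto)
  then have "\<tau> a = a [^]\<^bsub>?C\<^esub> card ?Q" using C.finprod_const[of a ?Q] a by simp
  ultimately show ?thesis by (simp add: nat_pow_consistent[symmetric])
qed

lemma generate_insert_central:
  assumes E: "E \<subseteq> center G" and e: "e \<in> center G" and x: "x \<in> generate G (insert e E)"
  obtains j :: int and z where "z \<in> generate G E" "x = e [^] j \<otimes> z"
proof -
  have eE: "insert e E \<subseteq> carrier G" and EG: "E \<subseteq> carrier G" and eG: "e \<in> carrier G"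
    using E e center_subset by auto
  have gc: "generate G E \<subseteq> carrier G" using generate_incl[OF EG] .
  have "\<exists>(j::int) z. z \<in> generate G E \<and> x = e [^] j \<otimes> z"
    using x
  proof (induction x rule: generate.induct)
    case one
    show ?case by (rule exI[of _ 0], rule exI[of _ \<one>]) (auto intro: generate.one)
  next
    case (incl h)
    then consider "h = e" | "h \<in> E" by auto
    then show ?case
    proof cases
      case 1
      then show ?thesis using eG
        by (intro exI[of _ 1] exI[of _ \<one>]) (auto intro: generate.one simp: int_pow_1)
    next
      case 2
      then show ?thesis using EG
        by (intro exI[of _ 0] exI[of _ h]) (auto intro: generate.incl)
    qed
  next
    case (inv h)
    then consider "h = e" | "h \<in> E" by auto
    then show ?case
    proof cases
      case 1
      then show ?thesis using eG
        by (intro exI[of _ "- 1"] exI[of _ \<one>]) (auto intro: generate.one simp: int_pow_neg int_pow_1)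
    next
      case 2
      then show ?thesis using EG
        by (intro exI[of _ 0] exI[of _ "inv h"]) (auto intro: generate.inv)
    qed
  next
    case (eng h k)
    then obtain i j :: int and z w where h: "z \<in> generate G E" "h = e [^] i \<otimes> z"
      and k: "w \<in> generate G E" "k = e [^] j \<otimes> w" by blast
    have c: "z \<in> carrier G" "w \<in> carrier G" "e [^] i \<in> carrier G" "e [^] j \<in> carrier G"
      using h k gc eG by auto
    have "e [^] j \<in> center G" by (rule subgroup_int_pow_closed[OF subgroup_center e])
    then have zj: "z \<otimes> e [^] j = e [^] j \<otimes> z" using center_comm c by metis
    have "h \<otimes> k = e [^] i \<otimes> (z \<otimes> e [^] j) \<otimes> w" using h k c by (simp add: m_assoc)
    also have "\<dots> = e [^] (i + j) \<otimes> (z \<otimes> w)"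
      unfolding zj using c eG by (simp add: int_pow_mult m_assoc)
    finally show ?case using generate.eng[OF h(1) k(1)] by blast
  qed
  then show ?thesis using that by blast
qed

text \<open>A finitely generated abelian group has a torsion-free subgroup of finite index. The induction
  over the generators leaves \<open>A\<close> unchanged if a power of the new generator \<open>e\<close> with nonzero exponent
  lies in the old group; otherwise the product with the cyclic group of \<open>e\<close> is direct and torsion-free. The
  finite set \<open>B\<close> represents the cosets of \<open>A\<close>.\<close>

lemma torsion_free_finite_index:
  assumes "finite E" "E \<subseteq> center G"
  shows "\<exists>A B. subgroup A G \<and> A \<subseteq> generate G E \<and> (\<forall>a\<in>A. \<forall>k::nat. 0 < k \<longrightarrow> a [^] k = \<one> \<longrightarrow> a = \<one>) \<and>
    finite B \<and> B \<subseteq> generate G E \<and> (\<forall>z\<in>generate G E. \<exists>b\<in>B. \<exists>a\<in>A. z = b \<otimes> a)"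
  using assms
proof (induction E rule: finite_induct)
  case empty
  have "generate G {} = {\<one>}" by (rule generate_empty)
  then show ?case
    by (intro exI[of _ "{\<one>}"]) (auto simp: triv_subgroup)
next
  case (insert e E)
  then obtain A B where A: "subgroup A G" "A \<subseteq> generate G E"
      "\<forall>a\<in>A. \<forall>k::nat. 0 < k \<longrightarrow> a [^] k = \<one> \<longrightarrow> a = \<one>"
    and B: "finite B" "B \<subseteq> generate G E" "\<forall>z\<in>generate G E. \<exists>b\<in>B. \<exists>a\<in>A. z = b \<otimes> a" by auto
  have e: "e \<in> center G" and E: "E \<subseteq> center G" using insert.prems by auto
  then have eG: "e \<in> carrier G" and EG: "E \<subseteq> carrier G" using center_subset by auto
  have S: "subgroup (generate G E) G" by (rule generate_is_subgroup[OF EG])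
  then have SG: "generate G E \<subseteq> carrier G" by (rule subgroup.subset)
  have S': "subgroup (generate G (insert e E)) G" using eG EG by (intro generate_is_subgroup) auto
  have mono: "generate G E \<subseteq> generate G (insert e E)" by (rule mono_generate) auto
  have epow: "e [^] j \<in> generate G (insert e E)" for j :: int
    by (rule subgroup_int_pow_closed[OF S']) (auto intro: generate.incl)
  have epowc: "e [^] j \<in> center G" for j :: int by (rule subgroup_int_pow_closed[OF subgroup_center e])
  have powc: "e [^] j \<in> carrier G" for j :: int using eG by simp
  show ?case
  proof (cases "\<exists>j::int. j \<noteq> 0 \<and> e [^] j \<in> generate G E")
    case True
    then obtain j :: int where j: "j \<noteq> 0" "e [^] j \<in> generate G E" by auto
    define k where "k = \<bar>j\<bar>"
    have k: "0 < k" "e [^] k \<in> generate G E"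
    proof -
      show "0 < k" using j by (simp add: k_def)
      have "e [^] (- j) \<in> generate G E" using subgroup.m_inv_closed[OF S j(2)] eG by (simp add: int_pow_neg)
      then show "e [^] k \<in> generate G E" using j(2) unfolding k_def abs_if by auto
    qed
    define B' where "B' = (\<lambda>(i, b). e [^] i \<otimes> b) ` ({0..<k} \<times> B)"
    have "\<exists>b\<in>B'. \<exists>a\<in>A. z = b \<otimes> a" if z: "z \<in> generate G (insert e E)" for z
    proof -
      obtain i :: int and w where iw: "w \<in> generate G E" "z = e [^] i \<otimes> w"
        using generate_insert_central[OF E e z] .
      have kq: "(e [^] k) [^] (i div k) \<in> generate G E" by (rule subgroup_int_pow_closed[OF S k(2)])
      then have "(e [^] k) [^] (i div k) \<otimes> w \<in> generate G E" using iw by (intro generate.eng)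
      then obtain b a where ba: "b \<in> B" "a \<in> A" "(e [^] k) [^] (i div k) \<otimes> w = b \<otimes> a" using B(3) by blast
      have c: "w \<in> carrier G" "b \<in> carrier G" "a \<in> carrier G" using iw ba A(2) B(2) SG by auto
      have "e [^] i = e [^] (i mod k + k * (i div k))" by simp
      also have "\<dots> = e [^] (i mod k) \<otimes> (e [^] k) [^] (i div k)"
        using eG by (simp only: int_pow_mult int_pow_pow)
      finally have "z = e [^] (i mod k) \<otimes> ((e [^] k) [^] (i div k) \<otimes> w)"
        using iw c kq SG powc by (auto simp: m_assoc)
      also have "\<dots> = (e [^] (i mod k) \<otimes> b) \<otimes> a" unfolding ba(3) using c powc by (simp add: m_assoc)
      finally have "z = (e [^] (i mod k) \<otimes> b) \<otimes> a" .
      moreover have "e [^] (i mod k) \<otimes> b \<in> B'" using ba k by (force simp: B'_def)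
      ultimately show ?thesis using ba by blast
    qed
    moreover have "B' \<subseteq> generate G (insert e E)"
      using epow B(2) mono by (auto simp: B'_def intro!: generate.eng)
    moreover have "finite B'" using B by (simp add: B'_def)
    ultimately show ?thesis using A mono by (intro exI[of _ A] exI[of _ B']) auto
  next
    case False
    define A' where "A' = {e [^] j \<otimes> a | (j::int) a. a \<in> A}"
    have AG: "A \<subseteq> carrier G" using A SG by auto
    have "subgroup A' G"
    proof (rule subgroupI)
      show "A' \<subseteq> carrier G" using AG powc by (auto simp: A'_def)
      show "A' \<noteq> {}" using subgroup.one_closed[OF A(1)] by (auto simp: A'_def)
    next
      fix x assume "x \<in> A'"
      then obtain j :: int and a where x: "a \<in> A" "x = e [^] j \<otimes> a" by (auto simp: A'_def)
      have "inv x = inv a \<otimes> e [^] (- j)" using x AG eG by (auto simp: inv_mult_group int_pow_neg)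
      also have "\<dots> = e [^] (- j) \<otimes> inv a" using center_comm[OF epowc] x AG by auto
      finally show "inv x \<in> A'" using subgroup.m_inv_closed[OF A(1) x(1)] by (auto simp: A'_def)
    next
      fix x y assume "x \<in> A'" "y \<in> A'"
      then obtain i j :: int and a b where x: "a \<in> A" "x = e [^] i \<otimes> a" and y: "b \<in> A" "y = e [^] j \<otimes> b"
        unfolding A'_def by blast
      have c: "a \<in> carrier G" "b \<in> carrier G" using x y AG by auto
      have aj: "a \<otimes> e [^] j = e [^] j \<otimes> a" using center_comm[OF epowc c(1)] by simp
      have "x \<otimes> y = e [^] i \<otimes> (a \<otimes> e [^] j) \<otimes> b" using x y c powc by (simp add: m_assoc)
      also have "\<dots> = e [^] (i + j) \<otimes> (a \<otimes> b)" unfolding aj using c powc eG by (simp add: m_assoc int_pow_mult)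
      finally show "x \<otimes> y \<in> A'" using subgroup.m_closed[OF A(1) x(1) y(1)] by (auto simp: A'_def)
    qed
    moreover have "A' \<subseteq> generate G (insert e E)"
      using epow A(2) mono by (auto simp: A'_def intro!: generate.eng)
    moreover have "x = \<one>" if x: "x \<in> A'" and k: "0 < k" "x [^] k = \<one>" for x and k :: nat
    proof -
      obtain j :: int and a where ja: "a \<in> A" "x = e [^] j \<otimes> a" using x by (auto simp: A'_def)
      have ac: "a \<in> carrier G" using ja AG by auto
      have ak: "a [^] k \<in> generate G E"
        using subgroup_int_pow_closed[OF S, of a "int k"] ja A(2) by (auto simp: int_pow_int)
      have "\<one> = x [^] int k" using k by (simp add: int_pow_int)
      also have "\<dots> = (e [^] j) [^] int k \<otimes> a [^] int k"
        unfolding ja(2) using center_comm[OF epowc ac] powc ac by (intro int_pow_mult_distrib) auto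
      also have "\<dots> = e [^] (j * int k) \<otimes> a [^] k"
        unfolding int_pow_pow[OF eG] unfolding int_pow_int ..
      finally have one: "e [^] (j * int k) \<otimes> a [^] k = \<one>" by simp
      then have "e [^] (j * int k) = inv (a [^] k)" using powc ac by (simp add: inv_equality)
      then have "e [^] (j * int k) \<in> generate G E" using subgroup.m_inv_closed[OF S ak] by simp
      then have "j * int k = 0" using False by blast
      then have "j = 0" using k by simp
      then have "a [^] k = \<one>" "x = a" using one ja ac by auto
      then show ?thesis using A(3) ja k by auto
    qed
    moreover have "\<exists>b\<in>B. \<exists>a\<in>A'. z = b \<otimes> a" if z: "z \<in> generate G (insert e E)" for z
    proof -
      obtain i :: int and w where iw: "w \<in> generate G E" "z = e [^] i \<otimes> w"
        using generate_insert_central[OF E e z] .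
      obtain b a where ba: "b \<in> B" "a \<in> A" "w = b \<otimes> a" using B(3) iw by blast
      have c: "b \<in> carrier G" "a \<in> carrier G" using ba A(2) B(2) SG by auto
      have "z = (e [^] i \<otimes> b) \<otimes> a" using iw ba c powc by (simp add: m_assoc)
      also have "\<dots> = b \<otimes> (e [^] i \<otimes> a)" using center_comm[OF epowc c(1)] c powc by (simp add: m_assoc)
      finally show ?thesis using ba by (auto simp: A'_def)
    qed
    ultimately show ?thesis using B mono by (intro exI[of _ A'] exI[of _ B]) auto
  qed
qed

end

section \<open>Finite groups isoclinic to central-by-finite groups\<close>

text \<open>A subgroup that generates the group together with the center is isoclinic to it, and so is a
  quotient by a normal subgroup that meets the derived subgroup trivially. This lemma combines both
  steps: \<open>\<phi>\<close> maps such a subgroup \<open>K\<close> onto \<open>H\<close>.\<close>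

lemma isoclinicI:
  fixes G (structure) and H :: "('c, 'd) monoid_scheme"
  assumes G: "group G" and H: "group H" and K: "subgroup K G"
    and hom: "\<phi> \<in> hom (G\<lparr>carrier := K\<rparr>) H" and surj: "\<phi> ` K = carrier H"
    and dense: "\<And>x. x \<in> carrier G \<Longrightarrow> \<exists>z\<in>center G. \<exists>k\<in>K. x = z \<otimes> k"
    and ker: "\<And>k. \<lbrakk>k \<in> K; k \<in> derived G (carrier G); \<phi> k = \<one>\<^bsub>H\<^esub>\<rbrakk> \<Longrightarrow> k = \<one>"
  shows "isoclinic H G"
proof -
  interpret G: group G by fact
  interpret H: group H by fact
  let ?K = "G\<lparr>carrier := K\<rparr>" and ?D = "derived G (carrier G)"
  interpret K: group ?K by (rule G.subgroup_imp_group[OF K])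
  interpret \<phi>: group_hom ?K H \<phi> using hom by unfold_locales
  have KG: "K \<subseteq> carrier G" using subgroup.subset[OF K] .
  have ZG: "center G \<subseteq> carrier G" by (rule G.center_subset)
  have mult: "\<phi> (k \<otimes> l) = \<phi> k \<otimes>\<^bsub>H\<^esub> \<phi> l" if "k \<in> K" "l \<in> K" for k l
    using \<phi>.hom_mult[of k l] that by simp
  have inv: "\<phi> (inv k) = inv\<^bsub>H\<^esub> \<phi> k" if "k \<in> K" for k
    using \<phi>.hom_inv[of k] that G.m_inv_consistent[OF K] by simp
  have closed: "\<phi> k \<in> carrier H" if "k \<in> K" for k using \<phi>.hom_closed[of k] that by simp
  have Kc: "\<And>k l. k \<in> K \<Longrightarrow> l \<in> K \<Longrightarrow> k \<otimes> l \<in> K" "\<And>k. k \<in> K \<Longrightarrow> inv k \<in> K"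
    using subgroup.m_closed[OF K] subgroup.m_inv_closed[OF K] by auto
  have comK: "commutator G k l \<in> K" if "k \<in> K" "l \<in> K" for k l
    using that Kc by (simp add: commutator_def)
  have comm: "\<phi> (commutator G k l) = commutator H (\<phi> k) (\<phi> l)" if "k \<in> K" "l \<in> K" for k l
    using that Kc by (simp add: commutator_def mult inv)
  have com_dense: "\<exists>k\<in>K. \<exists>l\<in>K. commutator G x y = commutator G k l"
    if x: "x \<in> carrier G" "y \<in> carrier G" for x y
  proof -
    obtain z k where k: "z \<in> center G" "k \<in> K" "x = z \<otimes> k" using dense[OF x(1)] by blast
    obtain w l where l: "w \<in> center G" "l \<in> K" "y = w \<otimes> l" using dense[OF x(2)] by blast
    have "commutator G x y = commutator G k l"
      unfolding k l using k l KG by (intro G.commutator_mult_center) auto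
    then show ?thesis using k l by blast
  qed

  have cen: "\<phi> k \<in> center H \<longleftrightarrow> k \<in> center G" if k: "k \<in> K" for k
  proof
    assume c: "\<phi> k \<in> center H"
    have kG: "k \<in> carrier G" using k KG by auto
    have "k \<otimes> x = x \<otimes> k" if x: "x \<in> carrier G" for x
    proof -
      obtain z l where l: "z \<in> center G" "l \<in> K" "x = z \<otimes> l" using dense[OF x] by blast
      have lG: "l \<in> carrier G" using l KG by auto
      have "commutator H (\<phi> k) (\<phi> l) = \<one>\<^bsub>H\<^esub>"
        using c closed[OF k] closed[OF l(2)] by (simp add: H.commutator_eq_one_iff center_def)
      then have "\<phi> (commutator G k l) = \<one>\<^bsub>H\<^esub>" using comm k l by simp
      then have "commutator G k l = \<one>"
        using ker[OF comK[OF k l(2)]] G.commutator_in_derived kG lG by blast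
      moreover have "commutator G (\<one> \<otimes> k) (z \<otimes> l) = commutator G k l"
        using l kG lG subgroup.one_closed[OF G.subgroup_center] by (intro G.commutator_mult_center) auto
      ultimately show ?thesis using G.commutator_eq_one_iff[OF kG x] kG l by simp
    qed
    then show "k \<in> center G" using kG by (simp add: center_def)
  next
    assume c: "k \<in> center G"
    have "\<phi> k \<otimes>\<^bsub>H\<^esub> h = h \<otimes>\<^bsub>H\<^esub> \<phi> k" if h: "h \<in> carrier H" for h
    proof -
      obtain l where l: "l \<in> K" "h = \<phi> l" using h surj by auto
      have "k \<otimes> l = l \<otimes> k" using G.center_comm[OF c] l KG by auto
      then have "\<phi> (k \<otimes> l) = \<phi> (l \<otimes> k)" by simp
      then show ?thesis using mult k l by simp
    qed
    then show "\<phi> k \<in> center H" using closed[OF k] by (simp add: center_def)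
  qed

  have coset_iff: "center H #>\<^bsub>H\<^esub> \<phi> k = center H #>\<^bsub>H\<^esub> \<phi> l \<longleftrightarrow> center G #> k = center G #> l"
    if kl: "k \<in> K" "l \<in> K" for k l
  proof -
    have "center H #>\<^bsub>H\<^esub> \<phi> k = center H #>\<^bsub>H\<^esub> \<phi> l \<longleftrightarrow> \<phi> k \<otimes>\<^bsub>H\<^esub> inv\<^bsub>H\<^esub> \<phi> l \<in> center H"
      using closed kl by (intro H.r_coset_eq_iff H.subgroup_center)
    also have "\<phi> k \<otimes>\<^bsub>H\<^esub> inv\<^bsub>H\<^esub> \<phi> l = \<phi> (k \<otimes> inv l)" using kl Kc by (simp add: mult inv)
    also have "\<phi> (k \<otimes> inv l) \<in> center H \<longleftrightarrow> k \<otimes> inv l \<in> center G" using kl by (intro cen Kc)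
    also have "\<dots> \<longleftrightarrow> center G #> k = center G #> l"
      using kl KG by (intro G.r_coset_eq_iff[symmetric] G.subgroup_center) auto
    finally show ?thesis .
  qed
  \<comment> \<open>The inverse of \<open>\<phi>\<close> on cosets of the centers; \<open>\<beta>\<close> will be the inverse of \<open>\<phi>\<close> on derived subgroups.\<close>
  define s where "s X = (SOME k. k \<in> K \<and> X = center H #>\<^bsub>H\<^esub> \<phi> k)" for X
  define \<alpha> where "\<alpha> X = center G #> s X" for X
  have \<alpha>: "\<alpha> (center H #>\<^bsub>H\<^esub> \<phi> k) = center G #> k" if k: "k \<in> K" for k
  proof -
    have "s (center H #>\<^bsub>H\<^esub> \<phi> k) \<in> K \<and> center H #>\<^bsub>H\<^esub> \<phi> k = center H #>\<^bsub>H\<^esub> \<phi> (s (center H #>\<^bsub>H\<^esub> \<phi> k))"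
      unfolding s_def by (rule someI[of _ k]) (use k in blast)
    then show ?thesis unfolding \<alpha>_def using coset_iff k by metis
  qed
  have carrH: "carrier (H Mod center H) = (\<lambda>k. center H #>\<^bsub>H\<^esub> \<phi> k) ` K"
    by (simp add: FactGroup_def H.rcosets_image surj[symmetric] image_image)
  have carrG: "carrier (G Mod center G) = (\<lambda>k. center G #> k) ` K"
  proof -
    have "center G #> x \<in> (\<lambda>k. center G #> k) ` K" if x: "x \<in> carrier G" for x
    proof -
      obtain z k where k: "z \<in> center G" "k \<in> K" "x = z \<otimes> k" using dense[OF x] by blast
      have c: "z \<in> carrier G" "k \<in> carrier G" using k KG ZG by auto
      have "x \<otimes> inv k = z" using k c by (simp add: G.m_assoc)
      then have "center G #> x = center G #> k"
        using G.r_coset_eq_iff[OF G.subgroup_center x c(2)] k by simp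
      then show ?thesis using k by blast
    qed
    then show ?thesis using KG by (auto simp: FactGroup_def G.rcosets_image)
  qed
  interpret ZH: normal "center H" H by (rule H.normal_center)
  interpret ZG: normal "center G" G by (rule G.normal_center)
  have "\<alpha> \<in> iso (H Mod center H) (G Mod center G)"
    unfolding iso_def hom_def
  proof (intro CollectI conjI ballI)
    show "\<alpha> \<in> carrier (H Mod center H) \<rightarrow> carrier (G Mod center G)"
      unfolding carrH carrG using \<alpha> by auto
    fix X Y assume XY: "X \<in> carrier (H Mod center H)" "Y \<in> carrier (H Mod center H)"
    obtain k where k: "k \<in> K" "X = center H #>\<^bsub>H\<^esub> \<phi> k" using XY(1) unfolding carrH by blast
    obtain l where l: "l \<in> K" "Y = center H #>\<^bsub>H\<^esub> \<phi> l" using XY(2) unfolding carrH by blast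
    have "X \<otimes>\<^bsub>H Mod center H\<^esub> Y = center H #>\<^bsub>H\<^esub> \<phi> (k \<otimes> l)"
      using k l closed by (simp add: FactGroup_def ZH.rcos_sum mult)
    moreover have "\<alpha> X \<otimes>\<^bsub>G Mod center G\<^esub> \<alpha> Y = center G #> (k \<otimes> l)"
      using k l KG by (simp add: FactGroup_def \<alpha> ZG.rcos_sum subset_iff)
    ultimately show "\<alpha> (X \<otimes>\<^bsub>H Mod center H\<^esub> Y) = \<alpha> X \<otimes>\<^bsub>G Mod center G\<^esub> \<alpha> Y"
      using k l Kc by (simp add: \<alpha>)
  next
    show "bij_betw \<alpha> (carrier (H Mod center H)) (carrier (G Mod center G))"
      unfolding bij_betw_def carrH carrG
    proof
      show "inj_on \<alpha> ((\<lambda>k. center H #>\<^bsub>H\<^esub> \<phi> k) ` K)"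
      proof (rule inj_onI)
        fix X Y assume X: "X \<in> (\<lambda>k. center H #>\<^bsub>H\<^esub> \<phi> k) ` K" and Y: "Y \<in> (\<lambda>k. center H #>\<^bsub>H\<^esub> \<phi> k) ` K"
          and eq: "\<alpha> X = \<alpha> Y"
        obtain k where k: "k \<in> K" "X = center H #>\<^bsub>H\<^esub> \<phi> k" using X by blast
        obtain l where l: "l \<in> K" "Y = center H #>\<^bsub>H\<^esub> \<phi> l" using Y by blast
        show "X = Y" using eq k l \<alpha> coset_iff by simp
      qed
      show "\<alpha> ` (\<lambda>k. center H #>\<^bsub>H\<^esub> \<phi> k) ` K = (\<lambda>k. center G #> k) ` K"
        unfolding image_image using \<alpha> by (intro image_cong refl)
    qed
  qed

  have DK: "?D \<subseteq> K"
    unfolding G.generate_commutator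
  proof (intro G.generate_subgroup_incl K subsetI)
    fix c assume "c \<in> {commutator G x y | x y. x \<in> carrier G \<and> y \<in> carrier G}"
    then show "c \<in> K" using com_dense comK by force
  qed
  let ?cG = "{commutator G x y | x y. x \<in> carrier G \<and> y \<in> carrier G}"
    and ?cH = "{commutator H x y | x y. x \<in> carrier H \<and> y \<in> carrier H}"
  have cK: "?cG = {commutator G k l | k l. k \<in> K \<and> l \<in> K}"
    using com_dense KG by blast
  have "\<phi> ` ?cG = ?cH"
  proof (intro antisym subsetI)
    fix c assume "c \<in> \<phi> ` ?cG"
    then obtain k l where "k \<in> K" "l \<in> K" "c = \<phi> (commutator G k l)" unfolding cK by blast
    then show "c \<in> ?cH" using comm closed by blast
  next
    fix c assume "c \<in> ?cH"
    then obtain x y where "x \<in> \<phi> ` K" "y \<in> \<phi> ` K" "c = commutator H x y" unfolding surj by blast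
    then show "c \<in> \<phi> ` ?cG" unfolding cK using comm by (force intro!: image_eqI)
  qed
  moreover have cGK: "?cG \<subseteq> K" unfolding cK using comK by blast
  ultimately have imD: "\<phi> ` ?D = derived H (carrier H)"
    unfolding G.generate_commutator H.generate_commutator
    using \<phi>.generate_img[of ?cG] G.generate_consistent[OF cGK K] by simp
  have DG: "subgroup ?D G" by (rule G.subgroup_derived)
  have injD: "inj_on \<phi> ?D"
  proof (rule inj_onI)
    fix c d assume cd: "c \<in> ?D" "d \<in> ?D" "\<phi> c = \<phi> d"
    have cdK: "c \<in> K" "d \<in> K" using cd DK by auto
    have "c \<otimes> inv d \<in> ?D" using cd DG by (simp add: subgroup.m_closed subgroup.m_inv_closed)
    moreover have "\<phi> (c \<otimes> inv d) = \<one>\<^bsub>H\<^esub>" using cdK Kc cd(3) closed by (simp add: mult inv)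
    ultimately have "c \<otimes> inv d = \<one>" using ker Kc cdK by blast
    then have "inv (inv d) = c" using cdK KG by (intro G.inv_equality) auto
    then show "c = d" using cdK KG by auto
  qed
  let ?DG = "derived_subgroup G" and ?DH = "derived_subgroup H"
  have "\<phi> (c \<otimes> d) = \<phi> c \<otimes>\<^bsub>H\<^esub> \<phi> d" if "c \<in> ?D" "d \<in> ?D" for c d
    using that DK by (intro mult) auto
  then have "\<phi> \<in> iso ?DG ?DH"
    unfolding iso_def hom_def derived_subgroup_def subgroup_of_def bij_betw_def
    using imD injD by auto
  moreover have "group ?DG"
    unfolding derived_subgroup_def subgroup_of_def by (rule G.subgroup_imp_group[OF DG])
  ultimately have "inv_into ?D \<phi> \<in> iso ?DH ?DG"
    using group.iso_set_sym[of ?DG \<phi> ?DH] by (simp add: derived_subgroup_def subgroup_of_def)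
  moreover have "commutator G x' y' = inv_into ?D \<phi> (commutator H x y)"
    if xy: "x \<in> carrier H" "y \<in> carrier H"
      and x': "x' \<in> \<alpha> (center H #>\<^bsub>H\<^esub> x)" and y': "y' \<in> \<alpha> (center H #>\<^bsub>H\<^esub> y)" for x y x' y'
  proof -
    obtain k l where kl: "k \<in> K" "l \<in> K" "x = \<phi> k" "y = \<phi> l" using xy surj by blast
    obtain z where z: "z \<in> center G" "x' = z \<otimes> k" using x' \<alpha>[OF kl(1)] kl by (auto simp: r_coset_def)
    obtain w where w: "w \<in> center G" "y' = w \<otimes> l" using y' \<alpha>[OF kl(2)] kl by (auto simp: r_coset_def)
    have "commutator G x' y' = commutator G k l"
      unfolding z w using z w kl KG by (intro G.commutator_mult_center) auto
    also have "\<dots> = inv_into ?D \<phi> (\<phi> (commutator G k l))"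
      using kl KG by (intro inv_into_f_f[OF injD, symmetric] G.commutator_in_derived) auto
    also have "\<dots> = inv_into ?D \<phi> (commutator H x y)" using kl comm by simp
    finally show ?thesis .
  qed
  ultimately show ?thesis
    unfolding isoclinic_def using \<open>\<alpha> \<in> iso (H Mod center H) (G Mod center G)\<close>
    by (intro bexI[of _ \<alpha>] bexI[of _ "inv_into ?D \<phi>"]) auto
qed

text \<open>The subgroup \<open>K\<close> is generated by coset representatives \<open>R\<close> of the center and finitely many central
  elements \<open>E\<close>, namely the factors by which products and inverses of elements of \<open>R\<close> differ from
  elements of \<open>R\<close>. By the transfer, the central elements of the derived subgroup have finite
  order, so a torsion-free central subgroup \<open>A\<close> meets it trivially, and \<open>K / A\<close> is the finite group.\<close>

theorem (in group) finite_isoclinic: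
  assumes fin: "finite (rcosets center G)"
  obtains H :: "nat monoid" where "group H" "finite (carrier H)" "isoclinic H G"
proof -
  let ?Z = "center G"
  have Z: "subgroup ?Z G" by (rule subgroup_center)
  obtain R where R: "finite R" "R \<subseteq> carrier G" "\<forall>x\<in>carrier G. \<exists>s\<in>R. inv s \<otimes> x \<in> ?Z"
    "\<forall>s\<in>R. \<forall>t\<in>R. inv s \<otimes> t \<in> ?Z \<longrightarrow> s = t"
    using finite_index_representatives[OF Z fin] .
  then obtain \<rho> where \<rho>: "\<And>x. x \<in> carrier G \<Longrightarrow> \<rho> x \<in> R \<and> inv (\<rho> x) \<otimes> x \<in> ?Z" by metis
  define f where "f x = inv (\<rho> x) \<otimes> x" for x
  have f: "f x \<in> ?Z" "\<rho> x \<in> R" "x = \<rho> x \<otimes> f x" if "x \<in> carrier G" for x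
    using \<rho>[OF that] R(2) that by (auto simp: f_def mult_inv_cancel subset_iff)
  define E where "E = f ` (insert \<one> ((\<lambda>(s, t). s \<otimes> t) ` (R \<times> R) \<union> m_inv G ` R))"
  have "insert \<one> ((\<lambda>(s, t). s \<otimes> t) ` (R \<times> R) \<union> m_inv G ` R) \<subseteq> carrier G"
    using R(2) by auto
  then have E: "finite E" "E \<subseteq> ?Z" using R(1) f(1) unfolding E_def by blast+
  have EG: "E \<subseteq> carrier G" using E center_subset by auto
  define Z0 where "Z0 = generate G E"
  have Z0: "subgroup Z0 G" unfolding Z0_def by (rule generate_is_subgroup[OF EG])
  have Z0Z: "Z0 \<subseteq> ?Z" unfolding Z0_def by (rule generate_subgroup_incl[OF E(2) Z])
  have Z0G: "Z0 \<subseteq> carrier G" using Z0Z center_subset by auto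
  define K where "K = {s \<otimes> z | s z. s \<in> R \<and> z \<in> Z0}"
  have KI: "x \<otimes> z \<in> K" if x: "x \<in> carrier G" "f x \<in> E" and z: "z \<in> Z0" for x z
  proof -
    have fz: "f x \<otimes> z \<in> Z0" using x z generate.incl[of "f x" E G] by (auto simp: Z0_def intro: generate.eng)
    have c: "\<rho> x \<in> carrier G" "f x \<in> carrier G" "z \<in> carrier G" using f[OF x(1)] R(2) z Z0G center_subset by auto
    have "x \<otimes> z = (\<rho> x \<otimes> f x) \<otimes> z" using f(3)[OF x(1)] by simp
    also have "\<dots> = \<rho> x \<otimes> (f x \<otimes> z)" using c by (simp add: m_assoc)
    finally show ?thesis unfolding K_def using fz f(2)[OF x(1)] by blast
  qed
  have K: "subgroup K G"
  proof (rule subgroupI)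
    show "K \<subseteq> carrier G" using R(2) Z0G by (auto simp: K_def)
    have "\<one> \<otimes> \<one> \<in> K" using subgroup.one_closed[OF Z0] by (intro KI) (auto simp: E_def)
    then show "K \<noteq> {}" by auto
  next
    fix x assume "x \<in> K"
    then obtain s z where x: "s \<in> R" "z \<in> Z0" "x = s \<otimes> z" by (auto simp: K_def)
    have c: "s \<in> carrier G" "z \<in> carrier G" using x R(2) Z0G by auto
    have iz: "inv z \<in> Z0" using subgroup.m_inv_closed[OF Z0 x(2)] .
    have "inv x = inv z \<otimes> inv s" using x c by (simp add: inv_mult_group)
    also have "\<dots> = inv s \<otimes> inv z" using center_comm[of "inv z" "inv s"] iz Z0Z c by auto
    also have "\<dots> \<in> K" using x c iz by (intro KI) (auto simp: E_def)
    finally show "inv x \<in> K" .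
  next
    fix x y assume "x \<in> K" "y \<in> K"
    then obtain s z t w where x: "s \<in> R" "z \<in> Z0" "x = s \<otimes> z" and y: "t \<in> R" "w \<in> Z0" "y = t \<otimes> w"
      unfolding K_def by blast
    have c: "s \<in> carrier G" "z \<in> carrier G" "t \<in> carrier G" "w \<in> carrier G" using x y R(2) Z0G by auto
    have "x \<otimes> y = s \<otimes> (z \<otimes> t) \<otimes> w" using x y c by (simp add: m_assoc)
    also have "z \<otimes> t = t \<otimes> z" using center_comm[of z t] x Z0Z c by auto
    also have "s \<otimes> (t \<otimes> z) \<otimes> w = (s \<otimes> t) \<otimes> (z \<otimes> w)" using c by (simp add: m_assoc)
    also have "\<dots> \<in> K" using x y c subgroup.m_closed[OF Z0] by (intro KI) (auto simp: E_def)
    finally show "x \<otimes> y \<in> K" .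
  qed
  have KG: "K \<subseteq> carrier G" by (rule subgroup.subset[OF K])
  have Z0K: "Z0 \<subseteq> K"
  proof
    fix z assume z: "z \<in> Z0"
    then have "\<one> \<otimes> z \<in> K" by (intro KI) (auto simp: E_def)
    then show "z \<in> K" using z Z0G by auto
  qed
  obtain A B where A: "subgroup A G" "A \<subseteq> Z0" "\<forall>a\<in>A. \<forall>k::nat. 0 < k \<longrightarrow> a [^] k = \<one> \<longrightarrow> a = \<one>"
    and B: "finite B" "B \<subseteq> Z0" "\<forall>z\<in>Z0. \<exists>b\<in>B. \<exists>a\<in>A. z = b \<otimes> a"
    using torsion_free_finite_index[OF E] unfolding Z0_def by blast
  let ?K = "G\<lparr>carrier := K\<rparr>"
  interpret K: group ?K by (rule subgroup_imp_group[OF K])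
  have AK: "A \<subseteq> K" using A Z0K by auto
  have AG: "A \<subseteq> carrier G" using AK KG by auto
  have coset: "A #>\<^bsub>?K\<^esub> k = A #> k" for k by (simp add: r_coset_def)
  have normal: "A \<lhd> ?K"
  proof (rule K.normalI)
    show "subgroup A ?K" using subgroup_incl[OF A(1) K AK] .
    have "A #> k = k <# A" if "k \<in> K" for k
      unfolding r_coset_def l_coset_def using that KG A(2) Z0Z
      by (intro SUP_cong refl) (metis center_comm subset_iff)
    then show "\<forall>x\<in>carrier ?K. A #>\<^bsub>?K\<^esub> x = x <#\<^bsub>?K\<^esub> A" by (simp add: r_coset_def l_coset_def)
  qed
  have fin_cosets: "finite ((\<lambda>k. A #> k) ` K)"
  proof (rule finite_subset)
    show "(\<lambda>k. A #> k) ` K \<subseteq> (\<lambda>(s, b). A #> (s \<otimes> b)) ` (R \<times> B)"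
    proof
      fix X assume "X \<in> (\<lambda>k. A #> k) ` K"
      then obtain s z where X: "s \<in> R" "z \<in> Z0" "X = A #> (s \<otimes> z)" by (auto simp: K_def)
      obtain b a where ba: "b \<in> B" "a \<in> A" "z = b \<otimes> a" using B(3) X by blast
      have c: "s \<in> carrier G" "b \<in> carrier G" "a \<in> carrier G" using X ba R(2) B(2) Z0G AG by auto
      have "s \<otimes> z = (s \<otimes> b) \<otimes> a" using c ba by (simp add: m_assoc)
      also have "\<dots> = a \<otimes> (s \<otimes> b)" using center_comm[of a "s \<otimes> b"] ba A(2) Z0Z c by auto
      finally have "(s \<otimes> z) \<otimes> inv (s \<otimes> b) = a" using c by (simp add: m_assoc)
      then have "A #> (s \<otimes> z) = A #> (s \<otimes> b)"
        using r_coset_eq_iff[OF A(1), of "s \<otimes> z" "s \<otimes> b"] c ba by simp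
      then show "X \<in> (\<lambda>(s, b). A #> (s \<otimes> b)) ` (R \<times> B)" using X ba by auto
    qed
  qed (use R B in auto)
  obtain e :: "'a set \<Rightarrow> nat" where e: "inj_on e ((\<lambda>k. A #> k) ` K)"
    using finite_imp_inj_to_nat_seg[OF fin_cosets] by metis
  define \<phi> where "\<phi> k = e (A #> k)" for k
  have \<phi>_eq: "\<phi> k = \<phi> l \<longleftrightarrow> k \<otimes> inv l \<in> A" if kl: "k \<in> K" "l \<in> K" for k l
  proof -
    have "\<phi> k = \<phi> l \<longleftrightarrow> A #> k = A #> l" unfolding \<phi>_def using kl by (intro inj_on_eq_iff[OF e] imageI)
    also have "\<dots> \<longleftrightarrow> k \<otimes> inv l \<in> A" using kl KG by (intro r_coset_eq_iff[OF A(1)]) auto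
    finally show ?thesis .
  qed
  have weak: "weak_group_morphism \<phi> A ?K"
    using \<phi>_eq m_inv_consistent[OF K] by (intro weak_group_morphismsI normal) auto
  let ?H = "image_group \<phi> ?K"
  have H: "group ?H" by (rule K.image_group_is_group[OF weak])
  have hom: "\<phi> \<in> hom ?K ?H" by (rule K.weak_group_morphism_is_hom[OF weak])
  have carr: "\<phi> ` K = carrier ?H" by (simp add: image_group_carrier)
  have "\<phi> ` K = e ` (\<lambda>k. A #> k) ` K" by (simp add: \<phi>_def image_image)
  then have finH: "finite (carrier ?H)" using fin_cosets carr by simp
  have "isoclinic ?H G"
  proof (rule isoclinicI[OF is_group H K hom carr])
    fix x assume x: "x \<in> carrier G"
    have "x = f x \<otimes> \<rho> x" using f[OF x] center_comm[OF f(1)[OF x], of "\<rho> x"] R(2) by auto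
    moreover have "\<rho> x \<otimes> \<one> \<in> K" unfolding K_def using f[OF x] subgroup.one_closed[OF Z0] by blast
    ultimately show "\<exists>z\<in>?Z. \<exists>k\<in>K. x = z \<otimes> k" using f[OF x] R(2) by (metis r_one subset_iff)
  next
    fix k assume k: "k \<in> K" "k \<in> derived G (carrier G)" "\<phi> k = \<one>\<^bsub>?H\<^esub>"
    then have "\<phi> k = \<phi> \<one>" by (simp add: image_group_one)
    then have "k \<in> A" using \<phi>_eq[of k \<one>] k(1) subgroup.one_closed[OF K] KG by auto
    then have "k [^] card (rcosets ?Z) = \<one>"
      using derived_Int_center_pow[OF fin k(2)] A(2) Z0Z by auto
    moreover have "card (rcosets ?Z) > 0"
      using fin card_gt_0_iff[of "rcosets ?Z"] one_closed by (auto simp: rcosets_image)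
    ultimately show "k = \<one>" using A(3) \<open>k \<in> A\<close> by blast
  qed
  then show ?thesis using that H finH by blast
qed

section \<open>The commuting probability\<close>

text \<open>A finite set with exactly one element in each coset of the center.\<close>

definition center_transversal :: "('a, 'b) monoid_scheme \<Rightarrow> 'a set \<Rightarrow> bool" where
  "center_transversal G S \<longleftrightarrow> finite S \<and> S \<subseteq> carrier G \<and>
     (\<forall>x\<in>carrier G. \<exists>s\<in>S. inv\<^bsub>G\<^esub> s \<otimes>\<^bsub>G\<^esub> x \<in> center G) \<and>
     (\<forall>s\<in>S. \<forall>t\<in>S. inv\<^bsub>G\<^esub> s \<otimes>\<^bsub>G\<^esub> t \<in> center G \<longrightarrow> s = t)"

lemma center_transversalD:
  assumes "center_transversal G S"
  shows "S \<subseteq> carrier G" "finite S"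
    "x \<in> carrier G \<Longrightarrow> \<exists>s\<in>S. inv\<^bsub>G\<^esub> s \<otimes>\<^bsub>G\<^esub> x \<in> center G"
    "\<lbrakk>s \<in> S; t \<in> S; inv\<^bsub>G\<^esub> s \<otimes>\<^bsub>G\<^esub> t \<in> center G\<rbrakk> \<Longrightarrow> s = t"
  using assms unfolding center_transversal_def by blast+

lemma (in group) exists_center_transversal:
  assumes "finite (rcosets center G)"
  obtains S where "center_transversal G S"
proof -
  obtain S where "finite S" "S \<subseteq> carrier G" "\<forall>x\<in>carrier G. \<exists>s\<in>S. inv s \<otimes> x \<in> center G"
    "\<forall>s\<in>S. \<forall>t\<in>S. inv s \<otimes> t \<in> center G \<longrightarrow> s = t"
    using finite_index_representatives[OF subgroup_center assms] .
  then show ?thesis using that[of S] by (simp add: center_transversal_def)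
qed

lemma (in group) center_coset_eq_iff:
  assumes "x \<in> carrier G" "y \<in> carrier G"
  shows "center G #> x = center G #> y \<longleftrightarrow> inv x \<otimes> y \<in> center G"
proof -
  have "center G #> x = center G #> y \<longleftrightarrow> y \<otimes> inv x \<in> center G"
    using r_coset_eq_iff[OF subgroup_center assms(2,1)] by auto
  also have "\<dots> \<longleftrightarrow> inv x \<otimes> y \<in> center G"
  proof
    assume z: "y \<otimes> inv x \<in> center G"
    have "inv x \<otimes> y = inv x \<otimes> ((y \<otimes> inv x) \<otimes> x)" using assms by (simp add: m_assoc)
    also have "\<dots> = y \<otimes> inv x" using assms unfolding center_comm[OF z assms(1)] by (simp add: group_normalize)
    finally show "inv x \<otimes> y \<in> center G" using z by simp
  next
    assume z: "inv x \<otimes> y \<in> center G"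
    have "y \<otimes> inv x = x \<otimes> (inv x \<otimes> y) \<otimes> inv x" using assms by (simp add: group_normalize)
    also have "\<dots> = inv x \<otimes> y" using assms unfolding center_comm[OF z assms(1), symmetric] by (simp add: group_normalize)
    finally show "y \<otimes> inv x \<in> center G" using z by simp
  qed
  finally show ?thesis .
qed

lemma (in group) center_transversal_bij:
  assumes S: "center_transversal G S"
  shows "bij_betw (\<lambda>s. center G #> s) S (rcosets center G)"
  unfolding bij_betw_def rcosets_image
proof
  have SG: "S \<subseteq> carrier G" and cover: "\<And>x. x \<in> carrier G \<Longrightarrow> \<exists>s\<in>S. inv s \<otimes> x \<in> center G"
    and indep: "\<And>s t. \<lbrakk>s \<in> S; t \<in> S; inv s \<otimes> t \<in> center G\<rbrakk> \<Longrightarrow> s = t"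
    using center_transversalD[OF S] by blast+
  show "inj_on (\<lambda>s. center G #> s) S"
  proof (rule inj_onI)
    fix s t assume st: "s \<in> S" "t \<in> S" "center G #> s = center G #> t"
    then have "inv s \<otimes> t \<in> center G" using center_coset_eq_iff[of s t] SG by blast
    then show "s = t" by (rule indep[OF st(1,2)])
  qed
  show "(\<lambda>s. center G #> s) ` S = (\<lambda>s. center G #> s) ` carrier G"
  proof (rule antisym[OF image_mono[OF SG]], rule subsetI)
    fix X assume "X \<in> (\<lambda>s. center G #> s) ` carrier G"
    then obtain x where x: "x \<in> carrier G" "X = center G #> x" by blast
    obtain s where s: "s \<in> S" "inv s \<otimes> x \<in> center G" using cover[OF x(1)] by blast
    then have "center G #> s = X" using center_coset_eq_iff[of s x] SG x by blast
    then show "X \<in> (\<lambda>s. center G #> s) ` S" using s(1) by blast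
  qed
qed

text \<open>Whether two elements commute depends only on their cosets of the center, and isoclinism preserves
  it since \<open>\<beta>\<close> is injective on commutators.\<close>

lemma isoclinic_transversal_card:
  fixes H :: "('a, 'b) monoid_scheme" and K :: "('c, 'd) monoid_scheme"
  assumes H: "group H" and K: "group K" and iso: "isoclinic H K"
    and S: "center_transversal H S" and R: "center_transversal K R"
  shows "card S = card R"
    and "card (commuting_pairs H \<inter> (S \<times> S)) = card (commuting_pairs K \<inter> (R \<times> R))"
proof -
  interpret H: group H by fact
  interpret K: group K by fact
  obtain \<alpha> \<beta> where \<alpha>: "\<alpha> \<in> iso (H Mod center H) (K Mod center K)"
    and \<beta>: "\<beta> \<in> iso (derived_subgroup H) (derived_subgroup K)"
    and comp: "\<And>x y x' y'. \<lbrakk>x \<in> carrier H; y \<in> carrier H;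
      x' \<in> \<alpha> (center H #>\<^bsub>H\<^esub> x); y' \<in> \<alpha> (center H #>\<^bsub>H\<^esub> y)\<rbrakk> \<Longrightarrow>
      commutator K x' y' = \<beta> (commutator H x y)"
    using iso unfolding isoclinic_def by blast
  have \<alpha>_bij: "bij_betw \<alpha> (rcosets\<^bsub>H\<^esub> center H) (rcosets\<^bsub>K\<^esub> center K)"
    using \<alpha> by (simp add: iso_def FactGroup_def)
  have SH: "S \<subseteq> carrier H" and RK: "R \<subseteq> carrier K"
    using center_transversalD S R by blast+
  note bijS = H.center_transversal_bij[OF S] and bijR = K.center_transversal_bij[OF R]
  \<comment> \<open>Each \<open>s\<close> goes to the representative of the coset that \<open>\<alpha>\<close> assigns to the coset of \<open>s\<close>.\<close>
  define g where "g = the_inv_into R (\<lambda>s. center K #>\<^bsub>K\<^esub> s) \<circ> (\<alpha> \<circ> (\<lambda>s. center H #>\<^bsub>H\<^esub> s))"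
  have g: "bij_betw g S R"
    unfolding g_def by (intro bij_betw_trans[OF bij_betw_trans[OF bijS \<alpha>_bij]] bij_betw_the_inv_into bijR)
  then show "card S = card R" by (rule bij_betw_same_card)
  have gR: "g s \<in> R" if "s \<in> S" for s using g that bij_betwE by blast
  have g_mem: "g s \<in> \<alpha> (center H #>\<^bsub>H\<^esub> s)" if s: "s \<in> S" for s
  proof -
    have "\<alpha> (center H #>\<^bsub>H\<^esub> s) \<in> rcosets\<^bsub>K\<^esub> center K"
      using bij_betwE[OF \<alpha>_bij] bij_betwE[OF bijS] s by blast
    then have "center K #>\<^bsub>K\<^esub> g s = \<alpha> (center H #>\<^bsub>H\<^esub> s)"
      using bijR unfolding g_def o_def bij_betw_def by (intro f_the_inv_into_f) auto
    then show ?thesis using K.rcos_self[OF _ K.subgroup_center] gR[OF s] RK by blast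
  qed
  have comm_iff: "s \<otimes>\<^bsub>H\<^esub> t = t \<otimes>\<^bsub>H\<^esub> s \<longleftrightarrow> g s \<otimes>\<^bsub>K\<^esub> g t = g t \<otimes>\<^bsub>K\<^esub> g s"
    if st: "s \<in> S" "t \<in> S" for s t
  proof -
    have c: "s \<in> carrier H" "t \<in> carrier H" "g s \<in> carrier K" "g t \<in> carrier K"
      using st SH RK gR by auto
    let ?DH = "derived_subgroup H" and ?DK = "derived_subgroup K"
    have "group ?DH" "group ?DK"
      unfolding derived_subgroup_def subgroup_of_def
      by (intro H.subgroup_imp_group K.subgroup_imp_group H.subgroup_derived K.subgroup_derived)+
    then have one: "\<beta> \<one>\<^bsub>H\<^esub> = \<one>\<^bsub>K\<^esub>"
      using hom_one[of \<beta> ?DH ?DK] \<beta> by (simp add: iso_def derived_subgroup_def subgroup_of_def)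
    have inj: "inj_on \<beta> (derived H (carrier H))"
      using \<beta> by (simp add: iso_def bij_betw_def derived_subgroup_def subgroup_of_def)
    have "s \<otimes>\<^bsub>H\<^esub> t = t \<otimes>\<^bsub>H\<^esub> s \<longleftrightarrow> commutator H s t = \<one>\<^bsub>H\<^esub>"
      using H.commutator_eq_one_iff c by simp
    also have "\<dots> \<longleftrightarrow> \<beta> (commutator H s t) = \<beta> \<one>\<^bsub>H\<^esub>"
      using inj_on_eq_iff[OF inj] H.commutator_in_derived[OF c(1,2)]
        subgroup.one_closed[OF H.subgroup_derived] by simp
    also have "\<dots> \<longleftrightarrow> commutator K (g s) (g t) = \<one>\<^bsub>K\<^esub>"
      using comp[OF c(1,2) g_mem[OF st(1)] g_mem[OF st(2)]] one by simp
    also have "\<dots> \<longleftrightarrow> g s \<otimes>\<^bsub>K\<^esub> g t = g t \<otimes>\<^bsub>K\<^esub> g s"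
      using K.commutator_eq_one_iff c by simp
    finally show ?thesis .
  qed
  have "bij_betw (map_prod g g) (S \<times> S) (R \<times> R)" using g g by (rule bij_betw_map_prod)
  then have "bij_betw (map_prod g g) (commuting_pairs H \<inter> (S \<times> S)) (commuting_pairs K \<inter> (R \<times> R))"
  proof (rule bij_betw_subset)
    show "commuting_pairs H \<inter> (S \<times> S) \<subseteq> S \<times> S" by blast
    have gS: "g ` S = R" using g by (simp add: bij_betw_def)
    show "map_prod g g ` (commuting_pairs H \<inter> (S \<times> S)) = commuting_pairs K \<inter> (R \<times> R)"
    proof (intro antisym subsetI)
      fix p assume "p \<in> map_prod g g ` (commuting_pairs H \<inter> (S \<times> S))"
      then obtain s t where "s \<in> S" "t \<in> S" "(s, t) \<in> commuting_pairs H" "p = (g s, g t)" by auto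
      then show "p \<in> commuting_pairs K \<inter> (R \<times> R)"
        using comm_iff[of s t] gR RK by (auto simp: commuting_pairs_def)
    next
      fix p assume p: "p \<in> commuting_pairs K \<inter> (R \<times> R)"
      then obtain s t where st: "s \<in> S" "t \<in> S" "p = (g s, g t)" using gS by blast
      then have "(s, t) \<in> commuting_pairs H \<inter> (S \<times> S)"
        using p comm_iff[of s t] SH by (auto simp: commuting_pairs_def)
      then show "p \<in> map_prod g g ` (commuting_pairs H \<inter> (S \<times> S))"
        using st by (intro image_eqI[of _ _ "(s, t)"]) auto
    qed
  qed
  then show "card (commuting_pairs H \<inter> (S \<times> S)) = card (commuting_pairs K \<inter> (R \<times> R))"
    by (rule bij_betw_same_card)
qed

lemma cp_eq: "cp G T = measure (haar (G \<times>\<times> G) (prod_topology T T)) (commuting_pairs G)"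
  by (simp add: cp_def commuting_pairs_def)

lemma (in compact_group) haar_square_haar:
  "haar_square G T (haar (G \<times>\<times> G) (prod_topology T T))"
  using compact_group.is_normalized_haar_haar[OF compact_group_DirProd[OF compact_group_axioms]]
  by (simp add: haar_square_def haar_square_axioms_def compact_group_axioms)

lemma (in compact_group) cp_center_transversal:
  assumes "center_transversal G S"
  shows "cp G T = card (commuting_pairs G \<inter> (S \<times> S)) / (card S)\<^sup>2"
proof -
  interpret haar_square G T "haar (G \<times>\<times> G) (prod_topology T T)" by (rule haar_square_haar)
  have one: "rcosets (carrier G) = {carrier G}"
    using coset_join2[OF _ subgroup_self] by (auto simp: rcosets_image)
  have clG: "closedin T (carrier G)" using closedin_topspace[of T] by (simp add: topspace_eq)
  have clZ: "closedin T (center G)"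
    unfolding center_eq_centralizer by (rule closedin_centralizer) simp
  have "measure (haar (G \<times>\<times> G) (prod_topology T T)) (commuting_pairs G \<inter> (carrier G \<times> carrier G))
     = card (commuting_pairs G \<inter> (S \<times> S)) / (card S)\<^sup>2 * (1 / card (rcosets (carrier G)))\<^sup>2"
    by (rule measure_commuting_finite_index[OF subgroup_self clG _ subgroup_center clZ center_subset center_comm])
      (use center_transversalD[OF assms] one in auto)
  moreover have "commuting_pairs G = commuting_pairs G \<inter> (carrier G \<times> carrier G)"
    by (auto simp: commuting_pairs_def)
  ultimately show ?thesis by (simp add: cp_eq one)
qed

lemma (in compact_group) compact_group_closed_subgroup:
  assumes F: "subgroup F G" "closedin T F"
  shows "compact_group (subgroup_of G F) (subtopology T F)"
proof -
  have FG: "F \<subseteq> carrier G" by (rule subgroup.subset[OF F(1)])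
  have g: "group (subgroup_of G F)" unfolding subgroup_of_def by (rule subgroup_imp_group[OF F(1)])
  let ?S = "subtopology T F"
  have top: "topspace ?S = F" using FG by (auto simp: topspace_eq)
  show ?thesis
  proof (intro compact_group.intro g compact_group_axioms.intro)
    show "topspace ?S = carrier (subgroup_of G F)" using top by (simp add: subgroup_of_def)
    have "continuous_map (subtopology (prod_topology T T) (F \<times> F)) ?S (\<lambda>(x, y). x \<otimes> y)"
      using continuous_map_from_subtopology[OF continuous_mult, of "F \<times> F"] subgroup.m_closed[OF F(1)]
      by (auto simp: continuous_map_in_subtopology)
    then show "continuous_map (prod_topology ?S ?S) ?S (\<lambda>(x, y). x \<otimes>\<^bsub>subgroup_of G F\<^esub> y)"
      by (simp add: subtopology_Times subgroup_of_def)
    have "continuous_map ?S ?S (m_inv G)"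
      using continuous_map_from_subtopology[OF continuous_inv, of F] subgroup.m_inv_closed[OF F(1)]
      by (auto simp: continuous_map_in_subtopology)
    then show "continuous_map ?S ?S (m_inv (subgroup_of G F))"
      by (rule continuous_map_eq) (use top F(1) in \<open>simp add: subgroup_of_def\<close>)
    have "compactin T F" using F(2) compact by (simp add: closedin_compact_space)
    then show "compact_space ?S" by (rule compact_space_subtopology)
    show "Hausdorff_space ?S" using Hausdorff by (rule Hausdorff_space_subtopology)
  qed
qed

lemma compact_group_discrete:
  assumes "group H" "finite (carrier H)"
  shows "compact_group H (discrete_topology (carrier H))"
proof -
  interpret group H by fact
  show ?thesis
  proof (intro compact_group.intro assms compact_group_axioms.intro)
    show "continuous_map (prod_topology (discrete_topology (carrier H)) (discrete_topology (carrier H)))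
        (discrete_topology (carrier H)) (\<lambda>(x, y). x \<otimes>\<^bsub>H\<^esub> y)"
      by (auto simp flip: prod_topology_discrete_topology)
  qed (use assms in \<open>auto simp: compact_space_discrete_topology\<close>)
qed

theorem cp_finite_isoclinic:
  fixes G :: "('a, 'b) monoid_scheme" (structure) and T :: "'a topology"
  assumes G: "compact_group G T" and fin: "finite (rcosets\<^bsub>G\<^esub> FC G)"
  obtains H :: "nat monoid" where "group H" "finite (carrier H)"
    "isoclinic H (subgroup_of G (FC G))"
    "cp (subgroup_of G (FC G)) (subtopology T (FC G)) = cp H (discrete_topology (carrier H))"
    "cp G T = cp H (discrete_topology (carrier H)) * (inverse_index G (FC G))\<^sup>2"
proof -
  interpret compact_group G T by fact
  let ?F = "FC G" and ?FG = "subgroup_of G (FC G)"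
  interpret haar_square G T "haar (G \<times>\<times> G) (prod_topology T T)" by (rule haar_square_haar)
  have F: "subgroup ?F G" by (rule subgroup_FC)
  have FG: "?F \<subseteq> carrier G" by (rule subgroup.subset[OF F])
  have clF: "closedin T ?F" and finZ: "finite (rcosets (?F \<inter> centralizer G ?F))"
    using center_FC_finite_index[OF fin] by auto
  interpret F: compact_group ?FG "subtopology T ?F" by (rule compact_group_closed_subgroup[OF F clF])
  have cenF: "center ?FG = ?F \<inter> centralizer G ?F"
    using FG by (auto simp: center_def centralizer_def subgroup_of_def)
  have "rcosets\<^bsub>?FG\<^esub> center ?FG \<subseteq> rcosets (?F \<inter> centralizer G ?F)"
    using FG unfolding cenF by (auto simp: RCOSETS_def r_coset_def subgroup_of_def)
  then have finF: "finite (rcosets\<^bsub>?FG\<^esub> center ?FG)" using finZ by (rule finite_subset)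
  obtain H :: "nat monoid" where H: "group H" "finite (carrier H)" "isoclinic H ?FG"
    using F.finite_isoclinic[OF finF] .
  interpret H: compact_group H "discrete_topology (carrier H)" by (rule compact_group_discrete[OF H(1,2)])
  obtain S where S: "center_transversal ?FG S" using F.exists_center_transversal[OF finF] .
  have "finite (rcosets\<^bsub>H\<^esub> center H)" unfolding H.rcosets_image using H(2) by simp
  then obtain R where R: "center_transversal H R" using H.exists_center_transversal by blast
  have cpFH: "cp ?FG (subtopology T ?F) = cp H (discrete_topology (carrier H))"
    using F.cp_center_transversal[OF S] H.cp_center_transversal[OF R]
      isoclinic_transversal_card[OF H(1) F.is_group H(3) R S] by simp
  have SF: "S \<subseteq> ?F" using center_transversalD(1)[OF S] by (simp add: subgroup_of_def)
  have inv: "inv\<^bsub>?FG\<^esub> s = inv s" if "s \<in> S" for s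
    using that SF F by (simp add: subgroup_of_def subset_iff)
  have "cp G T = measure (haar (G \<times>\<times> G) (prod_topology T T)) (commuting_pairs G \<inter> (?F \<times> ?F))"
    unfolding cp_eq by (rule measure_commuting_pairs)
  also have "\<dots> = card (commuting_pairs G \<inter> (S \<times> S)) / (card S)\<^sup>2 * (1 / card (rcosets ?F))\<^sup>2"
  proof (rule measure_commuting_finite_index[OF F clF fin])
    show "subgroup (?F \<inter> centralizer G ?F) G"
      using F subgroup_centralizer[OF FG] by (rule subgroups_Inter_pair)
    show "closedin T (?F \<inter> centralizer G ?F)"
      using clF closedin_centralizer[OF FG] by (rule closedin_Int)
    show "\<forall>s\<in>S. \<forall>t\<in>S. inv s \<otimes> t \<in> ?F \<inter> centralizer G ?F \<longrightarrow> s = t"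
      using center_transversalD(4)[OF S] inv unfolding cenF by (simp add: subgroup_of_def)
    show "\<forall>x\<in>?F. \<exists>s\<in>S. inv s \<otimes> x \<in> ?F \<inter> centralizer G ?F"
    proof
      fix x assume "x \<in> ?F"
      then obtain s where "s \<in> S" "inv\<^bsub>?FG\<^esub> s \<otimes> x \<in> ?F \<inter> centralizer G ?F"
        using center_transversalD(3)[OF S, of x] unfolding cenF by (auto simp: subgroup_of_def)
      then show "\<exists>s\<in>S. inv s \<otimes> x \<in> ?F \<inter> centralizer G ?F" using inv by metis
    qed
    show "S \<subseteq> ?F" "finite S" using SF center_transversalD(2)[OF S] by auto
  qed (auto simp: centralizer_def)
  also have "commuting_pairs G \<inter> (S \<times> S) = commuting_pairs ?FG \<inter> (S \<times> S)"
    using SF FG by (auto simp: commuting_pairs_def subgroup_of_def)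
  also have "card (commuting_pairs ?FG \<inter> (S \<times> S)) / (card S)\<^sup>2 = cp ?FG (subtopology T ?F)"
    using F.cp_center_transversal[OF S] by simp
  also have "1 / card (rcosets ?F) = inverse_index G ?F" using fin by (simp add: inverse_index_def)
  finally have "cp G T = cp ?FG (subtopology T ?F) * (inverse_index G ?F)\<^sup>2" .
  then show ?thesis using that[OF H cpFH] cpFH by simp
qed

theorem theorem1p1:
  fixes G :: "('a, 'b) monoid_scheme" and T :: "'a topology"
  assumes "compact_group G T"
  shows "\<exists>H :: nat monoid. group H \<and> finite (carrier H) \<and>
           cp G T = cp H (discrete_topology (carrier H)) * (inverse_index G (FC G))\<^sup>2 \<and>
           (cp G T > 0 \<longrightarrow>
              isoclinic H (subgroup_of G (FC G)) \<and>
              cp (subgroup_of G (FC G)) (subtopology T (FC G)) =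
                cp H (discrete_topology (carrier H)))"
proof (cases "finite (rcosets\<^bsub>G\<^esub> FC G)")
  case True
  obtain H :: "nat monoid" where "group H" "finite (carrier H)"
    "isoclinic H (subgroup_of G (FC G))"
    "cp (subgroup_of G (FC G)) (subtopology T (FC G)) = cp H (discrete_topology (carrier H))"
    "cp G T = cp H (discrete_topology (carrier H)) * (inverse_index G (FC G))\<^sup>2"
    using cp_finite_isoclinic[OF assms True] .
  then show ?thesis by (intro exI[of _ H]) simp
next
  case False
  interpret compact_group G T by fact
  interpret haar_square G T "haar (G \<times>\<times> G) (prod_topology T T)" by (rule haar_square_haar)
  have "cp G T = 0" unfolding cp_eq by (rule measure_commuting_pairs_eq_0[OF False])
  moreover have "inverse_index G (FC G) = 0" using False by (simp add: inverse_index_def)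
  moreover define H :: "nat monoid" where "H = \<lparr>carrier = {0}, mult = \<lambda>_ _. 0, one = 0\<rparr>"
  have "group H" by (rule groupI) (auto simp: H_def)
  moreover have "finite (carrier H)" by (simp add: H_def)
  ultimately show ?thesis by (intro exI[of _ H]) simp
qed

end
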